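(* Let $(-)^{\bullet}$ be the interpretation of the intensional level $\mathbf{mTT}$ of the Minimalist Foundation in Homotopy Type Theory ($\mathbf{HoTT}$) described in the context. If $\mathcal{J}$ is a judgement derivable in $\mathbf{mTT}$, then its interpretation $\mathcal{J}^{\bullet}$ holds in $\mathbf{HoTT}$ (that is, it is defined and all the $\mathbf{HoTT}$-judgements it consists of are derivable). Moreover, if $P\ prop\ [\Gamma]$ or $P\ prop_s\ [\Gamma]$ is derivable in $\mathbf{mTT}$, then $\mathsf{pr_S}(P^{\bullet}):\mathsf{isSet}(P^{\bullet})\ [\Gamma^{\bullet}]$ is derivable in $\mathbf{HoTT}$, where $\mathsf{pr_S}(P^{\bullet}):\equiv \mathfrak{s}_{coe}(P^{\bullet},\mathsf{pr_P}(P^{\bullet}))$.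
   Context: **The theory HoTT.** Intensional Martin-Löf type theory as in the HoTT Book: types $\mathbf 0,\mathbf 1,\mathbb N,+,\mathsf{List},\Pi,\Sigma,\mathrm{Id}$ (also written $=$), a cumulative hierarchy of univalent universes $\mathcal U_0:\mathcal U_1:\dots$, and higher inductive types, among them propositional truncation $\|A\|$ with constructors $|-|:A\to\|A\|$ and $\mathsf{sq}_A:\Pi_{x,y:\|A\|}\,x=y$ and eliminator $\mathsf{ind}_{\|\ \|}(e,x.c,s):C$ for $e:\|A\|$, $c:C\ [x:A]$, $s:\mathsf{isProp}(C)$, with $\mathsf{ind}_{\|\ \|}(|a|,x.c,s)\equiv c[a/x]$. Definitional equality is $\equiv$. Put $\mathsf{isProp}(A):\equiv\Pi_{x,y:A}\,x=y$, $\mathsf{isSet}(A):\equiv\Pi_{x,y:A}\Pi_{p,q:x=y}\,p=q$, $\mathsf{Prop}_{\mathcal U_i}:\equiv\Sigma_{X:\mathcal U_i}\mathsf{isProp}(X)$, $\mathsf{Set}_{\mathcal U_i}:\equiv\Sigma_{X:\mathcal U_i}\mathsf{isSet}(X)$; projections are $\mathsf{pr}_1,\mathsf{pr}_2$. For h-propositions: $P\vee Q:\equiv\|P+Q\|$, $\mathsf{inl}_\vee(p):\equiv|\mathsf{inl}(p)|$, $\mathsf{inr}_\vee(q):\equiv|\mathsf{inr}(q)|$, $\mathsf{ind}_\vee(e,x.l_1,y.l_2,s):\equiv\mathsf{ind}_{\|\ \|}(e,z.\mathsf{ind}_+(z,x.l_1,y.l_2),s)$; $\exists_{x:A}P(x):\equiv\|\Sigma_{x:A}P(x)\|$,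 $(a,_\exists p):\equiv|(a,p)|$, $\mathsf{ind}_\exists(e,x.y.l,s):\equiv\mathsf{ind}_{\|\ \|}(e,z.\mathsf{ind}_\Sigma(z,x.y.l),s)$. Fix once and for all closed $\mathbf{HoTT}$-terms (any choice will do), for the relevant universes $\mathcal U_i$: $\mathfrak p_0:\mathsf{isProp}(\mathbf 0)$; $\mathfrak p_\to:\Pi_{A,B:\mathcal U_i}\Pi_{q:\mathsf{isProp}(B)}\mathsf{isProp}(A\to B)$; $\mathfrak p_\times:\Pi_{A,B:\mathcal U_i}\Pi_{p:\mathsf{isProp}(A)}\Pi_{q:\mathsf{isProp}(B)}\mathsf{isProp}(A\times B)$; $\mathfrak p_\Pi:\Pi_{A:\mathcal U_i}\Pi_{B:A\to\mathcal U_i}\Pi_{p:\Pi_{x:A}\mathsf{isProp}(B(x))}\mathsf{isProp}(\Pi_{x:A}B(x))$; $\mathfrak p_\vee:\Pi_{A,B:\mathcal U_i}\mathsf{isProp}(A\vee B)$; $\mathfrak p_\exists:\Pi_{A:\mathcal U_i}\Pi_{B:A\to\mathcal U_i}\mathsf{isProp}(\exists_{x:A}B(x))$; $\mathfrak p_{Id}:\Pi_{A:\mathcal U_i}\Pi_{s:\mathsf{isSet}(A)}\Pi_{a,b:A}\mathsf{isProp}(\mathrm{Id}_A(a,b))$; $\mathfrak s_{coe}:\Pi_{A:\mathcal U_i}\mathsf{isProp}(A)\to\mathsf{isSet}(A)$; $\mathfrak s_0:\mathsf{isSet}(\mathbf 0)$, $\mathfrak s_1:\mathsf{isSet}(\mathbf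 1)$; $\mathfrak s_\Pi:\Pi_{A:\mathcal U_i}\Pi_{B:A\to\mathcal U_i}\Pi_{s:\Pi_{x:A}\mathsf{isSet}(B(x))}\mathsf{isSet}(\Pi_{x:A}B(x))$; $\mathfrak s_\Sigma:\Pi_{A:\mathcal U_i}\Pi_{B:A\to\mathcal U_i}\Pi_{s:\mathsf{isSet}(A)}\Pi_{t:\Pi_{x:A}\mathsf{isSet}(B(x))}\mathsf{isSet}(\Sigma_{x:A}B(x))$; $\mathfrak s_+:\Pi_{A,B:\mathcal U_i}\Pi_{s:\mathsf{isSet}(A)}\Pi_{t:\mathsf{isSet}(B)}\mathsf{isSet}(A+B)$; $\mathfrak s_{\mathsf{List}}:\Pi_{A:\mathcal U_i}\Pi_{s:\mathsf{isSet}(A)}\mathsf{isSet}(\mathsf{List}(A))$; $\mathfrak s_{\mathsf{Prop}_0}:\mathsf{isSet}(\mathsf{Prop}_{\mathcal U_0})$. **The theory mTT.** A dependent type theory in the style of intensional Martin-Löf type theory with four sorts of types: $A\ set$, $A\ col$ (collections), $P\ prop$, $P\ prop_s$ (small propositions), all relative to contexts $[\Gamma]$; further judgements are definitional equality of types of each sort, $a\in A\ [\Gamma]$, and $a=b\in A\ [\Gamma]$. Structural rules: formation of contexts from types of any sort, variables, definitional equality is an equivalence relation, conversion ($a\in A$ and $A=B$ give $a\in B$), substitution of equal terms into types. Term congruence rules (in particular the $\xi$-rule) are absent and replaced by: from $c(x_1,\dots,x_n)\in C(x_1,\dots,x_n)\ [x_1\in A_1,\dots,x_n\in A_n(x_1,\dots,x_{n-1})]$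 and $a_i=b_i\in A_i(a_1,\dots,a_{i-1})$ for all $i$ infer $c(a_1,\dots,a_n)=c(b_1,\dots,b_n)\in C(a_1,\dots,a_n)$. Subsumption: every $prop_s$ is a $set$ and a $prop$, every $prop$ and every $set$ is a $col$ (and the same for equalities). *Sets*: $\mathsf N_0$ (eliminator $\mathsf{emp}_0$), $\mathsf N_1$ ($\star$, $\mathrm{El}_{\mathsf N_1}$), $\mathsf{List}(A)$ ($\epsilon$, $\mathsf{cons}(\ell,a)$, $\mathrm{El}_{\mathsf{List}}$), $A+B$ ($\mathsf{inl},\mathsf{inr},\mathrm{El}_+$), $\Sigma_{x\in A}B(x)$ ($\langle a,b\rangle$, $\mathrm{El}_\Sigma$), $\Pi_{x\in A}B(x)$ ($\lambda x.b$, $\mathsf{Ap}$), for $A$, $B$ sets, with the usual formation, introduction, (dependent, towards collections) elimination and $\beta$-rules of intensional Martin-Löf type theory. *Collections*: additionally $\Sigma_{x\in A}B(x)$ for collections $A,B(x)$; $\mathsf{prop_s}$ (the collection of small propositions); $A\to\mathsf{prop_s}$ for a set $A$ (with $\lambda$, $\mathsf{Ap}$, $\beta$). *Propositions*: $\bot$ ($\mathsf r_0$), $A\vee B$ ($\mathsf{inl}_\vee,\mathsf{inr}_\vee,\mathrm{El}_\vee$), $A\wedge B$ ($\langle a,_\wedge b\rangle,\pi_1,\pi_2$), $A\to B$ ($\lambda_\to,\mathsf{Ap}_\to$), for propositions $A,B$; $\exists_{x\in A}B(x)$ ($\langle a,_\exists b\rangle,\mathrm{El}_\exists$), $\forall_{x\in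 A}B(x)$ ($\lambda_\forall,\mathsf{Ap}_\forall$) for a collection $A$ and propositions $B(x)$; $\mathrm{Id}(A,a,b)$ for a collection $A$ ($\mathsf{id}_A(a)\in\mathrm{Id}(A,a,a)$; from $C(x,y)\ prop\ [x,y\in A]$, $p\in\mathrm{Id}(A,a,b)$, $c(x)\in C(x,x)\ [x\in A]$ infer $\mathrm{El}_{\mathrm{Id}}(p,c)\in C(a,b)$, with $\mathrm{El}_{\mathrm{Id}}(\mathsf{id}_A(a),c)=c(a)$). These have the natural-deduction rules with proof terms and $\beta$-equalities, and the eliminators of $\bot,\vee,\exists,\mathrm{Id}$ act towards propositions only. *Small propositions*: the propositions $\bot$, and $\vee,\wedge,\to$ of small propositions, $\exists_{x\in A},\forall_{x\in A}$ of small propositions with $A$ a set, $\mathrm{Id}(A,a,b)$ with $A$ a set. *Codes*: $\widehat\bot\in\mathsf{prop_s}$; if $p,q\in\mathsf{prop_s}$ then $p\,\widehat\vee\,q,\ p\,\widehat\wedge\,q,\ p\,\widehat\to\,q\in\mathsf{prop_s}$; if $A\ set$ and $p\in\mathsf{prop_s}\ [x\in A]$ then $\widehat{\forall}_{x\in A}p,\ \widehat{\exists}_{x\in A}p\in\mathsf{prop_s}$; if $A\ set$, $a,b\in A$ then $\widehat{\mathrm{Id}}(A,a,b)\in\mathsf{prop_s}$. If $p\in\mathsf{prop_s}$ then $\tau(p)\ prop_s$, with definitional equalities $\tau(\widehat\bot)=\bot$, $\tau(p\,\widehat\vee\,q)=\tau(p)\vee\tau(q)$, likewise for $\wedge,\to$,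 $\tau(\widehat\forall_{x\in A}p)=\forall_{x\in A}\tau(p)$, $\tau(\widehat\exists_{x\in A}p)=\exists_{x\in A}\tau(p)$, $\tau(\widehat{\mathrm{Id}}(A,a,b))=\mathrm{Id}(A,a,b)$. **The interpretation.** A partial map $(-)^\bullet$ from raw types and terms of $\mathbf{mTT}$ to those of $\mathbf{HoTT}$, defined together with proof terms $\mathsf{pr_P}(A^\bullet)$ (meant to witness $\mathsf{isProp}(A^\bullet)$) and $\mathsf{pr_S}(A^\bullet)$ (meant to witness $\mathsf{isSet}(A^\bullet)$), by recursion on the $\mathbf{mTT}$-expression. Variables: $x^\bullet:\equiv x$. Contexts: the empty context goes to the empty context, $(\Gamma,x\in A)^\bullet:\equiv\Gamma^\bullet,x:A^\bullet$. Types: - $(\mathsf{prop_s})^\bullet:\equiv\mathsf{Prop}_{\mathcal U_0}$, $\mathsf{pr_S}:\equiv\mathfrak s_{\mathsf{Prop}_0}$. $(A\to\mathsf{prop_s})^\bullet:\equiv A^\bullet\to\mathsf{Prop}_{\mathcal U_0}$, $\mathsf{pr_S}:\equiv\mathfrak s_\Pi(A^\bullet,\lambda x.\mathsf{Prop}_{\mathcal U_0},\lambda x.\mathfrak s_{\mathsf{Prop}_0})$. - $(\tau(p))^\bullet:\equiv\mathsf{pr}_1(p^\bullet)$, $\mathsf{pr_P}:\equiv\mathsf{pr}_2(p^\bullet)$. - $\mathsf N_0,\mathsf N_1,\mathsf{List}(A),A+B,\Sigma_{x\in A}B(x),\Pi_{x\in A}B(x)$ go to $\mathbf 0,\mathbf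 1,\mathsf{List}(A^\bullet),A^\bullet+B^\bullet,\Sigma_{x:A^\bullet}B(x)^\bullet,\Pi_{x:A^\bullet}B(x)^\bullet$, with $\mathsf{pr_S}$ equal respectively to $\mathfrak s_0$, $\mathfrak s_1$, $\mathfrak s_{\mathsf{List}}(A^\bullet,\mathsf{pr_S}(A^\bullet))$, $\mathfrak s_+(A^\bullet,B^\bullet,\mathsf{pr_S}(A^\bullet),\mathsf{pr_S}(B^\bullet))$, $\mathfrak s_\Sigma(A^\bullet,\lambda x.B(x)^\bullet,\mathsf{pr_S}(A^\bullet),\lambda x.\mathsf{pr_S}(B(x)^\bullet))$, $\mathfrak s_\Pi(A^\bullet,\lambda x.B(x)^\bullet,\lambda x.\mathsf{pr_S}(B(x)^\bullet))$. - $\bot,\ A\vee B,\ A\wedge B,\ A\to B,\ \exists_{x\in A}B(x),\ \forall_{x\in A}B(x),\ \mathrm{Id}(A,a,b)$ go to $\mathbf 0$, $A^\bullet\vee B^\bullet$, $A^\bullet\times B^\bullet$, $A^\bullet\to B^\bullet$, $\exists_{x:A^\bullet}B(x)^\bullet$, $\Pi_{x:A^\bullet}B(x)^\bullet$, $\mathrm{Id}_{A^\bullet}(a^\bullet,b^\bullet)$, with $\mathsf{pr_P}$ equal respectively to $\mathfrak p_0$, $\mathfrak p_\vee(A^\bullet,B^\bullet)$, $\mathfrak p_\times(A^\bullet,B^\bullet,\mathsf{pr_P}(A^\bullet),\mathsf{pr_P}(B^\bullet))$, $\mathfrak p_\to(A^\bullet,B^\bullet,\mathsf{pr_P}(B^\bullet))$,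 $\mathfrak p_\exists(A^\bullet,\lambda x.B(x)^\bullet)$, $\mathfrak p_\Pi(A^\bullet,\lambda x.B(x)^\bullet,\lambda x.\mathsf{pr_P}(B(x)^\bullet))$, $\mathfrak p_{Id}(A^\bullet,\mathsf{pr_S}(A^\bullet),a^\bullet,b^\bullet)$. - For every propositional type former $P$ (including $\tau(p)$): $\mathsf{pr_S}(P^\bullet):\equiv\mathfrak s_{coe}(P^\bullet,\mathsf{pr_P}(P^\bullet))$. Codes: each goes to the pair of the corresponding type and its proof: $(\widehat\bot)^\bullet:\equiv(\mathbf 0,\mathfrak p_0)$; $(p\,\widehat\vee\,q)^\bullet:\equiv(\mathsf{pr}_1(p^\bullet)\vee\mathsf{pr}_1(q^\bullet),\mathfrak p_\vee(\mathsf{pr}_1(p^\bullet),\mathsf{pr}_1(q^\bullet)))$; $(p\,\widehat\wedge\,q)^\bullet:\equiv(\mathsf{pr}_1(p^\bullet)\times\mathsf{pr}_1(q^\bullet),\mathfrak p_\times(\mathsf{pr}_1(p^\bullet),\mathsf{pr}_1(q^\bullet),\mathsf{pr}_2(p^\bullet),\mathsf{pr}_2(q^\bullet)))$; $(p\,\widehat\to\,q)^\bullet:\equiv(\mathsf{pr}_1(p^\bullet)\to\mathsf{pr}_1(q^\bullet),\mathfrak p_\to(\mathsf{pr}_1(p^\bullet),\mathsf{pr}_1(q^\bullet),\mathsf{pr}_2(q^\bullet)))$; $(\widehat\exists_{x\in A}p)^\bullet:\equiv(\exists_{x:A^\bullet}\mathsf{pr}_1(p^\bullet),\mathfrak p_\exists(A^\bullet,\lambda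 x.\mathsf{pr}_1(p^\bullet)))$; $(\widehat\forall_{x\in A}p)^\bullet:\equiv(\Pi_{x:A^\bullet}\mathsf{pr}_1(p^\bullet),\mathfrak p_\Pi(A^\bullet,\lambda x.\mathsf{pr}_1(p^\bullet),\lambda x.\mathsf{pr}_2(p^\bullet)))$; $(\widehat{\mathrm{Id}}(A,a,b))^\bullet:\equiv(\mathrm{Id}_{A^\bullet}(a^\bullet,b^\bullet),\mathfrak p_{Id}(A^\bullet,\mathsf{pr_S}(A^\bullet),a^\bullet,b^\bullet))$. Other terms: each constructor and eliminator goes to the corresponding one, applied to the interpreted arguments: $\mathsf{emp}_0,\mathsf r_0\mapsto\mathsf{ind}_0$; $\star\mapsto\star$, $\mathrm{El}_{\mathsf N_1}\mapsto\mathsf{ind}_1$; $\epsilon\mapsto\mathsf{nil}$, $\mathsf{cons}\mapsto\mathsf{cons}$, $\mathrm{El}_{\mathsf{List}}\mapsto\mathsf{ind}_{\mathsf{List}}$; $\mathsf{inl},\mathsf{inr},\mathrm{El}_+\mapsto\mathsf{inl},\mathsf{inr},\mathsf{ind}_+$; $\langle a,b\rangle,\langle a,_\wedge b\rangle\mapsto(a^\bullet,b^\bullet)$; $\mathrm{El}_\Sigma\mapsto\mathsf{ind}_\Sigma$; $\pi_i\mapsto\mathsf{pr}_i$; all abstractions $\lambda,\lambda_\to,\lambda_\forall\mapsto\lambda$ and all applications $\mapsto$ application; $\mathsf{inl}_\vee,\mathsf{inr}_\vee\mapsto\mathsf{inl}_\vee,\mathsf{inr}_\vee$, $\langle a,_\exists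 b\rangle\mapsto(a^\bullet,_\exists b^\bullet)$; $\mathrm{El}_\vee,\mathrm{El}_\exists\mapsto\mathsf{ind}_\vee,\mathsf{ind}_\exists$ with last argument $s:\equiv\mathsf{pr_P}(C^\bullet)$ for the target proposition $C$; $\mathsf{id}_A(a)\mapsto\mathsf{refl}_{a^\bullet}$, $\mathrm{El}_{\mathrm{Id}}\mapsto\mathsf{ind}_{\mathrm{Id}}$. Judgements: - $(A\ set\ [\Gamma])^\bullet$: $A^\bullet:\mathcal U_0\ [\Gamma^\bullet]$ and $\mathsf{pr_S}(A^\bullet):\mathsf{isSet}(A^\bullet)\ [\Gamma^\bullet]$ is derivable; $(A\ col\ [\Gamma])^\bullet$: the same with $\mathcal U_1$. - $(P\ prop_s\ [\Gamma])^\bullet$: $P^\bullet:\mathcal U_0\ [\Gamma^\bullet]$ and $\mathsf{pr_P}(P^\bullet):\mathsf{isProp}(P^\bullet)\ [\Gamma^\bullet]$ is derivable; $(P\ prop\ [\Gamma])^\bullet$: the same with $\mathcal U_1$. - $(A=B\ set\ [\Gamma])^\bullet$, resp. $col$: $(A^\bullet,\mathsf{pr_S}(A^\bullet))\equiv(B^\bullet,\mathsf{pr_S}(B^\bullet)):\mathsf{Set}_{\mathcal U_0}$, resp. $\mathsf{Set}_{\mathcal U_1}$, in context $\Gamma^\bullet$. - $(P=Q\ prop_s\ [\Gamma])^\bullet$, resp. $prop$: $(P^\bullet,\mathsf{pr_P}(P^\bullet))\equiv(Q^\bullet,\mathsf{pr_P}(Q^\bullet)):\mathsf{Prop}_{\mathcal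 U_0}$, resp. $\mathsf{Prop}_{\mathcal U_1}$, in context $\Gamma^\bullet$. - $(a\in A\ [\Gamma])^\bullet$: $a^\bullet:A^\bullet\ [\Gamma^\bullet]$; $(a=b\in A\ [\Gamma])^\bullet$: $a^\bullet\equiv b^\bullet:A^\bullet\ [\Gamma^\bullet]$. *)

theory Defs
  imports Main "HOL-Library.Monad_Syntax"
begin

text \<open>
  Both theories are presented with de Bruijn indices. A context is a list of types whose head is
  the type of the most recently declared variable; the \<open>i\<close>-th entry is a type over the entries
  after it. In a constructor that binds variables, the number of bound variables of each argument
  is given in a comment, and the last variable bound is index 0; an argument written
  \<open>(x,y,z)c\<close> on paper therefore has \<open>z\<close> = 0, \<open>y\<close> = 1, \<open>x\<close> = 2.
\<close>

abbreviation scons :: "'a \<Rightarrow> (nat \<Rightarrow> 'a) \<Rightarrow> nat \<Rightarrow> 'a"  (infixr "\<rhd>" 65)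
  where "a \<rhd> \<sigma> \<equiv> case_nat a \<sigma>"

definition upr :: "(nat \<Rightarrow> nat) \<Rightarrow> nat \<Rightarrow> nat"
  where "upr \<xi> = 0 \<rhd> (\<lambda>n. Suc (\<xi> n))"


section \<open>Homotopy type theory\<close>

subsection \<open>Raw syntax\<close>

text \<open>
  Types are terms (of some universe). Abstractions and eliminators carry no type annotations or
  motives, as in the notation \<open>ind\<^sub>+(z, x.l\<^sub>1, y.l\<^sub>2)\<close>. In \<^term>\<open>HList\<close> the constructor \<open>cons(l,a)\<close>
  takes the list first. \<open>HUa i\<close> is the univalence axiom for the universe \<open>i\<close>, and the constants
  \<open>HConst k\<close> are available to the further higher inductive types (see \<open>hott\<close> below).
\<close>

datatype htm =
    HVar nat
  | HConst nat
  | HUniv nat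
  | HPi htm htm             (* 0, 1 *)
  | HLam htm                (* 1 *)
  | HApp htm htm
  | HSig htm htm            (* 0, 1 *)
  | HPair htm htm
  | HIndSig htm htm         (* 0, 2 *)
  | HSum htm htm
  | HInl htm
  | HInr htm
  | HIndSum htm htm htm     (* 0, 1, 1 *)
  | HEmpty
  | HIndEmpty htm
  | HUnit
  | HStar
  | HIndUnit htm htm
  | HNat
  | HZero
  | HSuc htm
  | HIndNat htm htm htm     (* 0, 0, 2: predecessor, induction hypothesis *)
  | HList htm
  | HNil
  | HCons htm htm
  | HIndList htm htm htm    (* 0, 0, 3: tail, head, induction hypothesis *)
  | HId htm htm htm
  | HRefl htm
  | HIndId htm htm          (* 0, 1 *)
  | HTrunc htm
  | HTr htm
  | HSq htm
  | HIndTr htm htm htm      (* 0, 1, 0 *)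
  | HUa nat

primrec hren :: "(nat \<Rightarrow> nat) \<Rightarrow> htm \<Rightarrow> htm" where
  "hren \<xi> (HVar n) = HVar (\<xi> n)"
| "hren \<xi> (HConst k) = HConst k"
| "hren \<xi> (HUniv i) = HUniv i"
| "hren \<xi> (HPi A B) = HPi (hren \<xi> A) (hren (upr \<xi>) B)"
| "hren \<xi> (HLam b) = HLam (hren (upr \<xi>) b)"
| "hren \<xi> (HApp f a) = HApp (hren \<xi> f) (hren \<xi> a)"
| "hren \<xi> (HSig A B) = HSig (hren \<xi> A) (hren (upr \<xi>) B)"
| "hren \<xi> (HPair a b) = HPair (hren \<xi> a) (hren \<xi> b)"
| "hren \<xi> (HIndSig e c) = HIndSig (hren \<xi> e) (hren (upr (upr \<xi>)) c)"
| "hren \<xi> (HSum A B) = HSum (hren \<xi> A) (hren \<xi> B)"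
| "hren \<xi> (HInl a) = HInl (hren \<xi> a)"
| "hren \<xi> (HInr b) = HInr (hren \<xi> b)"
| "hren \<xi> (HIndSum e l r) = HIndSum (hren \<xi> e) (hren (upr \<xi>) l) (hren (upr \<xi>) r)"
| "hren \<xi> HEmpty = HEmpty"
| "hren \<xi> (HIndEmpty e) = HIndEmpty (hren \<xi> e)"
| "hren \<xi> HUnit = HUnit"
| "hren \<xi> HStar = HStar"
| "hren \<xi> (HIndUnit e c) = HIndUnit (hren \<xi> e) (hren \<xi> c)"
| "hren \<xi> HNat = HNat"
| "hren \<xi> HZero = HZero"
| "hren \<xi> (HSuc n) = HSuc (hren \<xi> n)"
| "hren \<xi> (HIndNat e z s) = HIndNat (hren \<xi> e) (hren \<xi> z) (hren (upr (upr \<xi>)) s)"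
| "hren \<xi> (HList A) = HList (hren \<xi> A)"
| "hren \<xi> HNil = HNil"
| "hren \<xi> (HCons l a) = HCons (hren \<xi> l) (hren \<xi> a)"
| "hren \<xi> (HIndList e n c) = HIndList (hren \<xi> e) (hren \<xi> n) (hren (upr (upr (upr \<xi>))) c)"
| "hren \<xi> (HId A a b) = HId (hren \<xi> A) (hren \<xi> a) (hren \<xi> b)"
| "hren \<xi> (HRefl a) = HRefl (hren \<xi> a)"
| "hren \<xi> (HIndId p c) = HIndId (hren \<xi> p) (hren (upr \<xi>) c)"
| "hren \<xi> (HTrunc A) = HTrunc (hren \<xi> A)"
| "hren \<xi> (HTr a) = HTr (hren \<xi> a)"
| "hren \<xi> (HSq A) = HSq (hren \<xi> A)"
| "hren \<xi> (HIndTr e c s) = HIndTr (hren \<xi> e) (hren (upr \<xi>) c) (hren \<xi> s)"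
| "hren \<xi> (HUa i) = HUa i"

definition hwk :: "nat \<Rightarrow> htm \<Rightarrow> htm"
  where "hwk k = hren (\<lambda>n. n + k)"

definition hup :: "(nat \<Rightarrow> htm) \<Rightarrow> nat \<Rightarrow> htm"
  where "hup \<sigma> = HVar 0 \<rhd> (\<lambda>n. hwk 1 (\<sigma> n))"

primrec hsub :: "(nat \<Rightarrow> htm) \<Rightarrow> htm \<Rightarrow> htm" where
  "hsub \<sigma> (HVar n) = \<sigma> n"
| "hsub \<sigma> (HConst k) = HConst k"
| "hsub \<sigma> (HUniv i) = HUniv i"
| "hsub \<sigma> (HPi A B) = HPi (hsub \<sigma> A) (hsub (hup \<sigma>) B)"
| "hsub \<sigma> (HLam b) = HLam (hsub (hup \<sigma>) b)"
| "hsub \<sigma> (HApp f a) = HApp (hsub \<sigma> f) (hsub \<sigma> a)"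
| "hsub \<sigma> (HSig A B) = HSig (hsub \<sigma> A) (hsub (hup \<sigma>) B)"
| "hsub \<sigma> (HPair a b) = HPair (hsub \<sigma> a) (hsub \<sigma> b)"
| "hsub \<sigma> (HIndSig e c) = HIndSig (hsub \<sigma> e) (hsub (hup (hup \<sigma>)) c)"
| "hsub \<sigma> (HSum A B) = HSum (hsub \<sigma> A) (hsub \<sigma> B)"
| "hsub \<sigma> (HInl a) = HInl (hsub \<sigma> a)"
| "hsub \<sigma> (HInr b) = HInr (hsub \<sigma> b)"
| "hsub \<sigma> (HIndSum e l r) = HIndSum (hsub \<sigma> e) (hsub (hup \<sigma>) l) (hsub (hup \<sigma>) r)"
| "hsub \<sigma> HEmpty = HEmpty"
| "hsub \<sigma> (HIndEmpty e) = HIndEmpty (hsub \<sigma> e)"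
| "hsub \<sigma> HUnit = HUnit"
| "hsub \<sigma> HStar = HStar"
| "hsub \<sigma> (HIndUnit e c) = HIndUnit (hsub \<sigma> e) (hsub \<sigma> c)"
| "hsub \<sigma> HNat = HNat"
| "hsub \<sigma> HZero = HZero"
| "hsub \<sigma> (HSuc n) = HSuc (hsub \<sigma> n)"
| "hsub \<sigma> (HIndNat e z s) = HIndNat (hsub \<sigma> e) (hsub \<sigma> z) (hsub (hup (hup \<sigma>)) s)"
| "hsub \<sigma> (HList A) = HList (hsub \<sigma> A)"
| "hsub \<sigma> HNil = HNil"
| "hsub \<sigma> (HCons l a) = HCons (hsub \<sigma> l) (hsub \<sigma> a)"
| "hsub \<sigma> (HIndList e n c) = HIndList (hsub \<sigma> e) (hsub \<sigma> n) (hsub (hup (hup (hup \<sigma>))) c)"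
| "hsub \<sigma> (HId A a b) = HId (hsub \<sigma> A) (hsub \<sigma> a) (hsub \<sigma> b)"
| "hsub \<sigma> (HRefl a) = HRefl (hsub \<sigma> a)"
| "hsub \<sigma> (HIndId p c) = HIndId (hsub \<sigma> p) (hsub (hup \<sigma>) c)"
| "hsub \<sigma> (HTrunc A) = HTrunc (hsub \<sigma> A)"
| "hsub \<sigma> (HTr a) = HTr (hsub \<sigma> a)"
| "hsub \<sigma> (HSq A) = HSq (hsub \<sigma> A)"
| "hsub \<sigma> (HIndTr e c s) = HIndTr (hsub \<sigma> e) (hsub (hup \<sigma>) c) (hsub \<sigma> s)"
| "hsub \<sigma> (HUa i) = HUa i"

primrec hscoped :: "nat \<Rightarrow> htm \<Rightarrow> bool" where
  "hscoped k (HVar n) \<longleftrightarrow> n < k"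
| "hscoped k (HConst c) \<longleftrightarrow> True"
| "hscoped k (HUniv i) \<longleftrightarrow> True"
| "hscoped k (HPi A B) \<longleftrightarrow> hscoped k A \<and> hscoped (k + 1) B"
| "hscoped k (HLam b) \<longleftrightarrow> hscoped (k + 1) b"
| "hscoped k (HApp f a) \<longleftrightarrow> hscoped k f \<and> hscoped k a"
| "hscoped k (HSig A B) \<longleftrightarrow> hscoped k A \<and> hscoped (k + 1) B"
| "hscoped k (HPair a b) \<longleftrightarrow> hscoped k a \<and> hscoped k b"
| "hscoped k (HIndSig e c) \<longleftrightarrow> hscoped k e \<and> hscoped (k + 2) c"
| "hscoped k (HSum A B) \<longleftrightarrow> hscoped k A \<and> hscoped k B"
| "hscoped k (HInl a) \<longleftrightarrow> hscoped k a"
| "hscoped k (HInr b) \<longleftrightarrow> hscoped k b"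
| "hscoped k (HIndSum e l r) \<longleftrightarrow> hscoped k e \<and> hscoped (k + 1) l \<and> hscoped (k + 1) r"
| "hscoped k HEmpty \<longleftrightarrow> True"
| "hscoped k (HIndEmpty e) \<longleftrightarrow> hscoped k e"
| "hscoped k HUnit \<longleftrightarrow> True"
| "hscoped k HStar \<longleftrightarrow> True"
| "hscoped k (HIndUnit e c) \<longleftrightarrow> hscoped k e \<and> hscoped k c"
| "hscoped k HNat \<longleftrightarrow> True"
| "hscoped k HZero \<longleftrightarrow> True"
| "hscoped k (HSuc n) \<longleftrightarrow> hscoped k n"
| "hscoped k (HIndNat e z s) \<longleftrightarrow> hscoped k e \<and> hscoped k z \<and> hscoped (k + 2) s"
| "hscoped k (HList A) \<longleftrightarrow> hscoped k A"
| "hscoped k HNil \<longleftrightarrow> True"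
| "hscoped k (HCons l a) \<longleftrightarrow> hscoped k l \<and> hscoped k a"
| "hscoped k (HIndList e n c) \<longleftrightarrow> hscoped k e \<and> hscoped k n \<and> hscoped (k + 3) c"
| "hscoped k (HId A a b) \<longleftrightarrow> hscoped k A \<and> hscoped k a \<and> hscoped k b"
| "hscoped k (HRefl a) \<longleftrightarrow> hscoped k a"
| "hscoped k (HIndId p c) \<longleftrightarrow> hscoped k p \<and> hscoped (k + 1) c"
| "hscoped k (HTrunc A) \<longleftrightarrow> hscoped k A"
| "hscoped k (HTr a) \<longleftrightarrow> hscoped k a"
| "hscoped k (HSq A) \<longleftrightarrow> hscoped k A"
| "hscoped k (HIndTr e c s) \<longleftrightarrow> hscoped k e \<and> hscoped (k + 1) c \<and> hscoped k s"
| "hscoped k (HUa i) \<longleftrightarrow> True"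

abbreviation hclosed :: "htm \<Rightarrow> bool"
  where "hclosed \<equiv> hscoped 0"

abbreviation hinst :: "htm \<Rightarrow> htm \<Rightarrow> htm"
  where "hinst B a \<equiv> hsub (a \<rhd> HVar) B"

text \<open>\<open>hat k u C\<close> replaces the last variable of \<open>C\<close> by the term \<open>u\<close>, which lives in the
  remaining context extended by \<open>k\<close> new variables.\<close>

definition hat :: "nat \<Rightarrow> htm \<Rightarrow> htm \<Rightarrow> htm"
  where "hat k u C = hsub (u \<rhd> (\<lambda>n. HVar (n + k))) C"


subsection \<open>Derived notions\<close>

definition hfun :: "htm \<Rightarrow> htm \<Rightarrow> htm"
  where "hfun A B = HPi A (hwk 1 B)"

definition hprod :: "htm \<Rightarrow> htm \<Rightarrow> htm"
  where "hprod A B = HSig A (hwk 1 B)"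

definition hpr1 :: "htm \<Rightarrow> htm"
  where "hpr1 d = HIndSig d (HVar 1)"

definition hpr2 :: "htm \<Rightarrow> htm"
  where "hpr2 d = HIndSig d (HVar 0)"

definition hisprop :: "htm \<Rightarrow> htm"
  where "hisprop A = HPi A (HPi (hwk 1 A) (HId (hwk 2 A) (HVar 1) (HVar 0)))"

definition hisset :: "htm \<Rightarrow> htm"
  where "hisset A = HPi A (HPi (hwk 1 A)
    (HPi (HId (hwk 2 A) (HVar 1) (HVar 0)) (HPi (HId (hwk 3 A) (HVar 2) (HVar 1))
      (HId (HId (hwk 4 A) (HVar 3) (HVar 2)) (HVar 1) (HVar 0)))))"

definition hPROP :: "nat \<Rightarrow> htm"
  where "hPROP i = HSig (HUniv i) (hisprop (HVar 0))"

definition hSET :: "nat \<Rightarrow> htm"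
  where "hSET i = HSig (HUniv i) (hisset (HVar 0))"

definition hor :: "htm \<Rightarrow> htm \<Rightarrow> htm"
  where "hor P Q = HTrunc (HSum P Q)"

definition hinl_or :: "htm \<Rightarrow> htm"
  where "hinl_or p = HTr (HInl p)"

definition hinr_or :: "htm \<Rightarrow> htm"
  where "hinr_or q = HTr (HInr q)"

text \<open>In \<open>ind\<^sub>\<or>\<close> and \<open>ind\<^sub>\<exists>\<close> the branches are moved under the extra binder \<open>z\<close>.\<close>

definition hind_or :: "htm \<Rightarrow> htm \<Rightarrow> htm \<Rightarrow> htm \<Rightarrow> htm"
  where "hind_or e l\<^sub>1 l\<^sub>2 s =
    HIndTr e (HIndSum (HVar 0) (hren (upr Suc) l\<^sub>1) (hren (upr Suc) l\<^sub>2)) s"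

definition hex :: "htm \<Rightarrow> htm \<Rightarrow> htm"
  where "hex A P = HTrunc (HSig A P)"

definition hpair_ex :: "htm \<Rightarrow> htm \<Rightarrow> htm"
  where "hpair_ex a p = HTr (HPair a p)"

definition hind_ex :: "htm \<Rightarrow> htm \<Rightarrow> htm \<Rightarrow> htm"
  where "hind_ex e l s = HIndTr e (HIndSig (HVar 0) (hren (upr (upr Suc)) l)) s"

text \<open>Equivalences are bi-invertible maps, and \<open>hidtoeqv\<close> is the map
  \<open>\<lambda>p. (p\<^sub>*, _) : A = B \<rightarrow> A \<simeq> B\<close>, both components being given by path induction.\<close>

definition hisequiv :: "htm \<Rightarrow> htm \<Rightarrow> htm \<Rightarrow> htm" where
  "hisequiv A B f = hprod
     (HSig (hfun B A) (HPi (hwk 1 B)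
        (HId (hwk 2 B) (HApp (hwk 2 f) (HApp (HVar 1) (HVar 0))) (HVar 0))))
     (HSig (hfun B A) (HPi (hwk 1 A)
        (HId (hwk 2 A) (HApp (HVar 1) (HApp (hwk 2 f) (HVar 0))) (HVar 0))))"

definition hequiv :: "htm \<Rightarrow> htm \<Rightarrow> htm"
  where "hequiv A B = HSig (hfun A B) (hisequiv (hwk 1 A) (hwk 1 B) (HVar 0))"

definition hidtoeqv :: htm where
  "hidtoeqv =
     (let i = HPair (HLam (HVar 0)) (HLam (HRefl (HVar 0)))
      in HLam (HPair (HIndId (HVar 0) (HLam (HVar 0))) (HIndId (HVar 0) (HPair i i))))"

definition hunivalence :: "nat \<Rightarrow> htm" where
  "hunivalence i = HPi (HUniv i) (HPi (HUniv i)
     (hisequiv (HId (HUniv i) (HVar 1) (HVar 0)) (hequiv (HVar 1) (HVar 0)) hidtoeqv))"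


subsection \<open>Derivability\<close>

type_synonym hctx = "htm list"

datatype hjudg =
    HCtx hctx
  | HTm hctx htm htm
  | HEq hctx htm htm htm

text \<open>
  The rules are those of the HoTT Book (Appendix A.2), where ``\<open>A\<close> is a type'' means
  \<open>A : U\<^sub>i\<close> for some \<open>i\<close>, with lists, propositional truncation and univalence.
  The theory is parametrised by a set \<open>E\<close> of further axioms: there is no general schema of higher
  inductive types to refer to, and the rules of any further ones (as well as any other constants)
  can be supplied as judgements about the constants \<^term>\<open>HConst k\<close>.
  The rules \<open>subst_tm\<close> and \<open>subst_eq\<close> comprise weakening and substitution; the Book
  observes that these are admissible, but with axioms in \<open>E\<close> they have to be assumed.
\<close>

inductive hott :: "hjudg set \<Rightarrow> hjudg \<Rightarrow> bool" for E where
  axiom: "J \<in> E \<Longrightarrow> hott E J"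

| ctx_empty: "hott E (HCtx [])"
| ctx_ext: "hott E (HTm G A (HUniv i)) \<Longrightarrow> hott E (HCtx (A # G))"
| var: "hott E (HCtx G) \<Longrightarrow> n < length G \<Longrightarrow> hott E (HTm G (HVar n) (hwk (Suc n) (G ! n)))"
| subst_tm: "hott E (HTm G a A) \<Longrightarrow> hott E (HCtx D) \<Longrightarrow>
    \<forall>n<length G. hott E (HTm D (\<sigma> n) (hsub \<sigma> (hwk (Suc n) (G ! n)))) \<Longrightarrow>
    hott E (HTm D (hsub \<sigma> a) (hsub \<sigma> A))"
| subst_eq: "hott E (HEq G a b A) \<Longrightarrow> hott E (HCtx D) \<Longrightarrow>
    \<forall>n<length G. hott E (HTm D (\<sigma> n) (hsub \<sigma> (hwk (Suc n) (G ! n)))) \<Longrightarrow>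
    hott E (HEq D (hsub \<sigma> a) (hsub \<sigma> b) (hsub \<sigma> A))"
| eq_refl: "hott E (HTm G a A) \<Longrightarrow> hott E (HEq G a a A)"
| eq_sym: "hott E (HEq G a b A) \<Longrightarrow> hott E (HEq G b a A)"
| eq_trans: "hott E (HEq G a b A) \<Longrightarrow> hott E (HEq G b c A) \<Longrightarrow> hott E (HEq G a c A)"
| conv: "hott E (HTm G a A) \<Longrightarrow> hott E (HEq G A B (HUniv i)) \<Longrightarrow> hott E (HTm G a B)"
| conv_eq: "hott E (HEq G a b A) \<Longrightarrow> hott E (HEq G A B (HUniv i)) \<Longrightarrow> hott E (HEq G a b B)"

| univ: "hott E (HCtx G) \<Longrightarrow> hott E (HTm G (HUniv i) (HUniv (Suc i)))"
| cumul: "hott E (HTm G A (HUniv i)) \<Longrightarrow> hott E (HTm G A (HUniv (Suc i)))"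
| cumul_eq: "hott E (HEq G A B (HUniv i)) \<Longrightarrow> hott E (HEq G A B (HUniv (Suc i)))"
| univalence: "hott E (HCtx G) \<Longrightarrow> hott E (HTm G (HUa i) (hunivalence i))"

| pi_form: "hott E (HTm G A (HUniv i)) \<Longrightarrow> hott E (HTm (A # G) B (HUniv i)) \<Longrightarrow>
    hott E (HTm G (HPi A B) (HUniv i))"
| pi_form_eq: "hott E (HTm G A (HUniv i)) \<Longrightarrow> hott E (HEq G A A' (HUniv i)) \<Longrightarrow>
    hott E (HEq (A # G) B B' (HUniv i)) \<Longrightarrow>
    hott E (HEq G (HPi A B) (HPi A' B') (HUniv i))"
| pi_intro: "hott E (HTm (A # G) b B) \<Longrightarrow> hott E (HTm G (HLam b) (HPi A B))"
| pi_intro_eq: "hott E (HEq (A # G) b b' B) \<Longrightarrow> hott E (HEq G (HLam b) (HLam b') (HPi A B))"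
| pi_elim: "hott E (HTm G f (HPi A B)) \<Longrightarrow> hott E (HTm G a A) \<Longrightarrow>
    hott E (HTm G (HApp f a) (hinst B a))"
| pi_elim_eq: "hott E (HEq G f f' (HPi A B)) \<Longrightarrow> hott E (HEq G a a' A) \<Longrightarrow>
    hott E (HEq G (HApp f a) (HApp f' a') (hinst B a))"
| pi_beta: "hott E (HTm (A # G) b B) \<Longrightarrow> hott E (HTm G a A) \<Longrightarrow>
    hott E (HEq G (HApp (HLam b) a) (hinst b a) (hinst B a))"
| pi_eta: "hott E (HTm G f (HPi A B)) \<Longrightarrow>
    hott E (HEq G f (HLam (HApp (hwk 1 f) (HVar 0))) (HPi A B))"

| sig_form: "hott E (HTm G A (HUniv i)) \<Longrightarrow> hott E (HTm (A # G) B (HUniv i)) \<Longrightarrow>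
    hott E (HTm G (HSig A B) (HUniv i))"
| sig_form_eq: "hott E (HTm G A (HUniv i)) \<Longrightarrow> hott E (HEq G A A' (HUniv i)) \<Longrightarrow>
    hott E (HEq (A # G) B B' (HUniv i)) \<Longrightarrow>
    hott E (HEq G (HSig A B) (HSig A' B') (HUniv i))"
| sig_intro: "hott E (HTm (A # G) B (HUniv i)) \<Longrightarrow> hott E (HTm G a A) \<Longrightarrow>
    hott E (HTm G b (hinst B a)) \<Longrightarrow> hott E (HTm G (HPair a b) (HSig A B))"
| sig_intro_eq: "hott E (HTm (A # G) B (HUniv i)) \<Longrightarrow> hott E (HEq G a a' A) \<Longrightarrow>
    hott E (HEq G b b' (hinst B a)) \<Longrightarrow> hott E (HEq G (HPair a b) (HPair a' b') (HSig A B))"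
| sig_elim: "hott E (HTm (HSig A B # G) C (HUniv i)) \<Longrightarrow>
    hott E (HTm (B # A # G) c (hat 2 (HPair (HVar 1) (HVar 0)) C)) \<Longrightarrow>
    hott E (HTm G d (HSig A B)) \<Longrightarrow> hott E (HTm G (HIndSig d c) (hinst C d))"
| sig_elim_eq: "hott E (HTm (HSig A B # G) C (HUniv i)) \<Longrightarrow>
    hott E (HEq (B # A # G) c c' (hat 2 (HPair (HVar 1) (HVar 0)) C)) \<Longrightarrow>
    hott E (HEq G d d' (HSig A B)) \<Longrightarrow>
    hott E (HEq G (HIndSig d c) (HIndSig d' c') (hinst C d))"
| sig_beta: "hott E (HTm (HSig A B # G) C (HUniv i)) \<Longrightarrow>
    hott E (HTm (B # A # G) c (hat 2 (HPair (HVar 1) (HVar 0)) C)) \<Longrightarrow>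
    hott E (HTm G a A) \<Longrightarrow> hott E (HTm G b (hinst B a)) \<Longrightarrow>
    hott E (HEq G (HIndSig (HPair a b) c) (hsub (b \<rhd> a \<rhd> HVar) c) (hinst C (HPair a b)))"

| sum_form: "hott E (HTm G A (HUniv i)) \<Longrightarrow> hott E (HTm G B (HUniv i)) \<Longrightarrow>
    hott E (HTm G (HSum A B) (HUniv i))"
| sum_form_eq: "hott E (HEq G A A' (HUniv i)) \<Longrightarrow> hott E (HEq G B B' (HUniv i)) \<Longrightarrow>
    hott E (HEq G (HSum A B) (HSum A' B') (HUniv i))"
| sum_inl: "hott E (HTm G B (HUniv i)) \<Longrightarrow> hott E (HTm G a A) \<Longrightarrow>
    hott E (HTm G (HInl a) (HSum A B))"
| sum_inl_eq: "hott E (HTm G B (HUniv i)) \<Longrightarrow> hott E (HEq G a a' A) \<Longrightarrow>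
    hott E (HEq G (HInl a) (HInl a') (HSum A B))"
| sum_inr: "hott E (HTm G A (HUniv i)) \<Longrightarrow> hott E (HTm G b B) \<Longrightarrow>
    hott E (HTm G (HInr b) (HSum A B))"
| sum_inr_eq: "hott E (HTm G A (HUniv i)) \<Longrightarrow> hott E (HEq G b b' B) \<Longrightarrow>
    hott E (HEq G (HInr b) (HInr b') (HSum A B))"
| sum_elim: "hott E (HTm (HSum A B # G) C (HUniv i)) \<Longrightarrow>
    hott E (HTm (A # G) l (hat 1 (HInl (HVar 0)) C)) \<Longrightarrow>
    hott E (HTm (B # G) r (hat 1 (HInr (HVar 0)) C)) \<Longrightarrow>
    hott E (HTm G e (HSum A B)) \<Longrightarrow> hott E (HTm G (HIndSum e l r) (hinst C e))"
| sum_elim_eq: "hott E (HTm (HSum A B # G) C (HUniv i)) \<Longrightarrow>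
    hott E (HEq (A # G) l l' (hat 1 (HInl (HVar 0)) C)) \<Longrightarrow>
    hott E (HEq (B # G) r r' (hat 1 (HInr (HVar 0)) C)) \<Longrightarrow>
    hott E (HEq G e e' (HSum A B)) \<Longrightarrow>
    hott E (HEq G (HIndSum e l r) (HIndSum e' l' r') (hinst C e))"
| sum_beta_inl: "hott E (HTm (HSum A B # G) C (HUniv i)) \<Longrightarrow>
    hott E (HTm (A # G) l (hat 1 (HInl (HVar 0)) C)) \<Longrightarrow>
    hott E (HTm (B # G) r (hat 1 (HInr (HVar 0)) C)) \<Longrightarrow>
    hott E (HTm G a A) \<Longrightarrow>
    hott E (HEq G (HIndSum (HInl a) l r) (hinst l a) (hinst C (HInl a)))"
| sum_beta_inr: "hott E (HTm (HSum A B # G) C (HUniv i)) \<Longrightarrow>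
    hott E (HTm (A # G) l (hat 1 (HInl (HVar 0)) C)) \<Longrightarrow>
    hott E (HTm (B # G) r (hat 1 (HInr (HVar 0)) C)) \<Longrightarrow>
    hott E (HTm G b B) \<Longrightarrow>
    hott E (HEq G (HIndSum (HInr b) l r) (hinst r b) (hinst C (HInr b)))"

| empty_form: "hott E (HCtx G) \<Longrightarrow> hott E (HTm G HEmpty (HUniv i))"
| empty_elim: "hott E (HTm (HEmpty # G) C (HUniv i)) \<Longrightarrow> hott E (HTm G e HEmpty) \<Longrightarrow>
    hott E (HTm G (HIndEmpty e) (hinst C e))"
| empty_elim_eq: "hott E (HTm (HEmpty # G) C (HUniv i)) \<Longrightarrow> hott E (HEq G e e' HEmpty) \<Longrightarrow>
    hott E (HEq G (HIndEmpty e) (HIndEmpty e') (hinst C e))"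
| unit_form: "hott E (HCtx G) \<Longrightarrow> hott E (HTm G HUnit (HUniv i))"
| unit_intro: "hott E (HCtx G) \<Longrightarrow> hott E (HTm G HStar HUnit)"
| unit_elim: "hott E (HTm (HUnit # G) C (HUniv i)) \<Longrightarrow> hott E (HTm G c (hinst C HStar)) \<Longrightarrow>
    hott E (HTm G e HUnit) \<Longrightarrow> hott E (HTm G (HIndUnit e c) (hinst C e))"
| unit_elim_eq: "hott E (HTm (HUnit # G) C (HUniv i)) \<Longrightarrow> hott E (HEq G c c' (hinst C HStar)) \<Longrightarrow>
    hott E (HEq G e e' HUnit) \<Longrightarrow> hott E (HEq G (HIndUnit e c) (HIndUnit e' c') (hinst C e))"
| unit_beta: "hott E (HTm (HUnit # G) C (HUniv i)) \<Longrightarrow> hott E (HTm G c (hinst C HStar)) \<Longrightarrow>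
    hott E (HEq G (HIndUnit HStar c) c (hinst C HStar))"

| nat_form: "hott E (HCtx G) \<Longrightarrow> hott E (HTm G HNat (HUniv i))"
| nat_zero: "hott E (HCtx G) \<Longrightarrow> hott E (HTm G HZero HNat)"
| nat_suc: "hott E (HTm G n HNat) \<Longrightarrow> hott E (HTm G (HSuc n) HNat)"
| nat_suc_eq: "hott E (HEq G n n' HNat) \<Longrightarrow> hott E (HEq G (HSuc n) (HSuc n') HNat)"
| nat_elim: "hott E (HTm (HNat # G) C (HUniv i)) \<Longrightarrow> hott E (HTm G z (hinst C HZero)) \<Longrightarrow>
    hott E (HTm (C # HNat # G) s (hat 2 (HSuc (HVar 1)) C)) \<Longrightarrow>
    hott E (HTm G e HNat) \<Longrightarrow> hott E (HTm G (HIndNat e z s) (hinst C e))"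
| nat_elim_eq: "hott E (HTm (HNat # G) C (HUniv i)) \<Longrightarrow> hott E (HEq G z z' (hinst C HZero)) \<Longrightarrow>
    hott E (HEq (C # HNat # G) s s' (hat 2 (HSuc (HVar 1)) C)) \<Longrightarrow>
    hott E (HEq G e e' HNat) \<Longrightarrow>
    hott E (HEq G (HIndNat e z s) (HIndNat e' z' s') (hinst C e))"
| nat_beta_zero: "hott E (HTm (HNat # G) C (HUniv i)) \<Longrightarrow> hott E (HTm G z (hinst C HZero)) \<Longrightarrow>
    hott E (HTm (C # HNat # G) s (hat 2 (HSuc (HVar 1)) C)) \<Longrightarrow>
    hott E (HEq G (HIndNat HZero z s) z (hinst C HZero))"
| nat_beta_suc: "hott E (HTm (HNat # G) C (HUniv i)) \<Longrightarrow> hott E (HTm G z (hinst C HZero)) \<Longrightarrow>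
    hott E (HTm (C # HNat # G) s (hat 2 (HSuc (HVar 1)) C)) \<Longrightarrow>
    hott E (HTm G n HNat) \<Longrightarrow>
    hott E (HEq G (HIndNat (HSuc n) z s) (hsub (HIndNat n z s \<rhd> n \<rhd> HVar) s) (hinst C (HSuc n)))"

| list_form: "hott E (HTm G A (HUniv i)) \<Longrightarrow> hott E (HTm G (HList A) (HUniv i))"
| list_form_eq: "hott E (HEq G A A' (HUniv i)) \<Longrightarrow>
    hott E (HEq G (HList A) (HList A') (HUniv i))"
| list_nil: "hott E (HTm G A (HUniv i)) \<Longrightarrow> hott E (HTm G HNil (HList A))"
| list_cons: "hott E (HTm G l (HList A)) \<Longrightarrow> hott E (HTm G a A) \<Longrightarrow>
    hott E (HTm G (HCons l a) (HList A))"
| list_cons_eq: "hott E (HEq G l l' (HList A)) \<Longrightarrow> hott E (HEq G a a' A) \<Longrightarrow>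
    hott E (HEq G (HCons l a) (HCons l' a') (HList A))"
| list_elim: "hott E (HTm (HList A # G) C (HUniv i)) \<Longrightarrow> hott E (HTm G n (hinst C HNil)) \<Longrightarrow>
    hott E (HTm (hat 2 (HVar 1) C # hwk 1 A # HList A # G) c (hat 3 (HCons (HVar 2) (HVar 1)) C)) \<Longrightarrow>
    hott E (HTm G e (HList A)) \<Longrightarrow> hott E (HTm G (HIndList e n c) (hinst C e))"
| list_elim_eq: "hott E (HTm (HList A # G) C (HUniv i)) \<Longrightarrow> hott E (HEq G n n' (hinst C HNil)) \<Longrightarrow>
    hott E (HEq (hat 2 (HVar 1) C # hwk 1 A # HList A # G) c c'
      (hat 3 (HCons (HVar 2) (HVar 1)) C)) \<Longrightarrow>
    hott E (HEq G e e' (HList A)) \<Longrightarrow>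
    hott E (HEq G (HIndList e n c) (HIndList e' n' c') (hinst C e))"
| list_beta_nil: "hott E (HTm (HList A # G) C (HUniv i)) \<Longrightarrow> hott E (HTm G n (hinst C HNil)) \<Longrightarrow>
    hott E (HTm (hat 2 (HVar 1) C # hwk 1 A # HList A # G) c (hat 3 (HCons (HVar 2) (HVar 1)) C)) \<Longrightarrow>
    hott E (HEq G (HIndList HNil n c) n (hinst C HNil))"
| list_beta_cons: "hott E (HTm (HList A # G) C (HUniv i)) \<Longrightarrow> hott E (HTm G n (hinst C HNil)) \<Longrightarrow>
    hott E (HTm (hat 2 (HVar 1) C # hwk 1 A # HList A # G) c (hat 3 (HCons (HVar 2) (HVar 1)) C)) \<Longrightarrow>
    hott E (HTm G l (HList A)) \<Longrightarrow> hott E (HTm G a A) \<Longrightarrow>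
    hott E (HEq G (HIndList (HCons l a) n c) (hsub (HIndList l n c \<rhd> a \<rhd> l \<rhd> HVar) c)
      (hinst C (HCons l a)))"

\<comment> \<open>in \<open>id_elim\<close>, the motive \<open>C\<close> lives over \<open>x : A, y : A, p : x = y\<close>\<close>
| id_form: "hott E (HTm G A (HUniv i)) \<Longrightarrow> hott E (HTm G a A) \<Longrightarrow> hott E (HTm G b A) \<Longrightarrow>
    hott E (HTm G (HId A a b) (HUniv i))"
| id_form_eq: "hott E (HEq G A A' (HUniv i)) \<Longrightarrow> hott E (HEq G a a' A) \<Longrightarrow>
    hott E (HEq G b b' A) \<Longrightarrow> hott E (HEq G (HId A a b) (HId A' a' b') (HUniv i))"
| id_intro: "hott E (HTm G a A) \<Longrightarrow> hott E (HTm G (HRefl a) (HId A a a))"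
| id_intro_eq: "hott E (HEq G a a' A) \<Longrightarrow> hott E (HEq G (HRefl a) (HRefl a') (HId A a a))"
| id_elim: "hott E (HTm (HId (hwk 2 A) (HVar 1) (HVar 0) # hwk 1 A # A # G) C (HUniv i)) \<Longrightarrow>
    hott E (HTm (A # G) c (hsub (HRefl (HVar 0) \<rhd> HVar 0 \<rhd> HVar 0 \<rhd> (\<lambda>n. HVar (n + 1))) C)) \<Longrightarrow>
    hott E (HTm G a A) \<Longrightarrow> hott E (HTm G b A) \<Longrightarrow> hott E (HTm G p (HId A a b)) \<Longrightarrow>
    hott E (HTm G (HIndId p c) (hsub (p \<rhd> b \<rhd> a \<rhd> HVar) C))"
| id_elim_eq: "hott E (HTm (HId (hwk 2 A) (HVar 1) (HVar 0) # hwk 1 A # A # G) C (HUniv i)) \<Longrightarrow>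
    hott E (HEq (A # G) c c' (hsub (HRefl (HVar 0) \<rhd> HVar 0 \<rhd> HVar 0 \<rhd> (\<lambda>n. HVar (n + 1))) C)) \<Longrightarrow>
    hott E (HTm G a A) \<Longrightarrow> hott E (HTm G b A) \<Longrightarrow> hott E (HEq G p p' (HId A a b)) \<Longrightarrow>
    hott E (HEq G (HIndId p c) (HIndId p' c') (hsub (p \<rhd> b \<rhd> a \<rhd> HVar) C))"
| id_beta: "hott E (HTm (HId (hwk 2 A) (HVar 1) (HVar 0) # hwk 1 A # A # G) C (HUniv i)) \<Longrightarrow>
    hott E (HTm (A # G) c (hsub (HRefl (HVar 0) \<rhd> HVar 0 \<rhd> HVar 0 \<rhd> (\<lambda>n. HVar (n + 1))) C)) \<Longrightarrow>
    hott E (HTm G a A) \<Longrightarrow>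
    hott E (HEq G (HIndId (HRefl a) c) (hinst c a) (hsub (HRefl a \<rhd> a \<rhd> a \<rhd> HVar) C))"

| trunc_form: "hott E (HTm G A (HUniv i)) \<Longrightarrow> hott E (HTm G (HTrunc A) (HUniv i))"
| trunc_form_eq: "hott E (HEq G A A' (HUniv i)) \<Longrightarrow>
    hott E (HEq G (HTrunc A) (HTrunc A') (HUniv i))"
| trunc_intro: "hott E (HTm G a A) \<Longrightarrow> hott E (HTm G (HTr a) (HTrunc A))"
| trunc_intro_eq: "hott E (HEq G a a' A) \<Longrightarrow> hott E (HEq G (HTr a) (HTr a') (HTrunc A))"
| trunc_sq: "hott E (HTm G A (HUniv i)) \<Longrightarrow> hott E (HTm G (HSq A) (hisprop (HTrunc A)))"
| trunc_sq_eq: "hott E (HEq G A A' (HUniv i)) \<Longrightarrow>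
    hott E (HEq G (HSq A) (HSq A') (hisprop (HTrunc A)))"
| trunc_elim: "hott E (HTm G C (HUniv i)) \<Longrightarrow> hott E (HTm G e (HTrunc A)) \<Longrightarrow>
    hott E (HTm (A # G) c (hwk 1 C)) \<Longrightarrow> hott E (HTm G s (hisprop C)) \<Longrightarrow>
    hott E (HTm G (HIndTr e c s) C)"
| trunc_elim_eq: "hott E (HTm G C (HUniv i)) \<Longrightarrow> hott E (HEq G e e' (HTrunc A)) \<Longrightarrow>
    hott E (HEq (A # G) c c' (hwk 1 C)) \<Longrightarrow> hott E (HEq G s s' (hisprop C)) \<Longrightarrow>
    hott E (HEq G (HIndTr e c s) (HIndTr e' c' s') C)"
| trunc_beta: "hott E (HTm G C (HUniv i)) \<Longrightarrow> hott E (HTm G a A) \<Longrightarrow>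
    hott E (HTm (A # G) c (hwk 1 C)) \<Longrightarrow> hott E (HTm G s (hisprop C)) \<Longrightarrow>
    hott E (HEq G (HIndTr (HTr a) c s) (hinst c a) C)"


section \<open>The intensional level of the Minimalist Foundation\<close>

subsection \<open>Raw syntax\<close>

text \<open>
  Types and terms of all four sorts share the two syntactic categories; \<open>\<Sigma>\<close> for sets and for
  collections is one type former, and so are \<open>\<lambda>\<close> and \<open>Ap\<close> for \<open>\<Pi>\<close> and for \<open>A \<rightarrow> prop\<^sub>s\<close>.
  The interpretation of \<open>El\<^sub>\<or>\<close> and \<open>El\<^sub>\<exists>\<close> depends on the target
  proposition \<open>C\<close>; to make it a function of the raw term, these two eliminators carry \<open>C\<close> as
  first argument. The constructors \<open>C...\<close> are the codes of small propositions.
\<close>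

datatype mty =
    TN0
  | TN1
  | TList mty
  | TSum mty mty
  | TSig mty mty                (* 0, 1 *)
  | TPi mty mty                 (* 0, 1 *)
  | TProps
  | TFunProps mty
  | TBot
  | TOr mty mty
  | TAnd mty mty
  | TImp mty mty
  | TEx mty mty                 (* 0, 1 *)
  | TAll mty mty                (* 0, 1 *)
  | TId mty mtm mtm
  | TTau mtm
and mtm =
    MVar nat
  | MEmp0 mtm
  | MStar
  | MElN1 mtm mtm
  | MNil
  | MCons mtm mtm
  | MElList mtm mtm mtm         (* 0, 0, 3 *)
  | MInl mtm
  | MInr mtm
  | MElSum mtm mtm mtm          (* 0, 1, 1 *)
  | MPair mtm mtm
  | MElSig mtm mtm              (* 0, 2 *)
  | MLam mtm                    (* 1 *)
  | MAp mtm mtm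
  | MR0 mtm
  | MInlOr mtm
  | MInrOr mtm
  | MElOr mty mtm mtm mtm       (* 0, 0, 1, 1 *)
  | MPairAnd mtm mtm
  | MPi1 mtm
  | MPi2 mtm
  | MLamImp mtm                 (* 1 *)
  | MApImp mtm mtm
  | MPairEx mtm mtm
  | MElEx mty mtm mtm           (* 0, 0, 2 *)
  | MLamAll mtm                 (* 1 *)
  | MApAll mtm mtm
  | MRefl mty mtm
  | MElId mtm mtm               (* 0, 1 *)
  | CBot
  | COr mtm mtm
  | CAnd mtm mtm
  | CImp mtm mtm
  | CEx mty mtm                 (* 0, 1 *)
  | CAll mty mtm                (* 0, 1 *)
  | CId mty mtm mtm

primrec mrenT :: "(nat \<Rightarrow> nat) \<Rightarrow> mty \<Rightarrow> mty" and mren :: "(nat \<Rightarrow> nat) \<Rightarrow> mtm \<Rightarrow> mtm" where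
  "mrenT \<xi> TN0 = TN0"
| "mrenT \<xi> TN1 = TN1"
| "mrenT \<xi> (TList A) = TList (mrenT \<xi> A)"
| "mrenT \<xi> (TSum A B) = TSum (mrenT \<xi> A) (mrenT \<xi> B)"
| "mrenT \<xi> (TSig A B) = TSig (mrenT \<xi> A) (mrenT (upr \<xi>) B)"
| "mrenT \<xi> (TPi A B) = TPi (mrenT \<xi> A) (mrenT (upr \<xi>) B)"
| "mrenT \<xi> TProps = TProps"
| "mrenT \<xi> (TFunProps A) = TFunProps (mrenT \<xi> A)"
| "mrenT \<xi> TBot = TBot"
| "mrenT \<xi> (TOr A B) = TOr (mrenT \<xi> A) (mrenT \<xi> B)"
| "mrenT \<xi> (TAnd A B) = TAnd (mrenT \<xi> A) (mrenT \<xi> B)"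
| "mrenT \<xi> (TImp A B) = TImp (mrenT \<xi> A) (mrenT \<xi> B)"
| "mrenT \<xi> (TEx A B) = TEx (mrenT \<xi> A) (mrenT (upr \<xi>) B)"
| "mrenT \<xi> (TAll A B) = TAll (mrenT \<xi> A) (mrenT (upr \<xi>) B)"
| "mrenT \<xi> (TId A a b) = TId (mrenT \<xi> A) (mren \<xi> a) (mren \<xi> b)"
| "mrenT \<xi> (TTau p) = TTau (mren \<xi> p)"
| "mren \<xi> (MVar n) = MVar (\<xi> n)"
| "mren \<xi> (MEmp0 d) = MEmp0 (mren \<xi> d)"
| "mren \<xi> MStar = MStar"
| "mren \<xi> (MElN1 d c) = MElN1 (mren \<xi> d) (mren \<xi> c)"
| "mren \<xi> MNil = MNil"
| "mren \<xi> (MCons l a) = MCons (mren \<xi> l) (mren \<xi> a)"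
| "mren \<xi> (MElList d n c) = MElList (mren \<xi> d) (mren \<xi> n) (mren (upr (upr (upr \<xi>))) c)"
| "mren \<xi> (MInl a) = MInl (mren \<xi> a)"
| "mren \<xi> (MInr b) = MInr (mren \<xi> b)"
| "mren \<xi> (MElSum d l r) = MElSum (mren \<xi> d) (mren (upr \<xi>) l) (mren (upr \<xi>) r)"
| "mren \<xi> (MPair a b) = MPair (mren \<xi> a) (mren \<xi> b)"
| "mren \<xi> (MElSig d c) = MElSig (mren \<xi> d) (mren (upr (upr \<xi>)) c)"
| "mren \<xi> (MLam b) = MLam (mren (upr \<xi>) b)"
| "mren \<xi> (MAp f a) = MAp (mren \<xi> f) (mren \<xi> a)"
| "mren \<xi> (MR0 d) = MR0 (mren \<xi> d)"
| "mren \<xi> (MInlOr a) = MInlOr (mren \<xi> a)"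
| "mren \<xi> (MInrOr b) = MInrOr (mren \<xi> b)"
| "mren \<xi> (MElOr C d l r) = MElOr (mrenT \<xi> C) (mren \<xi> d) (mren (upr \<xi>) l) (mren (upr \<xi>) r)"
| "mren \<xi> (MPairAnd a b) = MPairAnd (mren \<xi> a) (mren \<xi> b)"
| "mren \<xi> (MPi1 d) = MPi1 (mren \<xi> d)"
| "mren \<xi> (MPi2 d) = MPi2 (mren \<xi> d)"
| "mren \<xi> (MLamImp b) = MLamImp (mren (upr \<xi>) b)"
| "mren \<xi> (MApImp f a) = MApImp (mren \<xi> f) (mren \<xi> a)"
| "mren \<xi> (MPairEx a b) = MPairEx (mren \<xi> a) (mren \<xi> b)"
| "mren \<xi> (MElEx C d c) = MElEx (mrenT \<xi> C) (mren \<xi> d) (mren (upr (upr \<xi>)) c)"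
| "mren \<xi> (MLamAll b) = MLamAll (mren (upr \<xi>) b)"
| "mren \<xi> (MApAll f a) = MApAll (mren \<xi> f) (mren \<xi> a)"
| "mren \<xi> (MRefl A a) = MRefl (mrenT \<xi> A) (mren \<xi> a)"
| "mren \<xi> (MElId p c) = MElId (mren \<xi> p) (mren (upr \<xi>) c)"
| "mren \<xi> CBot = CBot"
| "mren \<xi> (COr p q) = COr (mren \<xi> p) (mren \<xi> q)"
| "mren \<xi> (CAnd p q) = CAnd (mren \<xi> p) (mren \<xi> q)"
| "mren \<xi> (CImp p q) = CImp (mren \<xi> p) (mren \<xi> q)"
| "mren \<xi> (CEx A p) = CEx (mrenT \<xi> A) (mren (upr \<xi>) p)"
| "mren \<xi> (CAll A p) = CAll (mrenT \<xi> A) (mren (upr \<xi>) p)"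
| "mren \<xi> (CId A a b) = CId (mrenT \<xi> A) (mren \<xi> a) (mren \<xi> b)"

definition mwkT :: "nat \<Rightarrow> mty \<Rightarrow> mty"
  where "mwkT k = mrenT (\<lambda>n. n + k)"

definition mwk :: "nat \<Rightarrow> mtm \<Rightarrow> mtm"
  where "mwk k = mren (\<lambda>n. n + k)"

definition mup :: "(nat \<Rightarrow> mtm) \<Rightarrow> nat \<Rightarrow> mtm"
  where "mup \<sigma> = MVar 0 \<rhd> (\<lambda>n. mwk 1 (\<sigma> n))"

primrec msubT :: "(nat \<Rightarrow> mtm) \<Rightarrow> mty \<Rightarrow> mty" and msub :: "(nat \<Rightarrow> mtm) \<Rightarrow> mtm \<Rightarrow> mtm" where
  "msubT \<sigma> TN0 = TN0"
| "msubT \<sigma> TN1 = TN1"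
| "msubT \<sigma> (TList A) = TList (msubT \<sigma> A)"
| "msubT \<sigma> (TSum A B) = TSum (msubT \<sigma> A) (msubT \<sigma> B)"
| "msubT \<sigma> (TSig A B) = TSig (msubT \<sigma> A) (msubT (mup \<sigma>) B)"
| "msubT \<sigma> (TPi A B) = TPi (msubT \<sigma> A) (msubT (mup \<sigma>) B)"
| "msubT \<sigma> TProps = TProps"
| "msubT \<sigma> (TFunProps A) = TFunProps (msubT \<sigma> A)"
| "msubT \<sigma> TBot = TBot"
| "msubT \<sigma> (TOr A B) = TOr (msubT \<sigma> A) (msubT \<sigma> B)"
| "msubT \<sigma> (TAnd A B) = TAnd (msubT \<sigma> A) (msubT \<sigma> B)"
| "msubT \<sigma> (TImp A B) = TImp (msubT \<sigma> A) (msubT \<sigma> B)"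
| "msubT \<sigma> (TEx A B) = TEx (msubT \<sigma> A) (msubT (mup \<sigma>) B)"
| "msubT \<sigma> (TAll A B) = TAll (msubT \<sigma> A) (msubT (mup \<sigma>) B)"
| "msubT \<sigma> (TId A a b) = TId (msubT \<sigma> A) (msub \<sigma> a) (msub \<sigma> b)"
| "msubT \<sigma> (TTau p) = TTau (msub \<sigma> p)"
| "msub \<sigma> (MVar n) = \<sigma> n"
| "msub \<sigma> (MEmp0 d) = MEmp0 (msub \<sigma> d)"
| "msub \<sigma> MStar = MStar"
| "msub \<sigma> (MElN1 d c) = MElN1 (msub \<sigma> d) (msub \<sigma> c)"
| "msub \<sigma> MNil = MNil"
| "msub \<sigma> (MCons l a) = MCons (msub \<sigma> l) (msub \<sigma> a)"
| "msub \<sigma> (MElList d n c) = MElList (msub \<sigma> d) (msub \<sigma> n) (msub (mup (mup (mup \<sigma>))) c)"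
| "msub \<sigma> (MInl a) = MInl (msub \<sigma> a)"
| "msub \<sigma> (MInr b) = MInr (msub \<sigma> b)"
| "msub \<sigma> (MElSum d l r) = MElSum (msub \<sigma> d) (msub (mup \<sigma>) l) (msub (mup \<sigma>) r)"
| "msub \<sigma> (MPair a b) = MPair (msub \<sigma> a) (msub \<sigma> b)"
| "msub \<sigma> (MElSig d c) = MElSig (msub \<sigma> d) (msub (mup (mup \<sigma>)) c)"
| "msub \<sigma> (MLam b) = MLam (msub (mup \<sigma>) b)"
| "msub \<sigma> (MAp f a) = MAp (msub \<sigma> f) (msub \<sigma> a)"
| "msub \<sigma> (MR0 d) = MR0 (msub \<sigma> d)"
| "msub \<sigma> (MInlOr a) = MInlOr (msub \<sigma> a)"
| "msub \<sigma> (MInrOr b) = MInrOr (msub \<sigma> b)"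
| "msub \<sigma> (MElOr C d l r) = MElOr (msubT \<sigma> C) (msub \<sigma> d) (msub (mup \<sigma>) l) (msub (mup \<sigma>) r)"
| "msub \<sigma> (MPairAnd a b) = MPairAnd (msub \<sigma> a) (msub \<sigma> b)"
| "msub \<sigma> (MPi1 d) = MPi1 (msub \<sigma> d)"
| "msub \<sigma> (MPi2 d) = MPi2 (msub \<sigma> d)"
| "msub \<sigma> (MLamImp b) = MLamImp (msub (mup \<sigma>) b)"
| "msub \<sigma> (MApImp f a) = MApImp (msub \<sigma> f) (msub \<sigma> a)"
| "msub \<sigma> (MPairEx a b) = MPairEx (msub \<sigma> a) (msub \<sigma> b)"
| "msub \<sigma> (MElEx C d c) = MElEx (msubT \<sigma> C) (msub \<sigma> d) (msub (mup (mup \<sigma>)) c)"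
| "msub \<sigma> (MLamAll b) = MLamAll (msub (mup \<sigma>) b)"
| "msub \<sigma> (MApAll f a) = MApAll (msub \<sigma> f) (msub \<sigma> a)"
| "msub \<sigma> (MRefl A a) = MRefl (msubT \<sigma> A) (msub \<sigma> a)"
| "msub \<sigma> (MElId p c) = MElId (msub \<sigma> p) (msub (mup \<sigma>) c)"
| "msub \<sigma> CBot = CBot"
| "msub \<sigma> (COr p q) = COr (msub \<sigma> p) (msub \<sigma> q)"
| "msub \<sigma> (CAnd p q) = CAnd (msub \<sigma> p) (msub \<sigma> q)"
| "msub \<sigma> (CImp p q) = CImp (msub \<sigma> p) (msub \<sigma> q)"
| "msub \<sigma> (CEx A p) = CEx (msubT \<sigma> A) (msub (mup \<sigma>) p)"
| "msub \<sigma> (CAll A p) = CAll (msubT \<sigma> A) (msub (mup \<sigma>) p)"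
| "msub \<sigma> (CId A a b) = CId (msubT \<sigma> A) (msub \<sigma> a) (msub \<sigma> b)"

abbreviation minstT :: "mty \<Rightarrow> mtm \<Rightarrow> mty"
  where "minstT B a \<equiv> msubT (a \<rhd> MVar) B"

abbreviation minst :: "mtm \<Rightarrow> mtm \<Rightarrow> mtm"
  where "minst b a \<equiv> msub (a \<rhd> MVar) b"

text \<open>As \<open>hat\<close> above.\<close>

definition matT :: "nat \<Rightarrow> mtm \<Rightarrow> mty \<Rightarrow> mty"
  where "matT k u C = msubT (u \<rhd> (\<lambda>n. MVar (n + k))) C"

text \<open>The substitution of a list of terms (last one first) for the last variables of a context.\<close>

definition mlist :: "mtm list \<Rightarrow> nat \<Rightarrow> mtm"
  where "mlist as = (\<lambda>n. if n < length as then as ! n else MVar (n - length as))"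


subsection \<open>Derivability\<close>

datatype msort = SCol | SSet | SProp | SProps

inductive subsort :: "msort \<Rightarrow> msort \<Rightarrow> bool" where
  "subsort SProps SSet"
| "subsort SProps SProp"
| "subsort SSet SCol"
| "subsort SProp SCol"

fun is_prop :: "msort \<Rightarrow> bool" where
  "is_prop SProp = True"
| "is_prop SProps = True"
| "is_prop SSet = False"
| "is_prop SCol = False"

text \<open>The sort over which propositions of a given sort may quantify (and whose elements they may
  equate): collections for propositions, sets for small propositions.\<close>

fun domsort :: "msort \<Rightarrow> msort" where
  "domsort SProp = SCol"
| "domsort SProps = SSet"
| "domsort SSet = SSet"
| "domsort SCol = SCol"

type_synonym mctx = "mty list"

datatype mjudg =
    JCtx mctx
  | JTy msort mctx mty
  | JTyEq msort mctx mty mty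
  | JTm mctx mtm mty
  | JEq mctx mtm mtm mty

text \<open>
  Presuppositions of the premises of a rule (such as \<open>A set\<close> and \<open>B set [x \<in> A]\<close> for
  \<open>f \<in> \<Pi>\<^sub>x\<^sub>\<in>\<^sub>A B\<close>) are listed among its premises. Type formers preserve
  definitional equality of types, whereas
  equalities between terms are only propagated by \<open>sub_ty\<close> and \<open>sub_tm\<close>: there
  \<open>D = [A\<^sub>n, \<dots>, A\<^sub>1]\<close>, \<open>as = [a\<^sub>n, \<dots>, a\<^sub>1]\<close>, \<open>bs = [b\<^sub>n, \<dots>, b\<^sub>1]\<close> and \<open>G\<close> is the ambient context.
\<close>

inductive mtt :: "mjudg \<Rightarrow> bool" where

  ctx_empty: "mtt (JCtx [])"
| ctx_ext: "mtt (JTy s G A) \<Longrightarrow> mtt (JCtx (A # G))"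
| var: "mtt (JCtx G) \<Longrightarrow> n < length G \<Longrightarrow> mtt (JTm G (MVar n) (mwkT (Suc n) (G ! n)))"
| subsume: "mtt (JTy s G A) \<Longrightarrow> subsort s s' \<Longrightarrow> mtt (JTy s' G A)"
| subsume_eq: "mtt (JTyEq s G A B) \<Longrightarrow> subsort s s' \<Longrightarrow> mtt (JTyEq s' G A B)"
| ty_refl: "mtt (JTy s G A) \<Longrightarrow> mtt (JTyEq s G A A)"
| ty_sym: "mtt (JTyEq s G A B) \<Longrightarrow> mtt (JTyEq s G B A)"
| ty_trans: "mtt (JTyEq s G A B) \<Longrightarrow> mtt (JTyEq s G B C) \<Longrightarrow> mtt (JTyEq s G A C)"
| tm_refl: "mtt (JTm G a A) \<Longrightarrow> mtt (JEq G a a A)"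
| tm_sym: "mtt (JEq G a b A) \<Longrightarrow> mtt (JEq G b a A)"
| tm_trans: "mtt (JEq G a b A) \<Longrightarrow> mtt (JEq G b c A) \<Longrightarrow> mtt (JEq G a c A)"
| conv: "mtt (JTm G a A) \<Longrightarrow> mtt (JTyEq s G A B) \<Longrightarrow> mtt (JTm G a B)"
| conv_eq: "mtt (JEq G a b A) \<Longrightarrow> mtt (JTyEq s G A B) \<Longrightarrow> mtt (JEq G a b B)"
| sub_ty: "mtt (JTy s (D @ G) C) \<Longrightarrow> length as = length D \<Longrightarrow> length bs = length D \<Longrightarrow>
    \<forall>i<length D. mtt (JEq G (as ! i) (bs ! i) (msubT (mlist (drop (Suc i) as)) (D ! i))) \<Longrightarrow>
    mtt (JTyEq s G (msubT (mlist as) C) (msubT (mlist bs) C))"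
| sub_tm: "mtt (JTm (D @ G) c C) \<Longrightarrow> length as = length D \<Longrightarrow> length bs = length D \<Longrightarrow>
    \<forall>i<length D. mtt (JEq G (as ! i) (bs ! i) (msubT (mlist (drop (Suc i) as)) (D ! i))) \<Longrightarrow>
    mtt (JEq G (msub (mlist as) c) (msub (mlist bs) c) (msubT (mlist as) C))"

| N0_form: "mtt (JCtx G) \<Longrightarrow> mtt (JTy SSet G TN0)"
| N0_elim: "mtt (JTy SCol (TN0 # G) C) \<Longrightarrow> mtt (JTm G d TN0) \<Longrightarrow>
    mtt (JTm G (MEmp0 d) (minstT C d))"
| N1_form: "mtt (JCtx G) \<Longrightarrow> mtt (JTy SSet G TN1)"
| N1_intro: "mtt (JCtx G) \<Longrightarrow> mtt (JTm G MStar TN1)"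
| N1_elim: "mtt (JTy SCol (TN1 # G) C) \<Longrightarrow> mtt (JTm G d TN1) \<Longrightarrow>
    mtt (JTm G c (minstT C MStar)) \<Longrightarrow> mtt (JTm G (MElN1 d c) (minstT C d))"
| N1_beta: "mtt (JTy SCol (TN1 # G) C) \<Longrightarrow> mtt (JTm G c (minstT C MStar)) \<Longrightarrow>
    mtt (JEq G (MElN1 MStar c) c (minstT C MStar))"

| List_form: "mtt (JTy SSet G A) \<Longrightarrow> mtt (JTy SSet G (TList A))"
| List_form_eq: "mtt (JTyEq SSet G A A') \<Longrightarrow> mtt (JTyEq SSet G (TList A) (TList A'))"
| List_nil: "mtt (JTy SSet G A) \<Longrightarrow> mtt (JTm G MNil (TList A))"
| List_cons: "mtt (JTy SSet G A) \<Longrightarrow> mtt (JTm G l (TList A)) \<Longrightarrow> mtt (JTm G a A) \<Longrightarrow>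
    mtt (JTm G (MCons l a) (TList A))"
| List_elim: "mtt (JTy SSet G A) \<Longrightarrow> mtt (JTy SCol (TList A # G) C) \<Longrightarrow>
    mtt (JTm G d (TList A)) \<Longrightarrow> mtt (JTm G n (minstT C MNil)) \<Longrightarrow>
    mtt (JTm (matT 2 (MVar 1) C # mwkT 1 A # TList A # G) c
      (matT 3 (MCons (MVar 2) (MVar 1)) C)) \<Longrightarrow>
    mtt (JTm G (MElList d n c) (minstT C d))"
| List_beta_nil: "mtt (JTy SSet G A) \<Longrightarrow> mtt (JTy SCol (TList A # G) C) \<Longrightarrow>
    mtt (JTm G n (minstT C MNil)) \<Longrightarrow>
    mtt (JTm (matT 2 (MVar 1) C # mwkT 1 A # TList A # G) c
      (matT 3 (MCons (MVar 2) (MVar 1)) C)) \<Longrightarrow>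
    mtt (JEq G (MElList MNil n c) n (minstT C MNil))"
| List_beta_cons: "mtt (JTy SSet G A) \<Longrightarrow> mtt (JTy SCol (TList A # G) C) \<Longrightarrow>
    mtt (JTm G l (TList A)) \<Longrightarrow> mtt (JTm G a A) \<Longrightarrow> mtt (JTm G n (minstT C MNil)) \<Longrightarrow>
    mtt (JTm (matT 2 (MVar 1) C # mwkT 1 A # TList A # G) c
      (matT 3 (MCons (MVar 2) (MVar 1)) C)) \<Longrightarrow>
    mtt (JEq G (MElList (MCons l a) n c) (msub (MElList l n c \<rhd> a \<rhd> l \<rhd> MVar) c)
      (minstT C (MCons l a)))"

| Sum_form: "mtt (JTy SSet G A) \<Longrightarrow> mtt (JTy SSet G B) \<Longrightarrow> mtt (JTy SSet G (TSum A B))"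
| Sum_form_eq: "mtt (JTyEq SSet G A A') \<Longrightarrow> mtt (JTyEq SSet G B B') \<Longrightarrow>
    mtt (JTyEq SSet G (TSum A B) (TSum A' B'))"
| Sum_inl: "mtt (JTy SSet G A) \<Longrightarrow> mtt (JTy SSet G B) \<Longrightarrow> mtt (JTm G a A) \<Longrightarrow>
    mtt (JTm G (MInl a) (TSum A B))"
| Sum_inr: "mtt (JTy SSet G A) \<Longrightarrow> mtt (JTy SSet G B) \<Longrightarrow> mtt (JTm G b B) \<Longrightarrow>
    mtt (JTm G (MInr b) (TSum A B))"
| Sum_elim: "mtt (JTy SSet G A) \<Longrightarrow> mtt (JTy SSet G B) \<Longrightarrow> mtt (JTy SCol (TSum A B # G) C) \<Longrightarrow>
    mtt (JTm G d (TSum A B)) \<Longrightarrow>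
    mtt (JTm (A # G) l (matT 1 (MInl (MVar 0)) C)) \<Longrightarrow>
    mtt (JTm (B # G) r (matT 1 (MInr (MVar 0)) C)) \<Longrightarrow>
    mtt (JTm G (MElSum d l r) (minstT C d))"
| Sum_beta_inl: "mtt (JTy SSet G A) \<Longrightarrow> mtt (JTy SSet G B) \<Longrightarrow>
    mtt (JTy SCol (TSum A B # G) C) \<Longrightarrow> mtt (JTm G a A) \<Longrightarrow>
    mtt (JTm (A # G) l (matT 1 (MInl (MVar 0)) C)) \<Longrightarrow>
    mtt (JTm (B # G) r (matT 1 (MInr (MVar 0)) C)) \<Longrightarrow>
    mtt (JEq G (MElSum (MInl a) l r) (minst l a) (minstT C (MInl a)))"
| Sum_beta_inr: "mtt (JTy SSet G A) \<Longrightarrow> mtt (JTy SSet G B) \<Longrightarrow>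
    mtt (JTy SCol (TSum A B # G) C) \<Longrightarrow> mtt (JTm G b B) \<Longrightarrow>
    mtt (JTm (A # G) l (matT 1 (MInl (MVar 0)) C)) \<Longrightarrow>
    mtt (JTm (B # G) r (matT 1 (MInr (MVar 0)) C)) \<Longrightarrow>
    mtt (JEq G (MElSum (MInr b) l r) (minst r b) (minstT C (MInr b)))"

| Sig_form: "s \<in> {SSet, SCol} \<Longrightarrow> mtt (JTy s G A) \<Longrightarrow> mtt (JTy s (A # G) B) \<Longrightarrow>
    mtt (JTy s G (TSig A B))"
| Sig_form_eq: "s \<in> {SSet, SCol} \<Longrightarrow> mtt (JTyEq s G A A') \<Longrightarrow> mtt (JTyEq s (A # G) B B') \<Longrightarrow>
    mtt (JTyEq s G (TSig A B) (TSig A' B'))"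
| Sig_intro: "mtt (JTy SCol G A) \<Longrightarrow> mtt (JTy SCol (A # G) B) \<Longrightarrow> mtt (JTm G a A) \<Longrightarrow>
    mtt (JTm G b (minstT B a)) \<Longrightarrow> mtt (JTm G (MPair a b) (TSig A B))"
| Sig_elim: "mtt (JTy SCol G A) \<Longrightarrow> mtt (JTy SCol (A # G) B) \<Longrightarrow>
    mtt (JTy SCol (TSig A B # G) C) \<Longrightarrow> mtt (JTm G d (TSig A B)) \<Longrightarrow>
    mtt (JTm (B # A # G) c (matT 2 (MPair (MVar 1) (MVar 0)) C)) \<Longrightarrow>
    mtt (JTm G (MElSig d c) (minstT C d))"
| Sig_beta: "mtt (JTy SCol G A) \<Longrightarrow> mtt (JTy SCol (A # G) B) \<Longrightarrow>
    mtt (JTy SCol (TSig A B # G) C) \<Longrightarrow> mtt (JTm G a A) \<Longrightarrow> mtt (JTm G b (minstT B a)) \<Longrightarrow>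
    mtt (JTm (B # A # G) c (matT 2 (MPair (MVar 1) (MVar 0)) C)) \<Longrightarrow>
    mtt (JEq G (MElSig (MPair a b) c) (msub (b \<rhd> a \<rhd> MVar) c) (minstT C (MPair a b)))"

| Pi_form: "mtt (JTy SSet G A) \<Longrightarrow> mtt (JTy SSet (A # G) B) \<Longrightarrow> mtt (JTy SSet G (TPi A B))"
| Pi_form_eq: "mtt (JTyEq SSet G A A') \<Longrightarrow> mtt (JTyEq SSet (A # G) B B') \<Longrightarrow>
    mtt (JTyEq SSet G (TPi A B) (TPi A' B'))"
| Pi_intro: "mtt (JTy SSet G A) \<Longrightarrow> mtt (JTy SSet (A # G) B) \<Longrightarrow> mtt (JTm (A # G) b B) \<Longrightarrow>
    mtt (JTm G (MLam b) (TPi A B))"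
| Pi_elim: "mtt (JTy SSet G A) \<Longrightarrow> mtt (JTy SSet (A # G) B) \<Longrightarrow> mtt (JTm G f (TPi A B)) \<Longrightarrow>
    mtt (JTm G a A) \<Longrightarrow> mtt (JTm G (MAp f a) (minstT B a))"
| Pi_beta: "mtt (JTy SSet G A) \<Longrightarrow> mtt (JTy SSet (A # G) B) \<Longrightarrow> mtt (JTm (A # G) b B) \<Longrightarrow>
    mtt (JTm G a A) \<Longrightarrow> mtt (JEq G (MAp (MLam b) a) (minst b a) (minstT B a))"

| Props_form: "mtt (JCtx G) \<Longrightarrow> mtt (JTy SCol G TProps)"
| FunProps_form: "mtt (JTy SSet G A) \<Longrightarrow> mtt (JTy SCol G (TFunProps A))"
| FunProps_form_eq: "mtt (JTyEq SSet G A A') \<Longrightarrow> mtt (JTyEq SCol G (TFunProps A) (TFunProps A'))"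
| FunProps_intro: "mtt (JTy SSet G A) \<Longrightarrow> mtt (JTm (A # G) p TProps) \<Longrightarrow>
    mtt (JTm G (MLam p) (TFunProps A))"
| FunProps_elim: "mtt (JTy SSet G A) \<Longrightarrow> mtt (JTm G f (TFunProps A)) \<Longrightarrow> mtt (JTm G a A) \<Longrightarrow>
    mtt (JTm G (MAp f a) TProps)"
| FunProps_beta: "mtt (JTy SSet G A) \<Longrightarrow> mtt (JTm (A # G) p TProps) \<Longrightarrow> mtt (JTm G a A) \<Longrightarrow>
    mtt (JEq G (MAp (MLam p) a) (minst p a) TProps)"

| Bot_form: "mtt (JCtx G) \<Longrightarrow> mtt (JTy SProps G TBot)"
| Bot_elim: "mtt (JTy SProp G C) \<Longrightarrow> mtt (JTm G d TBot) \<Longrightarrow> mtt (JTm G (MR0 d) C)"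

| Or_form: "is_prop s \<Longrightarrow> mtt (JTy s G A) \<Longrightarrow> mtt (JTy s G B) \<Longrightarrow> mtt (JTy s G (TOr A B))"
| Or_form_eq: "is_prop s \<Longrightarrow> mtt (JTyEq s G A A') \<Longrightarrow> mtt (JTyEq s G B B') \<Longrightarrow>
    mtt (JTyEq s G (TOr A B) (TOr A' B'))"
| Or_inl: "mtt (JTy SProp G A) \<Longrightarrow> mtt (JTy SProp G B) \<Longrightarrow> mtt (JTm G a A) \<Longrightarrow>
    mtt (JTm G (MInlOr a) (TOr A B))"
| Or_inr: "mtt (JTy SProp G A) \<Longrightarrow> mtt (JTy SProp G B) \<Longrightarrow> mtt (JTm G b B) \<Longrightarrow>
    mtt (JTm G (MInrOr b) (TOr A B))"
| Or_elim: "mtt (JTy SProp G A) \<Longrightarrow> mtt (JTy SProp G B) \<Longrightarrow> mtt (JTy SProp G C) \<Longrightarrow>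
    mtt (JTm G d (TOr A B)) \<Longrightarrow> mtt (JTm (A # G) l (mwkT 1 C)) \<Longrightarrow>
    mtt (JTm (B # G) r (mwkT 1 C)) \<Longrightarrow> mtt (JTm G (MElOr C d l r) C)"
| Or_beta_inl: "mtt (JTy SProp G A) \<Longrightarrow> mtt (JTy SProp G B) \<Longrightarrow> mtt (JTy SProp G C) \<Longrightarrow>
    mtt (JTm G a A) \<Longrightarrow> mtt (JTm (A # G) l (mwkT 1 C)) \<Longrightarrow>
    mtt (JTm (B # G) r (mwkT 1 C)) \<Longrightarrow> mtt (JEq G (MElOr C (MInlOr a) l r) (minst l a) C)"
| Or_beta_inr: "mtt (JTy SProp G A) \<Longrightarrow> mtt (JTy SProp G B) \<Longrightarrow> mtt (JTy SProp G C) \<Longrightarrow>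
    mtt (JTm G b B) \<Longrightarrow> mtt (JTm (A # G) l (mwkT 1 C)) \<Longrightarrow>
    mtt (JTm (B # G) r (mwkT 1 C)) \<Longrightarrow> mtt (JEq G (MElOr C (MInrOr b) l r) (minst r b) C)"

| And_form: "is_prop s \<Longrightarrow> mtt (JTy s G A) \<Longrightarrow> mtt (JTy s G B) \<Longrightarrow> mtt (JTy s G (TAnd A B))"
| And_form_eq: "is_prop s \<Longrightarrow> mtt (JTyEq s G A A') \<Longrightarrow> mtt (JTyEq s G B B') \<Longrightarrow>
    mtt (JTyEq s G (TAnd A B) (TAnd A' B'))"
| And_intro: "mtt (JTy SProp G A) \<Longrightarrow> mtt (JTy SProp G B) \<Longrightarrow> mtt (JTm G a A) \<Longrightarrow>
    mtt (JTm G b B) \<Longrightarrow> mtt (JTm G (MPairAnd a b) (TAnd A B))"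
| And_elim1: "mtt (JTy SProp G A) \<Longrightarrow> mtt (JTy SProp G B) \<Longrightarrow> mtt (JTm G d (TAnd A B)) \<Longrightarrow>
    mtt (JTm G (MPi1 d) A)"
| And_elim2: "mtt (JTy SProp G A) \<Longrightarrow> mtt (JTy SProp G B) \<Longrightarrow> mtt (JTm G d (TAnd A B)) \<Longrightarrow>
    mtt (JTm G (MPi2 d) B)"
| And_beta1: "mtt (JTy SProp G A) \<Longrightarrow> mtt (JTy SProp G B) \<Longrightarrow> mtt (JTm G a A) \<Longrightarrow>
    mtt (JTm G b B) \<Longrightarrow> mtt (JEq G (MPi1 (MPairAnd a b)) a A)"
| And_beta2: "mtt (JTy SProp G A) \<Longrightarrow> mtt (JTy SProp G B) \<Longrightarrow> mtt (JTm G a A) \<Longrightarrow>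
    mtt (JTm G b B) \<Longrightarrow> mtt (JEq G (MPi2 (MPairAnd a b)) b B)"

| Imp_form: "is_prop s \<Longrightarrow> mtt (JTy s G A) \<Longrightarrow> mtt (JTy s G B) \<Longrightarrow> mtt (JTy s G (TImp A B))"
| Imp_form_eq: "is_prop s \<Longrightarrow> mtt (JTyEq s G A A') \<Longrightarrow> mtt (JTyEq s G B B') \<Longrightarrow>
    mtt (JTyEq s G (TImp A B) (TImp A' B'))"
| Imp_intro: "mtt (JTy SProp G A) \<Longrightarrow> mtt (JTy SProp G B) \<Longrightarrow> mtt (JTm (A # G) b (mwkT 1 B)) \<Longrightarrow>
    mtt (JTm G (MLamImp b) (TImp A B))"
| Imp_elim: "mtt (JTy SProp G A) \<Longrightarrow> mtt (JTy SProp G B) \<Longrightarrow> mtt (JTm G f (TImp A B)) \<Longrightarrow>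
    mtt (JTm G a A) \<Longrightarrow> mtt (JTm G (MApImp f a) B)"
| Imp_beta: "mtt (JTy SProp G A) \<Longrightarrow> mtt (JTy SProp G B) \<Longrightarrow> mtt (JTm (A # G) b (mwkT 1 B)) \<Longrightarrow>
    mtt (JTm G a A) \<Longrightarrow> mtt (JEq G (MApImp (MLamImp b) a) (minst b a) B)"

| Ex_form: "is_prop s \<Longrightarrow> mtt (JTy (domsort s) G A) \<Longrightarrow> mtt (JTy s (A # G) B) \<Longrightarrow>
    mtt (JTy s G (TEx A B))"
| Ex_form_eq: "is_prop s \<Longrightarrow> mtt (JTyEq (domsort s) G A A') \<Longrightarrow> mtt (JTyEq s (A # G) B B') \<Longrightarrow>
    mtt (JTyEq s G (TEx A B) (TEx A' B'))"
| Ex_intro: "mtt (JTy SCol G A) \<Longrightarrow> mtt (JTy SProp (A # G) B) \<Longrightarrow> mtt (JTm G a A) \<Longrightarrow>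
    mtt (JTm G b (minstT B a)) \<Longrightarrow> mtt (JTm G (MPairEx a b) (TEx A B))"
| Ex_elim: "mtt (JTy SCol G A) \<Longrightarrow> mtt (JTy SProp (A # G) B) \<Longrightarrow> mtt (JTy SProp G C) \<Longrightarrow>
    mtt (JTm G d (TEx A B)) \<Longrightarrow> mtt (JTm (B # A # G) c (mwkT 2 C)) \<Longrightarrow>
    mtt (JTm G (MElEx C d c) C)"
| Ex_beta: "mtt (JTy SCol G A) \<Longrightarrow> mtt (JTy SProp (A # G) B) \<Longrightarrow> mtt (JTy SProp G C) \<Longrightarrow>
    mtt (JTm G a A) \<Longrightarrow> mtt (JTm G b (minstT B a)) \<Longrightarrow>
    mtt (JTm (B # A # G) c (mwkT 2 C)) \<Longrightarrow>
    mtt (JEq G (MElEx C (MPairEx a b) c) (msub (b \<rhd> a \<rhd> MVar) c) C)"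

| All_form: "is_prop s \<Longrightarrow> mtt (JTy (domsort s) G A) \<Longrightarrow> mtt (JTy s (A # G) B) \<Longrightarrow>
    mtt (JTy s G (TAll A B))"
| All_form_eq: "is_prop s \<Longrightarrow> mtt (JTyEq (domsort s) G A A') \<Longrightarrow> mtt (JTyEq s (A # G) B B') \<Longrightarrow>
    mtt (JTyEq s G (TAll A B) (TAll A' B'))"
| All_intro: "mtt (JTy SCol G A) \<Longrightarrow> mtt (JTy SProp (A # G) B) \<Longrightarrow> mtt (JTm (A # G) b B) \<Longrightarrow>
    mtt (JTm G (MLamAll b) (TAll A B))"
| All_elim: "mtt (JTy SCol G A) \<Longrightarrow> mtt (JTy SProp (A # G) B) \<Longrightarrow> mtt (JTm G f (TAll A B)) \<Longrightarrow>
    mtt (JTm G a A) \<Longrightarrow> mtt (JTm G (MApAll f a) (minstT B a))"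
| All_beta: "mtt (JTy SCol G A) \<Longrightarrow> mtt (JTy SProp (A # G) B) \<Longrightarrow> mtt (JTm (A # G) b B) \<Longrightarrow>
    mtt (JTm G a A) \<Longrightarrow> mtt (JEq G (MApAll (MLamAll b) a) (minst b a) (minstT B a))"

| Id_form: "is_prop s \<Longrightarrow> mtt (JTy (domsort s) G A) \<Longrightarrow> mtt (JTm G a A) \<Longrightarrow> mtt (JTm G b A) \<Longrightarrow>
    mtt (JTy s G (TId A a b))"
| Id_form_eq: "is_prop s \<Longrightarrow> mtt (JTyEq (domsort s) G A A') \<Longrightarrow> mtt (JEq G a a' A) \<Longrightarrow>
    mtt (JEq G b b' A) \<Longrightarrow> mtt (JTyEq s G (TId A a b) (TId A' a' b'))"
| Id_intro: "mtt (JTy SCol G A) \<Longrightarrow> mtt (JTm G a A) \<Longrightarrow> mtt (JTm G (MRefl A a) (TId A a a))"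
| Id_elim: "mtt (JTy SCol G A) \<Longrightarrow> mtt (JTm G a A) \<Longrightarrow> mtt (JTm G b A) \<Longrightarrow>
    mtt (JTy SProp (mwkT 1 A # A # G) C) \<Longrightarrow> mtt (JTm G p (TId A a b)) \<Longrightarrow>
    mtt (JTm (A # G) c (msubT (MVar 0 \<rhd> MVar 0 \<rhd> (\<lambda>n. MVar (n + 1))) C)) \<Longrightarrow>
    mtt (JTm G (MElId p c) (msubT (b \<rhd> a \<rhd> MVar) C))"
| Id_beta: "mtt (JTy SCol G A) \<Longrightarrow> mtt (JTm G a A) \<Longrightarrow>
    mtt (JTy SProp (mwkT 1 A # A # G) C) \<Longrightarrow>
    mtt (JTm (A # G) c (msubT (MVar 0 \<rhd> MVar 0 \<rhd> (\<lambda>n. MVar (n + 1))) C)) \<Longrightarrow>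
    mtt (JEq G (MElId (MRefl A a) c) (minst c a) (msubT (a \<rhd> a \<rhd> MVar) C))"

| Tau_form: "mtt (JTm G p TProps) \<Longrightarrow> mtt (JTy SProps G (TTau p))"
| CBot_intro: "mtt (JCtx G) \<Longrightarrow> mtt (JTm G CBot TProps)"
| COr_intro: "mtt (JTm G p TProps) \<Longrightarrow> mtt (JTm G q TProps) \<Longrightarrow> mtt (JTm G (COr p q) TProps)"
| CAnd_intro: "mtt (JTm G p TProps) \<Longrightarrow> mtt (JTm G q TProps) \<Longrightarrow> mtt (JTm G (CAnd p q) TProps)"
| CImp_intro: "mtt (JTm G p TProps) \<Longrightarrow> mtt (JTm G q TProps) \<Longrightarrow> mtt (JTm G (CImp p q) TProps)"
| CEx_intro: "mtt (JTy SSet G A) \<Longrightarrow> mtt (JTm (A # G) p TProps) \<Longrightarrow> mtt (JTm G (CEx A p) TProps)"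
| CAll_intro: "mtt (JTy SSet G A) \<Longrightarrow> mtt (JTm (A # G) p TProps) \<Longrightarrow> mtt (JTm G (CAll A p) TProps)"
| CId_intro: "mtt (JTy SSet G A) \<Longrightarrow> mtt (JTm G a A) \<Longrightarrow> mtt (JTm G b A) \<Longrightarrow>
    mtt (JTm G (CId A a b) TProps)"
| CBot_tau: "mtt (JCtx G) \<Longrightarrow> mtt (JTyEq SProps G (TTau CBot) TBot)"
| COr_tau: "mtt (JTm G p TProps) \<Longrightarrow> mtt (JTm G q TProps) \<Longrightarrow>
    mtt (JTyEq SProps G (TTau (COr p q)) (TOr (TTau p) (TTau q)))"
| CAnd_tau: "mtt (JTm G p TProps) \<Longrightarrow> mtt (JTm G q TProps) \<Longrightarrow>
    mtt (JTyEq SProps G (TTau (CAnd p q)) (TAnd (TTau p) (TTau q)))"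
| CImp_tau: "mtt (JTm G p TProps) \<Longrightarrow> mtt (JTm G q TProps) \<Longrightarrow>
    mtt (JTyEq SProps G (TTau (CImp p q)) (TImp (TTau p) (TTau q)))"
| CEx_tau: "mtt (JTy SSet G A) \<Longrightarrow> mtt (JTm (A # G) p TProps) \<Longrightarrow>
    mtt (JTyEq SProps G (TTau (CEx A p)) (TEx A (TTau p)))"
| CAll_tau: "mtt (JTy SSet G A) \<Longrightarrow> mtt (JTm (A # G) p TProps) \<Longrightarrow>
    mtt (JTyEq SProps G (TTau (CAll A p)) (TAll A (TTau p)))"
| CId_tau: "mtt (JTy SSet G A) \<Longrightarrow> mtt (JTm G a A) \<Longrightarrow> mtt (JTm G b A) \<Longrightarrow>
    mtt (JTyEq SProps G (TTau (CId A a b)) (TId A a b))"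


section \<open>The interpretation\<close>

record choice =
  p_0 :: htm
  p_imp :: htm
  p_and :: htm
  p_all :: htm
  p_or :: htm
  p_ex :: htm
  p_id :: htm
  s_coe :: htm
  s_0 :: htm
  s_1 :: htm
  s_pi :: htm
  s_sig :: htm
  s_sum :: htm
  s_list :: htm
  s_PROP :: htm

text \<open>
  All propositions and collections are interpreted in \<open>U\<^sub>1\<close>, and by cumulativity \<open>\<Pi>A : U\<^sub>1\<close> covers
  the small ones too. A raw type has a single \<open>pr\<^sub>P\<close> and \<open>pr\<^sub>S\<close>, regardless of its sort, hence
  one closed term of each kind, of the type at \<open>U\<^sub>1\<close>, is what the interpretation uses.
\<close>

definition is_choice :: "hjudg set \<Rightarrow> choice \<Rightarrow> bool" where
  "is_choice E ch \<longleftrightarrow>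
    (\<forall>(t, T) \<in> {
       (p_0 ch, hisprop HEmpty),
       (p_imp ch, HPi (HUniv 1) (HPi (HUniv 1) (HPi (hisprop (HVar 0))
          (hisprop (hfun (HVar 2) (HVar 1)))))),
       (p_and ch, HPi (HUniv 1) (HPi (HUniv 1) (HPi (hisprop (HVar 1)) (HPi (hisprop (HVar 1))
          (hisprop (hprod (HVar 3) (HVar 2))))))),
       (p_all ch, HPi (HUniv 1) (HPi (hfun (HVar 0) (HUniv 1))
          (HPi (HPi (HVar 1) (hisprop (HApp (HVar 1) (HVar 0))))
          (hisprop (HPi (HVar 2) (HApp (HVar 2) (HVar 0))))))),
       (p_or ch, HPi (HUniv 1) (HPi (HUniv 1) (hisprop (hor (HVar 1) (HVar 0))))),
       (p_ex ch, HPi (HUniv 1) (HPi (hfun (HVar 0) (HUniv 1))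
          (hisprop (hex (HVar 1) (HApp (HVar 1) (HVar 0)))))),
       (p_id ch, HPi (HUniv 1) (HPi (hisset (HVar 0)) (HPi (HVar 1) (HPi (HVar 2)
          (hisprop (HId (HVar 3) (HVar 1) (HVar 0))))))),
       (s_coe ch, HPi (HUniv 1) (hfun (hisprop (HVar 0)) (hisset (HVar 0)))),
       (s_0 ch, hisset HEmpty),
       (s_1 ch, hisset HUnit),
       (s_pi ch, HPi (HUniv 1) (HPi (hfun (HVar 0) (HUniv 1))
          (HPi (HPi (HVar 1) (hisset (HApp (HVar 1) (HVar 0))))
          (hisset (HPi (HVar 2) (HApp (HVar 2) (HVar 0))))))),
       (s_sig ch, HPi (HUniv 1) (HPi (hfun (HVar 0) (HUniv 1)) (HPi (hisset (HVar 1))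
          (HPi (HPi (HVar 2) (hisset (HApp (HVar 2) (HVar 0))))
          (hisset (HSig (HVar 3) (HApp (HVar 3) (HVar 0)))))))),
       (s_sum ch, HPi (HUniv 1) (HPi (HUniv 1) (HPi (hisset (HVar 1)) (HPi (hisset (HVar 1))
          (hisset (HSum (HVar 3) (HVar 2))))))),
       (s_list ch, HPi (HUniv 1) (HPi (hisset (HVar 0)) (hisset (HList (HVar 1))))),
       (s_PROP ch, hisset (hPROP 0))}.
     hclosed t \<and> hott E (HTm [] t T))"

abbreviation happs :: "htm \<Rightarrow> htm list \<Rightarrow> htm"
  where "happs f as \<equiv> foldl HApp f as"

text \<open>\<open>ity\<close> and \<open>itm\<close> are the partial map on types and terms, \<open>iprP\<close> and \<open>iprS\<close> are
  \<open>pr\<^sub>P\<close> and \<open>pr\<^sub>S\<close>.\<close>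

context
  fixes ch :: choice
begin

function (sequential)
  ity :: "mty \<Rightarrow> htm option" and
  iprP :: "mty \<Rightarrow> htm option" and
  iprS :: "mty \<Rightarrow> htm option" and
  itm :: "mtm \<Rightarrow> htm option"
where
  "ity TN0 = Some HEmpty"
| "ity TN1 = Some HUnit"
| "ity (TList A) = do { A' \<leftarrow> ity A; Some (HList A') }"
| "ity (TSum A B) = do { A' \<leftarrow> ity A; B' \<leftarrow> ity B; Some (HSum A' B') }"
| "ity (TSig A B) = do { A' \<leftarrow> ity A; B' \<leftarrow> ity B; Some (HSig A' B') }"
| "ity (TPi A B) = do { A' \<leftarrow> ity A; B' \<leftarrow> ity B; Some (HPi A' B') }"
| "ity TProps = Some (hPROP 0)"
| "ity (TFunProps A) = do { A' \<leftarrow> ity A; Some (hfun A' (hPROP 0)) }"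
| "ity TBot = Some HEmpty"
| "ity (TOr A B) = do { A' \<leftarrow> ity A; B' \<leftarrow> ity B; Some (hor A' B') }"
| "ity (TAnd A B) = do { A' \<leftarrow> ity A; B' \<leftarrow> ity B; Some (hprod A' B') }"
| "ity (TImp A B) = do { A' \<leftarrow> ity A; B' \<leftarrow> ity B; Some (hfun A' B') }"
| "ity (TEx A B) = do { A' \<leftarrow> ity A; B' \<leftarrow> ity B; Some (hex A' B') }"
| "ity (TAll A B) = do { A' \<leftarrow> ity A; B' \<leftarrow> ity B; Some (HPi A' B') }"
| "ity (TId A a b) = do { A' \<leftarrow> ity A; a' \<leftarrow> itm a; b' \<leftarrow> itm b; Some (HId A' a' b') }"
| "ity (TTau p) = do { p' \<leftarrow> itm p; Some (hpr1 p') }"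

| "iprP TBot = Some (p_0 ch)"
| "iprP (TOr A B) = do { A' \<leftarrow> ity A; B' \<leftarrow> ity B; Some (happs (p_or ch) [A', B']) }"
| "iprP (TAnd A B) = do { A' \<leftarrow> ity A; B' \<leftarrow> ity B; pA \<leftarrow> iprP A; pB \<leftarrow> iprP B;
     Some (happs (p_and ch) [A', B', pA, pB]) }"
| "iprP (TImp A B) = do { A' \<leftarrow> ity A; B' \<leftarrow> ity B; pB \<leftarrow> iprP B;
     Some (happs (p_imp ch) [A', B', pB]) }"
| "iprP (TEx A B) = do { A' \<leftarrow> ity A; B' \<leftarrow> ity B; Some (happs (p_ex ch) [A', HLam B']) }"
| "iprP (TAll A B) = do { A' \<leftarrow> ity A; B' \<leftarrow> ity B; pB \<leftarrow> iprP B;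
     Some (happs (p_all ch) [A', HLam B', HLam pB]) }"
| "iprP (TId A a b) = do { A' \<leftarrow> ity A; sA \<leftarrow> iprS A; a' \<leftarrow> itm a; b' \<leftarrow> itm b;
     Some (happs (p_id ch) [A', sA, a', b']) }"
| "iprP (TTau p) = do { p' \<leftarrow> itm p; Some (hpr2 p') }"
| "iprP _ = None"

| "iprS TN0 = Some (s_0 ch)"
| "iprS TN1 = Some (s_1 ch)"
| "iprS (TList A) = do { A' \<leftarrow> ity A; sA \<leftarrow> iprS A; Some (happs (s_list ch) [A', sA]) }"
| "iprS (TSum A B) = do { A' \<leftarrow> ity A; B' \<leftarrow> ity B; sA \<leftarrow> iprS A; sB \<leftarrow> iprS B;
     Some (happs (s_sum ch) [A', B', sA, sB]) }"
| "iprS (TSig A B) = do { A' \<leftarrow> ity A; B' \<leftarrow> ity B; sA \<leftarrow> iprS A; sB \<leftarrow> iprS B;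
     Some (happs (s_sig ch) [A', HLam B', sA, HLam sB]) }"
| "iprS (TPi A B) = do { A' \<leftarrow> ity A; B' \<leftarrow> ity B; sB \<leftarrow> iprS B;
     Some (happs (s_pi ch) [A', HLam B', HLam sB]) }"
| "iprS TProps = Some (s_PROP ch)"
| "iprS (TFunProps A) = do { A' \<leftarrow> ity A;
     Some (happs (s_pi ch) [A', HLam (hPROP 0), HLam (s_PROP ch)]) }"
| "iprS P = do { P' \<leftarrow> ity P; p \<leftarrow> iprP P; Some (happs (s_coe ch) [P', p]) }"

| "itm (MVar n) = Some (HVar n)"
| "itm (MEmp0 d) = do { d' \<leftarrow> itm d; Some (HIndEmpty d') }"
| "itm MStar = Some HStar"
| "itm (MElN1 d c) = do { d' \<leftarrow> itm d; c' \<leftarrow> itm c; Some (HIndUnit d' c') }"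
| "itm MNil = Some HNil"
| "itm (MCons l a) = do { l' \<leftarrow> itm l; a' \<leftarrow> itm a; Some (HCons l' a') }"
| "itm (MElList d n c) = do { d' \<leftarrow> itm d; n' \<leftarrow> itm n; c' \<leftarrow> itm c; Some (HIndList d' n' c') }"
| "itm (MInl a) = do { a' \<leftarrow> itm a; Some (HInl a') }"
| "itm (MInr b) = do { b' \<leftarrow> itm b; Some (HInr b') }"
| "itm (MElSum d l r) = do { d' \<leftarrow> itm d; l' \<leftarrow> itm l; r' \<leftarrow> itm r; Some (HIndSum d' l' r') }"
| "itm (MPair a b) = do { a' \<leftarrow> itm a; b' \<leftarrow> itm b; Some (HPair a' b') }"
| "itm (MElSig d c) = do { d' \<leftarrow> itm d; c' \<leftarrow> itm c; Some (HIndSig d' c') }"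
| "itm (MLam b) = do { b' \<leftarrow> itm b; Some (HLam b') }"
| "itm (MAp f a) = do { f' \<leftarrow> itm f; a' \<leftarrow> itm a; Some (HApp f' a') }"
| "itm (MR0 d) = do { d' \<leftarrow> itm d; Some (HIndEmpty d') }"
| "itm (MInlOr a) = do { a' \<leftarrow> itm a; Some (hinl_or a') }"
| "itm (MInrOr b) = do { b' \<leftarrow> itm b; Some (hinr_or b') }"
| "itm (MElOr C d l r) = do { d' \<leftarrow> itm d; l' \<leftarrow> itm l; r' \<leftarrow> itm r; pC \<leftarrow> iprP C;
     Some (hind_or d' l' r' pC) }"
| "itm (MPairAnd a b) = do { a' \<leftarrow> itm a; b' \<leftarrow> itm b; Some (HPair a' b') }"
| "itm (MPi1 d) = do { d' \<leftarrow> itm d; Some (hpr1 d') }"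
| "itm (MPi2 d) = do { d' \<leftarrow> itm d; Some (hpr2 d') }"
| "itm (MLamImp b) = do { b' \<leftarrow> itm b; Some (HLam b') }"
| "itm (MApImp f a) = do { f' \<leftarrow> itm f; a' \<leftarrow> itm a; Some (HApp f' a') }"
| "itm (MPairEx a b) = do { a' \<leftarrow> itm a; b' \<leftarrow> itm b; Some (hpair_ex a' b') }"
| "itm (MElEx C d c) = do { d' \<leftarrow> itm d; c' \<leftarrow> itm c; pC \<leftarrow> iprP C; Some (hind_ex d' c' pC) }"
| "itm (MLamAll b) = do { b' \<leftarrow> itm b; Some (HLam b') }"
| "itm (MApAll f a) = do { f' \<leftarrow> itm f; a' \<leftarrow> itm a; Some (HApp f' a') }"
| "itm (MRefl A a) = do { a' \<leftarrow> itm a; Some (HRefl a') }"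
| "itm (MElId p c) = do { p' \<leftarrow> itm p; c' \<leftarrow> itm c; Some (HIndId p' c') }"
| "itm CBot = Some (HPair HEmpty (p_0 ch))"
| "itm (COr p q) = do { p' \<leftarrow> itm p; q' \<leftarrow> itm q;
     Some (HPair (hor (hpr1 p') (hpr1 q')) (happs (p_or ch) [hpr1 p', hpr1 q'])) }"
| "itm (CAnd p q) = do { p' \<leftarrow> itm p; q' \<leftarrow> itm q;
     Some (HPair (hprod (hpr1 p') (hpr1 q'))
       (happs (p_and ch) [hpr1 p', hpr1 q', hpr2 p', hpr2 q'])) }"
| "itm (CImp p q) = do { p' \<leftarrow> itm p; q' \<leftarrow> itm q;
     Some (HPair (hfun (hpr1 p') (hpr1 q')) (happs (p_imp ch) [hpr1 p', hpr1 q', hpr2 q'])) }"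
| "itm (CEx A p) = do { A' \<leftarrow> ity A; p' \<leftarrow> itm p;
     Some (HPair (hex A' (hpr1 p')) (happs (p_ex ch) [A', HLam (hpr1 p')])) }"
| "itm (CAll A p) = do { A' \<leftarrow> ity A; p' \<leftarrow> itm p;
     Some (HPair (HPi A' (hpr1 p')) (happs (p_all ch) [A', HLam (hpr1 p'), HLam (hpr2 p')])) }"
| "itm (CId A a b) = do { A' \<leftarrow> ity A; sA \<leftarrow> iprS A; a' \<leftarrow> itm a; b' \<leftarrow> itm b;
     Some (HPair (HId A' a' b') (happs (p_id ch) [A', sA, a', b'])) }"
  by pat_completeness auto

termination
  by (relation "measure (case_sum
        (case_sum (\<lambda>A. 3 * size A) (\<lambda>A. 3 * size A + 1))
        (case_sum (\<lambda>A. 3 * size A + 2) (\<lambda>a. 3 * size a)))")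
     auto

fun ictx :: "mctx \<Rightarrow> hctx option" where
  "ictx [] = Some []"
| "ictx (A # G) = do { G' \<leftarrow> ictx G; A' \<leftarrow> ity A; Some (A' # G') }"

definition ity_proof :: "msort \<Rightarrow> mty \<Rightarrow> htm option"
  where "ity_proof s A = (if is_prop s then iprP A else iprS A)"

end

fun level :: "msort \<Rightarrow> nat" where
  "level SSet = 0"
| "level SProps = 0"
| "level SCol = 1"
| "level SProp = 1"

definition hlevel_pred :: "msort \<Rightarrow> htm \<Rightarrow> htm"
  where "hlevel_pred s A = (if is_prop s then hisprop A else hisset A)"

definition hlevel_univ :: "msort \<Rightarrow> htm"
  where "hlevel_univ s = (if is_prop s then hPROP (level s) else hSET (level s))"

fun holds :: "hjudg set \<Rightarrow> choice \<Rightarrow> mjudg \<Rightarrow> bool" where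
  "holds E ch (JCtx G) \<longleftrightarrow> (\<exists>G'. ictx ch G = Some G' \<and> hott E (HCtx G'))"
| "holds E ch (JTy s G A) \<longleftrightarrow>
     (\<exists>G' A' p. ictx ch G = Some G' \<and> ity ch A = Some A' \<and> ity_proof ch s A = Some p \<and>
        hott E (HTm G' A' (HUniv (level s))) \<and> hott E (HTm G' p (hlevel_pred s A')))"
| "holds E ch (JTyEq s G A B) \<longleftrightarrow>
     (\<exists>G' A' p B' q. ictx ch G = Some G' \<and> ity ch A = Some A' \<and> ity_proof ch s A = Some p \<and>
        ity ch B = Some B' \<and> ity_proof ch s B = Some q \<and>
        hott E (HEq G' (HPair A' p) (HPair B' q) (hlevel_univ s)))"
| "holds E ch (JTm G a A) \<longleftrightarrow>
     (\<exists>G' a' A'. ictx ch G = Some G' \<and> itm ch a = Some a' \<and> ity ch A = Some A' \<and>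
        hott E (HTm G' a' A'))"
| "holds E ch (JEq G a b A) \<longleftrightarrow>
     (\<exists>G' a' b' A'. ictx ch G = Some G' \<and> itm ch a = Some a' \<and> itm ch b = Some b' \<and>
        ity ch A = Some A' \<and> hott E (HEq G' a' b' A'))"

end

theory Submission
  imports Defs
begin

text \<open>
  The interpretation is sound rule by rule, once it commutes with substitution (the chosen proof
  terms are closed). As the axioms \<open>E\<close> are arbitrary, no presupposition of a derivable
  homotopy-type-theoretic judgement can be recovered from it, so the induction carries all
  presuppositions along. Equality of types of \<open>mTT\<close> is interpreted by equality of the
  types and of the proofs of \<open>isProp\<close> or \<open>isSet\<close>; every type former respects both
  because the chosen proof terms are applied to equal arguments. The substitution of equals, which
  \<open>mTT\<close> has in place of the \<open>\<xi>\<close>-rule, follows from \<open>\<beta>\<close> and the congruence of application.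
\<close>

text \<open>Three obstacles shape the development. A chosen proof term such as
  \<open>s_pi ch\<close> receives a family as \<open>HLam B\<close>, so its type mentions the redex
  \<open>HApp (HLam B) x\<close> where the interpretation has \<open>B\<close>. The two are only
  definitionally equal, and every proof term for a binder is converted along the congruence of
  isProp or isSet. That congruence, like the typing of the second projection, rests on substitution
  of equals, which is why \<open>sub_cong\<close> precedes everything about type formers. Second,
  the universe of an interpreted type depends on its sort, while the chosen terms are typed at
  \<open>HUniv 1\<close>. Small types are raised by cumulativity before they meet a chosen term, and
  their own universe judgement is kept at \<open>level s\<close>. This is consistent because the raw
  types \<open>hisprop A\<close> and \<open>hisset A\<close> do not mention a universe. Third, a
  proposition regarded as a set or collection changes its proof from pr_P to \<open>s_coe\<close>
  applied to it. The recursion of \<open>iprS\<close> makes exactly this change, so subsumption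
  holds on the nose.\<close>

section \<open>Substitution calculus\<close>

text \<open>Otherwise the simplifier does not rewrite below the \<open>case_nat\<close> of \<open>\<rhd>\<close>.\<close>

declare nat.case_cong_weak [cong del]

lemma upr_Suc [simp]: "upr \<xi> (Suc n) = Suc (\<xi> n)"
  by (simp add: upr_def)

lemma hup_Suc [simp]: "hup \<sigma> (Suc n) = hwk 1 (\<sigma> n)"
  by (simp add: hup_def)

lemma upr_comp: "(\<lambda>n. upr \<xi> (upr \<zeta> n)) = upr (\<lambda>n. \<xi> (\<zeta> n))"
  by (auto simp: upr_def split: nat.split)

text \<open>The lift \<open>hup\<close> is defined by renaming, so the composition laws come in the
  order renaming after renaming, substitution after renaming, renaming after substitution,
  substitution after substitution. Under a binder the third uses the first, and the last uses the
  second and the third.\<close>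

lemma hren_hren: "hren \<xi> (hren \<zeta> t) = hren (\<lambda>n. \<xi> (\<zeta> n)) t"
  by (induction t arbitrary: \<xi> \<zeta>) (simp_all add: upr_comp)

lemma hup_upr: "(\<lambda>n. hup \<sigma> (upr \<zeta> n)) = hup (\<lambda>n. \<sigma> (\<zeta> n))"
  by (auto simp: hup_def upr_def split: nat.split)

lemma hsub_hren: "hsub \<sigma> (hren \<zeta> t) = hsub (\<lambda>n. \<sigma> (\<zeta> n)) t"
  by (induction t arbitrary: \<sigma> \<zeta>) (simp_all add: hup_upr)

lemma hup_ren: "hup (\<lambda>n. HVar (\<xi> n)) = (\<lambda>n. HVar (upr \<xi> n))"
  by (auto simp: hup_def upr_def hwk_def split: nat.split)

text \<open>Renamings are eliminated in favour of substitutions by variables, so that weakenings and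
  instantiations meet in one normal form.\<close>

lemma hren_hsub_var: "hren \<xi> t = hsub (\<lambda>n. HVar (\<xi> n)) t"
  by (induction t arbitrary: \<xi>) (simp_all add: hup_ren)

lemma upr_hup: "(\<lambda>n. hren (upr \<xi>) (hup \<sigma> n)) = hup (\<lambda>n. hren \<xi> (\<sigma> n))"
  by (auto simp: hup_def upr_def hwk_def hren_hren split: nat.split)

lemma hren_hsub: "hren \<xi> (hsub \<sigma> t) = hsub (\<lambda>n. hren \<xi> (\<sigma> n)) t"
  by (induction t arbitrary: \<sigma> \<xi>) (simp_all add: upr_hup)

lemma hup_hup: "(\<lambda>n. hsub (hup \<tau>) (hup \<sigma> n)) = hup (\<lambda>n. hsub \<tau> (\<sigma> n))"
  by (auto simp: hup_def hwk_def hsub_hren hren_hsub split: nat.split)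

lemma hsub_hsub: "hsub \<tau> (hsub \<sigma> t) = hsub (\<lambda>n. hsub \<tau> (\<sigma> n)) t"
  by (induction t arbitrary: \<sigma> \<tau>) (simp_all add: hup_hup)

lemma hup_HVar: "hup HVar = HVar"
  by (auto simp: hup_def hwk_def split: nat.split)

lemma hsub_HVar [simp]: "hsub HVar t = t"
  by (induction t) (simp_all add: hup_HVar)

text \<open>Pointwise, because \<open>hsub_hsub\<close> leaves \<open>hsub \<tau>\<close> applied to
  \<open>(a \<rhd> \<sigma>) n\<close> under a lambda; rewriting the body and eta-contracting gives
  an explicit list again.\<close>

lemma hsub_scons: "hsub \<tau> ((a \<rhd> \<sigma>) n) = (hsub \<tau> a \<rhd> (\<lambda>n. hsub \<tau> (\<sigma> n))) n"
  by (simp split: nat.split)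

lemma scons_var: "HVar ((k \<rhd> \<xi>) n) = (HVar k \<rhd> (\<lambda>n. HVar (\<xi> n))) n"
    "Suc ((k \<rhd> \<xi>) n) = (Suc k \<rhd> (\<lambda>n. Suc (\<xi> n))) n"
  by (simp_all split: nat.split)

text \<open>Eta laws: a list that enumerates consecutive variables collapses to the identity or to a
  shift.\<close>

lemma scons_HVar: "(HVar 0 \<rhd> (\<lambda>n. HVar (Suc n))) = HVar"
    "(HVar (Suc 0) \<rhd> (\<lambda>n. HVar (Suc (Suc n)))) = (\<lambda>n. HVar (Suc n))"
    "(HVar (Suc (Suc 0)) \<rhd> (\<lambda>n. HVar (Suc (Suc (Suc n))))) = (\<lambda>n. HVar (Suc (Suc n)))"
  by (auto split: nat.split)

lemma hup_sub: "hup \<sigma> = HVar 0 \<rhd> (\<lambda>n. hsub (\<lambda>m. HVar (Suc m)) (\<sigma> n))"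
  by (simp add: hup_def hwk_def hren_hsub_var)

lemma hwk_sub: "hwk k t = hsub (\<lambda>n. HVar (n + k)) t"
  by (simp add: hwk_def hren_hsub_var)

text \<open>These rules turn every combination of weakenings and substitutions into a single
  substitution given by an explicit list of terms.\<close>

lemmas sub_simps = hup_sub hwk_sub hat_def hren_hsub_var hsub_hsub hsub_scons scons_var scons_HVar upr_def

section \<open>Substitution in the derived types and terms\<close>

lemma hisprop_sub: "hsub \<sigma> (hisprop A) = hisprop (hsub \<sigma> A)"
  by (simp add: hisprop_def sub_simps)

lemma hisset_sub: "hsub \<sigma> (hisset A) = hisset (hsub \<sigma> A)"
  by (simp add: hisset_def sub_simps eval_nat_numeral)

lemma hprod_sub: "hsub \<sigma> (hprod A B) = hprod (hsub \<sigma> A) (hsub \<sigma> B)"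
  by (simp add: hprod_def sub_simps)

lemma hfun_sub: "hsub \<sigma> (hfun A B) = hfun (hsub \<sigma> A) (hsub \<sigma> B)"
  by (simp add: hfun_def sub_simps)

lemma hpr_sub: "hsub \<sigma> (hpr1 d) = hpr1 (hsub \<sigma> d)" "hsub \<sigma> (hpr2 d) = hpr2 (hsub \<sigma> d)"
  by (simp_all add: hpr1_def hpr2_def sub_simps)

lemma hPROP_sub: "hsub \<sigma> (hPROP i) = hPROP i"
  by (simp add: hPROP_def hisprop_sub sub_simps)

lemma hor_sub: "hsub \<sigma> (hor A B) = hor (hsub \<sigma> A) (hsub \<sigma> B)"
  by (simp add: hor_def)

lemma hex_sub: "hsub \<sigma> (hex A B) = hex (hsub \<sigma> A) (hsub (hup \<sigma>) B)"
  by (simp add: hex_def)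

lemma hinl_or_sub: "hsub \<sigma> (hinl_or a) = hinl_or (hsub \<sigma> a)"
    and hinr_or_sub: "hsub \<sigma> (hinr_or a) = hinr_or (hsub \<sigma> a)"
    and hpair_ex_sub: "hsub \<sigma> (hpair_ex a b) = hpair_ex (hsub \<sigma> a) (hsub \<sigma> b)"
  by (simp_all add: hinl_or_def hinr_or_def hpair_ex_def)

lemma hind_or_sub:
  "hsub \<sigma> (hind_or e l r s) = hind_or (hsub \<sigma> e) (hsub (hup \<sigma>) l) (hsub (hup \<sigma>) r) (hsub \<sigma> s)"
  by (simp add: hind_or_def sub_simps)

lemma hind_ex_sub:
  "hsub \<sigma> (hind_ex e l s) = hind_ex (hsub \<sigma> e) (hsub (hup (hup \<sigma>)) l) (hsub \<sigma> s)"
  by (simp add: hind_ex_def sub_simps)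

lemmas def_sub = hisprop_sub hisset_sub hprod_sub hfun_sub hpr_sub hPROP_sub hor_sub hex_sub
  hinl_or_sub hinr_or_sub hpair_ex_sub hind_or_sub hind_ex_sub

text \<open>The bound \<open>k\<close> generalises closedness so that the induction passes under
  binders: if \<open>\<sigma>\<close> fixes the indices below \<open>k\<close>, then
  \<open>hup \<sigma>\<close> fixes those below \<open>k + 1\<close>.\<close>

lemma hsub_scoped: "hscoped k t \<Longrightarrow> \<forall>n<k. \<sigma> n = HVar n \<Longrightarrow> hsub \<sigma> t = t"
proof (induction t arbitrary: k \<sigma>)
qed (force simp: hup_def hwk_def less_Suc_eq_0_disj split: nat.split)+

lemma hsub_closed: "hclosed t \<Longrightarrow> hsub \<sigma> t = t"
  by (rule hsub_scoped) auto

section \<open>Derived rules of homotopy type theory\<close>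

locale hott_theory =
  fixes E :: "hjudg set"
begin

abbreviation ctx ("\<turnstile> _" [51] 50)
  where "\<turnstile> G \<equiv> hott E (HCtx G)"

abbreviation typing ("_ \<turnstile> _ \<Ztypecolon> _" [51, 51, 51] 50)
  where "G \<turnstile> a \<Ztypecolon> A \<equiv> hott E (HTm G a A)"

abbreviation equality ("_ \<turnstile> _ \<simeq> _ \<Ztypecolon> _" [51, 51, 51, 51] 50)
  where "G \<turnstile> a \<simeq> b \<Ztypecolon> A \<equiv> hott E (HEq G a b A)"

text \<open>Since the axioms \<open>E\<close> are arbitrary judgements, derivable judgements need not satisfy their
  presuppositions; these are carried along explicitly by \<open>wf\<close> and \<open>deq\<close>.\<close>

inductive wf :: "hctx \<Rightarrow> bool" where
  "wf []"
| "wf G \<Longrightarrow> G \<turnstile> A \<Ztypecolon> HUniv i \<Longrightarrow> wf (A # G)"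

inductive_cases wf_ConsE: "wf (A # G)"

definition deq :: "hctx \<Rightarrow> htm \<Rightarrow> htm \<Rightarrow> htm \<Rightarrow> bool"
  where "deq G a b A \<longleftrightarrow> G \<turnstile> a \<Ztypecolon> A \<and> G \<turnstile> b \<Ztypecolon> A \<and> G \<turnstile> a \<simeq> b \<Ztypecolon> A"

text \<open>The premise on \<open>\<sigma>\<close> in the rules \<open>subst_tm\<close> and
  \<open>subst_eq\<close>, read as a morphism of contexts from \<open>D\<close> to
  \<open>G\<close>.\<close>

definition sub_ok :: "hctx \<Rightarrow> (nat \<Rightarrow> htm) \<Rightarrow> hctx \<Rightarrow> bool"
  where "sub_ok D \<sigma> G \<longleftrightarrow> (\<forall>n<length G. D \<turnstile> \<sigma> n \<Ztypecolon> hsub \<sigma> (hwk (Suc n) (G ! n)))"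

section \<open>Contexts, cumulativity, weakening and substitution\<close>

lemma wf_ctx: "wf G \<Longrightarrow> \<turnstile> G"
  by (induction rule: wf.induct) (auto intro: hott.ctx_empty hott.ctx_ext)

lemma wf_appendD: "wf (D @ G) \<Longrightarrow> wf G"
  by (induction D) (auto elim: wf_ConsE)

lemma deq_refl: "deq G a a A \<longleftrightarrow> G \<turnstile> a \<Ztypecolon> A"
  by (auto simp: deq_def intro: hott.eq_refl)

lemma deq_sym: "deq G a b A \<Longrightarrow> deq G b a A"
  by (auto simp: deq_def intro: hott.eq_sym)

lemma deq_trans: "deq G a b A \<Longrightarrow> deq G b c A \<Longrightarrow> deq G a c A"
  by (auto simp: deq_def intro: hott.eq_trans)

lemma deq_conv: "deq G a b A \<Longrightarrow> G \<turnstile> A \<simeq> B \<Ztypecolon> HUniv i \<Longrightarrow> deq G a b B"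
  by (auto simp: deq_def intro: hott.conv hott.conv_eq)

lemma deqD:
  assumes "deq G a b A"
  shows "G \<turnstile> a \<Ztypecolon> A" "G \<turnstile> b \<Ztypecolon> A" "G \<turnstile> a \<simeq> b \<Ztypecolon> A"
  using assms by (auto simp: deq_def)

lemma cumul_le: "G \<turnstile> A \<Ztypecolon> HUniv i \<Longrightarrow> i \<le> j \<Longrightarrow> G \<turnstile> A \<Ztypecolon> HUniv j"
  by (rotate_tac 1, induction j rule: dec_induct) (auto intro: hott.cumul)

lemma cumul_eq_le: "G \<turnstile> A \<simeq> B \<Ztypecolon> HUniv i \<Longrightarrow> i \<le> j \<Longrightarrow> G \<turnstile> A \<simeq> B \<Ztypecolon> HUniv j"
  by (rotate_tac 1, induction j rule: dec_induct) (auto intro: hott.cumul_eq)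

lemma deq_cumul: "deq G A B (HUniv i) \<Longrightarrow> i \<le> j \<Longrightarrow> deq G A B (HUniv j)"
  by (auto simp: deq_def intro: cumul_le cumul_eq_le)

lemma sub_ok_scons: "sub_ok D \<sigma> G \<Longrightarrow> D \<turnstile> a \<Ztypecolon> hsub \<sigma> A \<Longrightarrow> sub_ok D (a \<rhd> \<sigma>) (A # G)"
  by (auto simp: sub_ok_def less_Suc_eq_0_disj sub_simps)

lemma sub_ok_shift: "\<turnstile> D @ G \<Longrightarrow> k = length D \<Longrightarrow> sub_ok (D @ G) (\<lambda>n. HVar (n + k)) G"
proof (unfold sub_ok_def, intro allI impI)
  fix n assume a: "\<turnstile> D @ G" "k = length D" "n < length G"
  then have "D @ G \<turnstile> HVar (n + k) \<Ztypecolon> hwk (Suc (n + k)) ((D @ G) ! (n + k))"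
    by (intro hott.var) auto
  then show "D @ G \<turnstile> HVar (n + k) \<Ztypecolon> hsub (\<lambda>n. HVar (n + k)) (hwk (Suc n) (G ! n))"
    using a by (simp add: sub_simps nth_append add.assoc)
qed

lemma sub_ok_id: "\<turnstile> G \<Longrightarrow> sub_ok G HVar G"
  using sub_ok_shift[of "[]" G 0] by simp

lemma sub_ok_shift1: "G \<turnstile> A \<Ztypecolon> HUniv i \<Longrightarrow> sub_ok (A # G) (\<lambda>n. HVar (Suc n)) G"
  using sub_ok_shift[of "[A]" G 1] by (simp add: hott.ctx_ext)

lemma sub_tm: "G \<turnstile> a \<Ztypecolon> A \<Longrightarrow> \<turnstile> D \<Longrightarrow> sub_ok D \<sigma> G \<Longrightarrow> D \<turnstile> hsub \<sigma> a \<Ztypecolon> hsub \<sigma> A"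
  by (auto simp: sub_ok_def intro: hott.subst_tm)

lemma sub_eq: "G \<turnstile> a \<simeq> b \<Ztypecolon> A \<Longrightarrow> \<turnstile> D \<Longrightarrow> sub_ok D \<sigma> G \<Longrightarrow> D \<turnstile> hsub \<sigma> a \<simeq> hsub \<sigma> b \<Ztypecolon> hsub \<sigma> A"
  by (auto simp: sub_ok_def intro: hott.subst_eq)

lemma sub_deq: "deq G a b A \<Longrightarrow> \<turnstile> D \<Longrightarrow> sub_ok D \<sigma> G \<Longrightarrow> deq D (hsub \<sigma> a) (hsub \<sigma> b) (hsub \<sigma> A)"
  by (auto simp: deq_def intro: sub_tm sub_eq)

lemma wk_tm:
  assumes "G \<turnstile> a \<Ztypecolon> A" "\<turnstile> D @ G" "k = length D"
  shows "D @ G \<turnstile> hwk k a \<Ztypecolon> hwk k A"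
  using sub_tm[OF assms(1,2) sub_ok_shift[OF assms(2,3)]] by (simp add: sub_simps)

lemma wk1_tm: "G \<turnstile> a \<Ztypecolon> A \<Longrightarrow> G \<turnstile> B \<Ztypecolon> HUniv i \<Longrightarrow> B # G \<turnstile> hwk 1 a \<Ztypecolon> hwk 1 A"
  using wk_tm[of G a A "[B]" 1] by (simp add: hott.ctx_ext)

lemma wk1_ty: "G \<turnstile> A \<Ztypecolon> HUniv j \<Longrightarrow> G \<turnstile> B \<Ztypecolon> HUniv i \<Longrightarrow> B # G \<turnstile> hwk 1 A \<Ztypecolon> HUniv j"
  using wk1_tm[of G A "HUniv j" B i] by (simp add: sub_simps)

lemma wk1_deq: "deq G a b A \<Longrightarrow> G \<turnstile> B \<Ztypecolon> HUniv i \<Longrightarrow> deq (B # G) (hwk 1 a) (hwk 1 b) (hwk 1 A)"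
  using sub_deq[of G a b A "B # G", OF _ _ sub_ok_shift1] by (simp add: hott.ctx_ext sub_simps)

lemma closed_tm: "[] \<turnstile> a \<Ztypecolon> A \<Longrightarrow> \<turnstile> G \<Longrightarrow> G \<turnstile> a \<Ztypecolon> A"
  using sub_tm[of "[]" a A G HVar] by (simp add: sub_ok_def)

lemma inst_tm:
  "A # G \<turnstile> b \<Ztypecolon> B \<Longrightarrow> G \<turnstile> a \<Ztypecolon> A \<Longrightarrow> \<turnstile> G \<Longrightarrow> G \<turnstile> hinst b a \<Ztypecolon> hinst B a"
  by (rule sub_tm, assumption, assumption, rule sub_ok_scons) (auto intro: sub_ok_id)

lemma inst_ty:
  "A # G \<turnstile> B \<Ztypecolon> HUniv i \<Longrightarrow> G \<turnstile> a \<Ztypecolon> A \<Longrightarrow> \<turnstile> G \<Longrightarrow> G \<turnstile> hinst B a \<Ztypecolon> HUniv i"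
  using inst_tm[of A G B "HUniv i" a] by simp

lemma var0: "G \<turnstile> A \<Ztypecolon> HUniv i \<Longrightarrow> A # G \<turnstile> HVar 0 \<Ztypecolon> hwk 1 A"
  using hott.var[of E "A # G" 0] by (simp add: hott.ctx_ext)

lemma sub_ok_hup:
  assumes "sub_ok D \<sigma> G" "D \<turnstile> hsub \<sigma> A \<Ztypecolon> HUniv i"
  shows "sub_ok (hsub \<sigma> A # D) (hup \<sigma>) (A # G)"
  unfolding hup_sub
proof (rule sub_ok_scons)
  show "sub_ok (hsub \<sigma> A # D) (\<lambda>n. hsub (\<lambda>m. HVar (Suc m)) (\<sigma> n)) G"
    unfolding sub_ok_def
  proof (intro allI impI)
    fix n assume "n < length G"
    then have "D \<turnstile> \<sigma> n \<Ztypecolon> hsub \<sigma> (hwk (Suc n) (G ! n))"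
      using assms(1) by (simp add: sub_ok_def)
    from wk1_tm[OF this assms(2)]
    show "hsub \<sigma> A # D \<turnstile> hsub (\<lambda>m. HVar (Suc m)) (\<sigma> n) \<Ztypecolon>
        hsub (\<lambda>n. hsub (\<lambda>m. HVar (Suc m)) (\<sigma> n)) (hwk (Suc n) (G ! n))"
      by (simp add: sub_simps)
  qed
  show "hsub \<sigma> A # D \<turnstile> HVar 0 \<Ztypecolon> hsub (\<lambda>n. hsub (\<lambda>m. HVar (Suc m)) (\<sigma> n)) A"
    using var0[OF assms(2)] by (simp add: sub_simps)
qed

text \<open>Conversion of the last type of a context is the identity substitution: over
  \<open>A' # G\<close> the last variable has type \<open>A'\<close>, hence also \<open>A\<close>.
  Substituting along it moves judgements from \<open>A # G\<close> to \<open>A' # G\<close>.\<close>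

lemma ctx_conv:
  assumes "\<turnstile> G" "deq G A A' (HUniv i)"
  shows "sub_ok (A' # G) HVar (A # G)"
proof -
  have A': "G \<turnstile> A' \<Ztypecolon> HUniv i" using assms(2) by (rule deqD)
  have "A' # G \<turnstile> HVar 0 \<Ztypecolon> hwk 1 A"
    by (rule hott.conv[where i = i, OF var0[OF A']])
      (use wk1_deq[OF deq_sym[OF assms(2)] A'] in \<open>simp add: deq_def sub_simps\<close>)
  then show ?thesis
    using sub_ok_scons[OF sub_ok_shift1[OF A'], of "HVar 0" A]
    by (simp add: sub_simps)
qed

text \<open>The formation rules want both types in one universe, so both are raised to the
  maximum.\<close>

lemma pi_form_le:
  assumes "G \<turnstile> A \<Ztypecolon> HUniv i" "A # G \<turnstile> B \<Ztypecolon> HUniv j"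
  shows "G \<turnstile> HPi A B \<Ztypecolon> HUniv (max i j)"
  using assms by (intro hott.pi_form) (auto intro: cumul_le)

lemma sig_form_le:
  assumes "G \<turnstile> A \<Ztypecolon> HUniv i" "A # G \<turnstile> B \<Ztypecolon> HUniv j"
  shows "G \<turnstile> HSig A B \<Ztypecolon> HUniv (max i j)"
  using assms by (intro hott.sig_form) (auto intro: cumul_le)

subsection \<open>Substitution of equals\<close>

text \<open>The counterpart of \<open>mlist\<close>, so that the premises of the substitution rules
  of \<open>mTT\<close> translate literally.\<close>

definition hlist :: "htm list \<Rightarrow> nat \<Rightarrow> htm"
  where "hlist as = (\<lambda>n. if n < length as then as ! n else HVar (n - length as))"

lemma hlist_Nil [simp]: "hlist [] = HVar"
  by (simp add: hlist_def)

lemma hlist_Cons [simp]: "hlist (a # as) = a \<rhd> hlist as"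
  by (auto simp: hlist_def split: nat.split)

text \<open>There is no rule of substitution of equals in homotopy type theory, and with arbitrary axioms
  it cannot be shown by induction on derivations. It holds because
  \<open>(\<lambda>x. c) a \<simeq> (\<lambda>x. c) b\<close> can be \<open>\<beta>\<close>-reduced on both sides.\<close>

lemma sub_cong:
  assumes "wf (D @ G)" "length as = length D" "length bs = length D"
    and "\<forall>i<length D. deq G (as ! i) (bs ! i) (hsub (hlist (drop (Suc i) as)) (D ! i))"
  shows "sub_ok G (hlist as) (D @ G) \<and> sub_ok G (hlist bs) (D @ G) \<and>
    (\<forall>c C i. D @ G \<turnstile> c \<Ztypecolon> C \<longrightarrow> D @ G \<turnstile> C \<Ztypecolon> HUniv i \<longrightarrow>
      G \<turnstile> hsub (hlist as) c \<simeq> hsub (hlist bs) c \<Ztypecolon> hsub (hlist as) C)"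
  using assms
\<comment> \<open>The head of \<open>D\<close> is the variable declared last, so the tail is again a
  telescope over \<open>G\<close>, and the induction hypothesis equates the two instances of the
  type of that variable.\<close>
proof (induction D arbitrary: as bs)
  case Nil
  then show ?case
    by (auto intro: hott.eq_refl sub_ok_id wf_ctx)
next
  case (Cons A D)
  obtain a as1 where as: "as = a # as1" using Cons.prems(2) by (cases as) auto
  obtain b bs1 where bs: "bs = b # bs1" using Cons.prems(3) by (cases bs) auto
  obtain j where wf: "wf (D @ G)" and A: "D @ G \<turnstile> A \<Ztypecolon> HUniv j"
    using Cons.prems(1) by (auto elim: wf_ConsE)
  have G: "\<turnstile> G" using wf by (auto intro: wf_ctx dest: wf_appendD)
  have DG: "\<turnstile> D @ G" using wf by (rule wf_ctx)
  have ab: "deq G a b (hsub (hlist as1) A)"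
    using Cons.prems(4) by (auto simp: as bs)
  have "\<forall>i<length D. deq G (as1 ! i) (bs1 ! i) (hsub (hlist (drop (Suc i) as1)) (D ! i))"
    using Cons.prems(4) by (auto simp: as bs)
  with Cons.IH[OF wf, of as1 bs1] Cons.prems(2,3)
  have s1: "sub_ok G (hlist as1) (D @ G)" and s2: "sub_ok G (hlist bs1) (D @ G)"
    and IH: "\<And>c C i. D @ G \<turnstile> c \<Ztypecolon> C \<Longrightarrow> D @ G \<turnstile> C \<Ztypecolon> HUniv i \<Longrightarrow>
      G \<turnstile> hsub (hlist as1) c \<simeq> hsub (hlist bs1) c \<Ztypecolon> hsub (hlist as1) C"
    by (auto simp: as bs)
  have A1: "G \<turnstile> hsub (hlist as1) A \<Ztypecolon> HUniv j" and A2: "G \<turnstile> hsub (hlist bs1) A \<Ztypecolon> HUniv j"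
    using sub_tm[OF A G s1] sub_tm[OF A G s2] by simp_all
  have eqA: "G \<turnstile> hsub (hlist as1) A \<simeq> hsub (hlist bs1) A \<Ztypecolon> HUniv j"
    using IH[OF A hott.univ[OF DG]] by simp
  \<comment> \<open>The hypothesis types \<open>b\<close> at the instance of \<open>A\<close> under
    \<open>as1\<close>. It is moved to the instance under \<open>bs1\<close>, because
    \<open>b \<rhd> hlist bs1\<close> has to be a well-typed substitution by itself.\<close>
  have b: "G \<turnstile> b \<Ztypecolon> hsub (hlist bs1) A"
    using ab eqA by (auto simp: deq_def intro: hott.conv)
  have so1: "sub_ok G (hlist as) ((A # D) @ G)" and so2: "sub_ok G (hlist bs) ((A # D) @ G)"
    using s1 s2 ab b by (auto simp: as bs deq_def intro!: sub_ok_scons)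
  \<comment> \<open>Substituting for the earlier variables and abstracting the last one gives a
    redex whose contractum is the full substitution.\<close>
  have bet: "G \<turnstile> HApp (HLam (hsub (hup (hlist xs)) c)) x \<simeq> hsub (hlist (x # xs)) c
      \<Ztypecolon> hsub (hlist (x # xs)) C"
    if c: "A # D @ G \<turnstile> c \<Ztypecolon> C" and s: "sub_ok G (hlist xs) (D @ G)"
      and x: "G \<turnstile> x \<Ztypecolon> hsub (hlist xs) A" and X: "G \<turnstile> hsub (hlist xs) A \<Ztypecolon> HUniv j"
    for c C x xs
    using hott.pi_beta[OF sub_tm[OF c hott.ctx_ext[OF X] sub_ok_hup[OF s X]] x]
    by (simp add: sub_simps)
  \<comment> \<open>\<open>HLam c\<close> lives over the shorter context, so the induction
    hypothesis equates its two instances; congruence of application brings in the equality of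
    \<open>a\<close> and \<open>b\<close>.\<close>
  have app: "G \<turnstile> HApp (HLam (hsub (hup (hlist as1)) c)) a \<simeq> HApp (HLam (hsub (hup (hlist bs1)) c)) b
      \<Ztypecolon> hsub (hlist as) C"
    if c: "A # D @ G \<turnstile> c \<Ztypecolon> C" and C: "A # D @ G \<turnstile> C \<Ztypecolon> HUniv i" for c C i
    using hott.pi_elim_eq[of E G _ _ "hsub (hlist as1) A" "hsub (hup (hlist as1)) C", OF _ deqD(3)[OF ab]]
      IH[OF hott.pi_intro[OF c] pi_form_le[OF A C]]
    by (simp add: sub_simps as)
  \<comment> \<open>The beta step for \<open>bs\<close> is typed at the \<open>bs\<close> instance
    of \<open>C\<close>; the assumption \<open>eq\<close> moves it to the \<open>as\<close>
    instance, so that the three equations compose.\<close>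
  have tri: "G \<turnstile> hsub (hlist as) c \<simeq> hsub (hlist bs) c \<Ztypecolon> hsub (hlist as) C"
    if c: "A # D @ G \<turnstile> c \<Ztypecolon> C" and C: "A # D @ G \<turnstile> C \<Ztypecolon> HUniv i"
      and eq: "G \<turnstile> hsub (hlist bs) C \<simeq> hsub (hlist as) C \<Ztypecolon> HUniv i" for c C i
    using hott.eq_trans[OF hott.eq_sym[OF bet[OF c s1 deqD(1)[OF ab] A1, folded as]]
        hott.eq_trans[OF app[OF c C] hott.conv_eq[OF bet[OF c s2 b A2, folded bs] eq]]] .
  have "G \<turnstile> hsub (hlist as) c \<simeq> hsub (hlist bs) c \<Ztypecolon> hsub (hlist as) C"
    if c: "A # D @ G \<turnstile> c \<Ztypecolon> C" and C: "A # D @ G \<turnstile> C \<Ztypecolon> HUniv i" for c C i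
  proof (rule tri[OF c C])
    have u: "A # D @ G \<turnstile> HUniv i \<Ztypecolon> HUniv (Suc i)"
      by (rule hott.univ[OF hott.ctx_ext[OF A]])
    \<comment> \<open>The remaining equation is \<open>tri\<close> for \<open>C\<close> itself: the
      type of \<open>C\<close> is \<open>HUniv i\<close>, which contains no variables, so there the
      assumption \<open>eq\<close> is reflexivity.\<close>
    show "G \<turnstile> hsub (hlist bs) C \<simeq> hsub (hlist as) C \<Ztypecolon> HUniv i"
      using hott.eq_sym[OF tri[OF C u]] hott.eq_refl[OF hott.univ[OF G]] by simp
  qed
  then show ?case using so1 so2 by auto
qed

lemma inst_cong:
  assumes G: "wf G" and A: "G \<turnstile> A \<Ztypecolon> HUniv j" and c: "A # G \<turnstile> c \<Ztypecolon> C" "A # G \<turnstile> C \<Ztypecolon> HUniv i"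
    and ab: "deq G a b A"
  shows "G \<turnstile> hinst c a \<simeq> hinst c b \<Ztypecolon> hinst C a"
  using sub_cong[of "[A]" G "[a]" "[b]"] wf.intros(2)[OF G A] c ab by auto

lemma inst_cong_ty:
  assumes G: "wf G" and A: "G \<turnstile> A \<Ztypecolon> HUniv j" and C: "A # G \<turnstile> C \<Ztypecolon> HUniv i"
    and ab: "deq G a b A"
  shows "deq G (hinst C a) (hinst C b) (HUniv i)"
  using inst_cong[OF G A C hott.univ[OF hott.ctx_ext[OF A]] ab] inst_ty[OF C _ wf_ctx[OF G]] ab
  by (auto simp: deq_def)

end

section \<open>The interpretation commutes with substitution\<close>

locale hott_choice = hott_theory E for E :: "hjudg set" +
  fixes ch :: choice
  assumes choice: "is_choice E ch"
begin

lemma choice_closed: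
  "hclosed (p_0 ch)" "hclosed (p_imp ch)" "hclosed (p_and ch)" "hclosed (p_all ch)"
  "hclosed (p_or ch)" "hclosed (p_ex ch)" "hclosed (p_id ch)" "hclosed (s_coe ch)"
  "hclosed (s_0 ch)" "hclosed (s_1 ch)" "hclosed (s_pi ch)" "hclosed (s_sig ch)"
  "hclosed (s_sum ch)" "hclosed (s_list ch)" "hclosed (s_PROP ch)"
  using choice by (auto simp: is_choice_def)

lemmas choice_sub = choice_closed[THEN hsub_closed]

lemma upr_HVar_sub: "(\<lambda>n. HVar (upr \<xi> n)) = hup (\<lambda>n. HVar (\<xi> n))"
  by (simp add: hup_ren)

text \<open>\<open>ity\<close>, \<open>iprP\<close>, \<open>iprS\<close> and \<open>itm\<close> call
  each other, so their equations are proved together. Renaming on the target side is written as a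
  substitution, which lets \<open>def_sub\<close> serve both here and in \<open>i_sub\<close>. An
  equation between options also covers the undefined case.\<close>

lemma i_ren:
  "ity ch (mrenT \<xi> A) = map_option (hsub (\<lambda>n. HVar (\<xi> n))) (ity ch A) \<and>
   iprP ch (mrenT \<xi> A) = map_option (hsub (\<lambda>n. HVar (\<xi> n))) (iprP ch A) \<and>
   iprS ch (mrenT \<xi> A) = map_option (hsub (\<lambda>n. HVar (\<xi> n))) (iprS ch A)"
  "itm ch (mren \<xi> a) = map_option (hsub (\<lambda>n. HVar (\<xi> n))) (itm ch a)"
  by (induction A and a arbitrary: \<xi> and \<xi>)
    (simp_all add: Option.map_option_bind Option.bind_map_option comp_def def_sub choice_sub
      upr_HVar_sub)

lemma i_mup:
  assumes "\<And>n. itm ch (\<sigma> n) = Some (\<sigma>' n)"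
  shows "itm ch (mup \<sigma> n) = Some (hup \<sigma>' n)"
  using assms
  by (cases n) (simp_all add: mup_def hup_def mwk_def hwk_sub i_ren)

text \<open>Only the values of \<open>\<sigma>\<close> have to be defined. Under binders this is
  preserved by \<open>i_mup\<close>, which weakens them by \<open>i_ren\<close>; hence the renaming
  case comes first.\<close>

lemma i_sub:
  "(\<And>n. itm ch (\<sigma> n) = Some (\<sigma>' n)) \<Longrightarrow>
   ity ch (msubT \<sigma> A) = map_option (hsub \<sigma>') (ity ch A) \<and>
   iprP ch (msubT \<sigma> A) = map_option (hsub \<sigma>') (iprP ch A) \<and>
   iprS ch (msubT \<sigma> A) = map_option (hsub \<sigma>') (iprS ch A)"
  "(\<And>n. itm ch (\<sigma> n) = Some (\<sigma>' n)) \<Longrightarrow>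
   itm ch (msub \<sigma> a) = map_option (hsub \<sigma>') (itm ch a)"
  by (induction A and a arbitrary: \<sigma> \<sigma>' and \<sigma> \<sigma>')
    (simp_all add: Option.map_option_bind Option.bind_map_option comp_def def_sub choice_sub i_mup)

end

section \<open>Congruence of type formers\<close>

context hott_theory
begin

section \<open>Formation and congruence of isProp and isSet\<close>

lemma hlevel_pred_sub: "hsub \<sigma> (hlevel_pred s A) = hlevel_pred s (hsub \<sigma> A)"
  by (simp add: hlevel_pred_def def_sub)

lemma var_ty: "G \<turnstile> A \<Ztypecolon> HUniv i \<Longrightarrow> n < length G \<Longrightarrow> A # G \<turnstile> HVar (Suc n) \<Ztypecolon> hwk (n + 2) (G ! n)"
  using hott.var[of E "A # G" "Suc n"] by (simp add: hott.ctx_ext)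

text \<open>This identity type over two fresh variables occurs in \<open>hisprop\<close>, twice
  nested in \<open>hisset\<close>, and in the context of the motive of
  \<open>id_elim\<close>.\<close>

lemma id_vars_form:
  assumes "G \<turnstile> A \<Ztypecolon> HUniv i"
  shows "hwk 1 A # A # G \<turnstile> HId (hwk 2 A) (HVar 1) (HVar 0) \<Ztypecolon> HUniv i"
proof -
  have A1: "A # G \<turnstile> hwk 1 A \<Ztypecolon> HUniv i" using assms by (rule wk1_ty[OF assms])
  have A2: "hwk 1 A # A # G \<turnstile> hwk 2 A \<Ztypecolon> HUniv i"
    using wk1_ty[OF A1 A1] by (simp add: sub_simps)
  show ?thesis
    by (rule hott.id_form[OF A2])
      (use var_ty[OF A1, of 0] var0[OF A1] in \<open>simp_all add: sub_simps\<close>)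
qed

lemma hisprop_form:
  assumes "G \<turnstile> A \<Ztypecolon> HUniv i"
  shows "G \<turnstile> hisprop A \<Ztypecolon> HUniv i"
  unfolding hisprop_def
  by (rule hott.pi_form[OF assms hott.pi_form[OF wk1_ty[OF assms assms] id_vars_form[OF assms]]])

lemma hisset_form:
  assumes A: "G \<turnstile> A \<Ztypecolon> HUniv i"
  shows "G \<turnstile> hisset A \<Ztypecolon> HUniv i"
proof -
  let ?I = "HId (hwk 2 A) (HVar 1) (HVar 0)"
  have A1: "A # G \<turnstile> hwk 1 A \<Ztypecolon> HUniv i" using assms by (rule wk1_ty[OF assms])
  note I = id_vars_form[OF A]
  \<comment> \<open>isSet quantifies over two paths in \<open>?I\<close> and a path between them, so
    the lemma is applied once more with \<open>?I\<close> in place of \<open>A\<close>.\<close>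
  have "hwk 1 ?I # ?I # hwk 1 A # A # G \<turnstile> HId (hwk 2 ?I) (HVar 1) (HVar 0) \<Ztypecolon> HUniv i"
    by (rule id_vars_form[OF I])
  moreover have "?I # hwk 1 A # A # G \<turnstile> hwk 1 ?I \<Ztypecolon> HUniv i"
    by (rule wk1_ty[OF I I])
  ultimately show ?thesis
    unfolding hisset_def using A A1 I
    by (intro hott.pi_form) (simp_all add: sub_simps eval_nat_numeral)
qed

lemma hlevel_pred_form: "G \<turnstile> A \<Ztypecolon> HUniv i \<Longrightarrow> G \<turnstile> hlevel_pred s A \<Ztypecolon> HUniv i"
  by (simp add: hlevel_pred_def hisset_form hisprop_form)

text \<open>The predicate of a generic \<open>X : HUniv i\<close> is formed once and instantiated at
  the two equal types; this avoids a congruence argument through the nested products.\<close>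

lemma hlevel_pred_cong:
  assumes G: "wf G" and AB: "deq G A B (HUniv i)"
  shows "deq G (hlevel_pred s A) (hlevel_pred s B) (HUniv i)"
proof -
  have U: "G \<turnstile> HUniv i \<Ztypecolon> HUniv (Suc i)" by (intro hott.univ wf_ctx G)
  have "HUniv i # G \<turnstile> hlevel_pred s (HVar 0) \<Ztypecolon> HUniv i"
    using var0[OF U] by (intro hlevel_pred_form) (simp add: sub_simps)
  from inst_cong_ty[OF G U this AB] show ?thesis by (simp add: hlevel_pred_sub)
qed

lemma hPROP_form: "\<turnstile> G \<Longrightarrow> G \<turnstile> hPROP i \<Ztypecolon> HUniv (Suc i)"
proof -
  assume "\<turnstile> G"
  then have U: "G \<turnstile> HUniv i \<Ztypecolon> HUniv (Suc i)" by (rule hott.univ)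
  have "HUniv i # G \<turnstile> HVar 0 \<Ztypecolon> HUniv i"
    using var0[OF U] by (simp add: sub_simps)
  with U show ?thesis
    unfolding hPROP_def by (intro hott.sig_form hisprop_form) (auto intro: hott.cumul)
qed

section \<open>Congruence of the type formers\<close>

text \<open>What has to be added to \<open>pi_form_eq\<close> is that the right-hand side is a type:
  \<open>B'\<close> is given over \<open>A # G\<close> but needed over \<open>A' # G\<close>, which
  \<open>ctx_conv\<close> supplies.\<close>

lemma pi_cong:
  assumes "\<turnstile> G" "deq G A A' (HUniv i)" "deq (A # G) B B' (HUniv i)"
  shows "deq G (HPi A B) (HPi A' B') (HUniv i)"
  using assms sub_tm[OF deqD(2)[OF assms(3)] _ ctx_conv[OF assms(1,2)]]
  by (auto simp: deq_def intro: hott.pi_form hott.pi_form_eq hott.ctx_ext)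

lemma sig_cong:
  assumes "\<turnstile> G" "deq G A A' (HUniv i)" "deq (A # G) B B' (HUniv i)"
  shows "deq G (HSig A B) (HSig A' B') (HUniv i)"
  using assms sub_tm[OF deqD(2)[OF assms(3)] _ ctx_conv[OF assms(1,2)]]
  by (auto simp: deq_def intro: hott.sig_form hott.sig_form_eq hott.ctx_ext)

lemma hfun_cong:
  assumes "\<turnstile> G" "deq G A A' (HUniv i)" "deq G B B' (HUniv i)"
  shows "deq G (hfun A B) (hfun A' B') (HUniv i)"
  using pi_cong[OF assms(1,2)] wk1_deq[OF assms(3) deqD(1)[OF assms(2)]]
  by (simp add: hfun_def sub_simps)

lemma hprod_cong:
  assumes "\<turnstile> G" "deq G A A' (HUniv i)" "deq G B B' (HUniv i)"
  shows "deq G (hprod A B) (hprod A' B') (HUniv i)"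
  using sig_cong[OF assms(1,2)] wk1_deq[OF assms(3) deqD(1)[OF assms(2)]]
  by (simp add: hprod_def sub_simps)

lemma list_cong: "deq G A A' (HUniv i) \<Longrightarrow> deq G (HList A) (HList A') (HUniv i)"
  by (auto simp: deq_def intro: hott.list_form hott.list_form_eq)

lemma trunc_cong: "deq G A A' (HUniv i) \<Longrightarrow> deq G (HTrunc A) (HTrunc A') (HUniv i)"
  by (auto simp: deq_def intro: hott.trunc_form hott.trunc_form_eq)

lemma sum_cong: "deq G A A' (HUniv i) \<Longrightarrow> deq G B B' (HUniv i) \<Longrightarrow>
    deq G (HSum A B) (HSum A' B') (HUniv i)"
  by (auto simp: deq_def intro: hott.sum_form hott.sum_form_eq)

lemma hor_cong: "deq G A A' (HUniv i) \<Longrightarrow> deq G B B' (HUniv i) \<Longrightarrow>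
    deq G (hor A B) (hor A' B') (HUniv i)"
  unfolding hor_def by (intro trunc_cong sum_cong)

lemma hex_cong: "\<turnstile> G \<Longrightarrow> deq G A A' (HUniv i) \<Longrightarrow> deq (A # G) B B' (HUniv i) \<Longrightarrow>
    deq G (hex A B) (hex A' B') (HUniv i)"
  unfolding hex_def by (intro trunc_cong sig_cong)

lemma id_cong: "deq G A A' (HUniv i) \<Longrightarrow> deq G a a' A \<Longrightarrow> deq G b b' A \<Longrightarrow>
    deq G (HId A a b) (HId A' a' b') (HUniv i)"
  using deq_conv[of G a a' A A' i] deq_conv[of G b b' A A' i]
  by (auto simp: deq_def intro: hott.id_form hott.id_form_eq)

subsection \<open>Projections\<close>

lemma pr1:
  assumes A: "G \<turnstile> A \<Ztypecolon> HUniv i" and B: "A # G \<turnstile> B \<Ztypecolon> HUniv j"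
  shows pr1_tm: "G \<turnstile> d \<Ztypecolon> HSig A B \<Longrightarrow> G \<turnstile> hpr1 d \<Ztypecolon> A"
    and pr1_beta: "G \<turnstile> a \<Ztypecolon> A \<Longrightarrow> G \<turnstile> b \<Ztypecolon> hinst B a \<Longrightarrow> G \<turnstile> hpr1 (HPair a b) \<simeq> a \<Ztypecolon> A"
proof -
  have C: "HSig A B # G \<turnstile> hwk 1 A \<Ztypecolon> HUniv i"
    by (rule wk1_ty[OF A sig_form_le[OF A B]])
  have c: "B # A # G \<turnstile> HVar 1 \<Ztypecolon> hat 2 (HPair (HVar 1) (HVar 0)) (hwk 1 A)"
    using var_ty[OF B, of 0] by (simp add: sub_simps)
  show "G \<turnstile> d \<Ztypecolon> HSig A B \<Longrightarrow> G \<turnstile> hpr1 d \<Ztypecolon> A"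
    using hott.sig_elim[OF C c, of d] by (simp add: hpr1_def sub_simps)
  show "G \<turnstile> a \<Ztypecolon> A \<Longrightarrow> G \<turnstile> b \<Ztypecolon> hinst B a \<Longrightarrow> G \<turnstile> hpr1 (HPair a b) \<simeq> a \<Ztypecolon> A"
    using hott.sig_beta[OF C c, of a b] by (simp add: hpr1_def sub_simps)
qed

lemma pr1_beta_deq:
  assumes A: "G \<turnstile> A \<Ztypecolon> HUniv i" and B: "A # G \<turnstile> B \<Ztypecolon> HUniv j"
    and a: "G \<turnstile> a \<Ztypecolon> A" and b: "G \<turnstile> b \<Ztypecolon> hinst B a"
  shows "deq G (hpr1 (HPair a b)) a A"
  using hott.sig_intro[OF B a b] pr1_tm[OF A B] pr1_beta[OF A B a b] a by (auto simp: deq_def)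

text \<open>The motive is \<open>B\<close> at the first projection of the eliminated pair, and the
  branch is the variable for the second component. That variable has type \<open>B\<close> at
  \<open>x\<close>, where the rule asks for \<open>B\<close> at \<open>hpr1\<close> of the pair of
  the two variables; the two types agree by the beta rule of \<open>hpr1\<close> and substitution of
  equals in \<open>B\<close>.\<close>

lemma pr2:
  assumes G: "wf G" and A: "G \<turnstile> A \<Ztypecolon> HUniv i" and B: "A # G \<turnstile> B \<Ztypecolon> HUniv j"
  shows pr2_tm: "G \<turnstile> d \<Ztypecolon> HSig A B \<Longrightarrow> G \<turnstile> hpr2 d \<Ztypecolon> hinst B (hpr1 d)"
    and pr2_beta: "G \<turnstile> a \<Ztypecolon> A \<Longrightarrow> G \<turnstile> b \<Ztypecolon> hinst B a \<Longrightarrow>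
      G \<turnstile> hpr2 (HPair a b) \<simeq> b \<Ztypecolon> hinst B (hpr1 (HPair a b))"
proof -
  let ?S = "HSig A B # G" and ?C = "hsub (hpr1 (HVar 0) \<rhd> (\<lambda>n. HVar (Suc n))) B"
  let ?D = "B # A # G" and ?p = "HPair (HVar 1) (HVar 0)"
  have S: "G \<turnstile> HSig A B \<Ztypecolon> HUniv (max i j)" by (rule sig_form_le[OF A B])
  have AG: "wf (A # G)" and D: "wf ?D" using G A B by (auto intro: wf.intros)
  have AS: "?S \<turnstile> hwk 1 A \<Ztypecolon> HUniv i" by (rule wk1_ty[OF A S])
  have BS: "hwk 1 A # ?S \<turnstile> hsub (hup (\<lambda>n. HVar (Suc n))) B \<Ztypecolon> HUniv j"
    using sub_tm[OF B hott.ctx_ext[OF AS], of "hup (\<lambda>n. HVar (Suc n))"]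
      sub_ok_hup[OF sub_ok_shift1[OF S], of A i] AS
    by (simp add: sub_simps)
  have "?S \<turnstile> hpr1 (HVar 0) \<Ztypecolon> hwk 1 A"
    using pr1_tm[OF AS BS, of "HVar 0"] var0[OF S] by (simp add: sub_simps)
  then have C: "?S \<turnstile> ?C \<Ztypecolon> HUniv j"
    using sub_tm[OF B hott.ctx_ext[OF S] sub_ok_scons[OF sub_ok_shift1[OF S]]]
    by (simp add: sub_simps)
  have A1: "A # G \<turnstile> hwk 1 A \<Ztypecolon> HUniv i" by (rule wk1_ty[OF A A])
  have A2: "?D \<turnstile> hwk 2 A \<Ztypecolon> HUniv i"
    using wk1_ty[OF A1 B] by (simp add: sub_simps)
  have sh: "sub_ok ?D (\<lambda>n. HVar (n + 2)) G"
    using sub_ok_shift[of "[B, A]" G 2] D by (simp add: wf_ctx)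
  have B2: "hwk 2 A # ?D \<turnstile> hsub (hup (\<lambda>n. HVar (n + 2))) B \<Ztypecolon> HUniv j"
    using sub_tm[OF B hott.ctx_ext[OF A2], of "hup (\<lambda>n. HVar (n + 2))"] sub_ok_hup[OF sh, of A i] A2
    by (simp add: sub_simps)
  have v1: "?D \<turnstile> HVar 1 \<Ztypecolon> hwk 2 A"
    using var_ty[OF B, of 0] by (simp add: eval_nat_numeral)
  have v0: "?D \<turnstile> HVar 0 \<Ztypecolon> hinst (hsub (hup (\<lambda>n. HVar (n + 2))) B) (HVar 1)"
    using var0[OF B] by (simp add: sub_simps)
  \<comment> \<open>The conversion for the branch. All data are first weakened by two, so that the
    pair of the two variables is an ordinary pair over \<open>?D\<close>.\<close>
  have "?D \<turnstile> hwk 1 B \<simeq> hat 2 ?p ?C \<Ztypecolon> HUniv j"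
    using deqD(3)[OF inst_cong_ty[OF D A2 B2 deq_sym[OF pr1_beta_deq[OF A2 B2 v1 v0]]]]
    by (simp add: sub_simps hpr_sub)
  with var0[OF B] have c: "?D \<turnstile> HVar 0 \<Ztypecolon> hat 2 ?p ?C"
    by (rule hott.conv)
  show "G \<turnstile> d \<Ztypecolon> HSig A B \<Longrightarrow> G \<turnstile> hpr2 d \<Ztypecolon> hinst B (hpr1 d)"
    using hott.sig_elim[OF C c, of d] by (simp add: hpr2_def sub_simps hpr_sub)
  show "G \<turnstile> a \<Ztypecolon> A \<Longrightarrow> G \<turnstile> b \<Ztypecolon> hinst B a \<Longrightarrow>
      G \<turnstile> hpr2 (HPair a b) \<simeq> b \<Ztypecolon> hinst B (hpr1 (HPair a b))"
    using hott.sig_beta[OF C c, of a b] by (simp add: hpr2_def sub_simps hpr_sub)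
qed

text \<open>The beta rule is typed at \<open>B\<close> of the first projection; the beta rule of
  \<open>hpr1\<close> moves it to \<open>B\<close> at \<open>a\<close>.\<close>

lemma pr2_beta_deq:
  assumes G: "wf G" and A: "G \<turnstile> A \<Ztypecolon> HUniv i" and B: "A # G \<turnstile> B \<Ztypecolon> HUniv j"
    and a: "G \<turnstile> a \<Ztypecolon> A" and b: "G \<turnstile> b \<Ztypecolon> hinst B a"
  shows "deq G (hpr2 (HPair a b)) b (hinst B a)"
proof -
  have eq: "G \<turnstile> hinst B (hpr1 (HPair a b)) \<simeq> hinst B a \<Ztypecolon> HUniv j"
    using inst_cong_ty[OF G A B pr1_beta_deq[OF A B a b]] by (simp add: deq_def)
  show ?thesis
    using hott.conv[OF pr2_tm[OF G A B hott.sig_intro[OF B a b]] eq]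
      hott.conv_eq[OF pr2_beta[OF G A B a b] eq] b
    by (simp add: deq_def)
qed

end

section \<open>Congruence of the interpreted type formers\<close>

lemma level_le: "level s \<le> Suc 0"
  by (cases s) auto

context hott_choice
begin

text \<open>An equality of pairs in \<open>hlevel_univ s\<close>, kept componentwise because no rule
  splits an equality of pairs; \<open>tyeq_pair\<close> restores it. With equal sides it says that
  \<open>A\<close> is a type and \<open>p\<close> its proof, so one lemma about \<open>tyeq\<close>
  serves both the formation rule of a type former and its congruence rule.\<close>

definition tyeq :: "msort \<Rightarrow> hctx \<Rightarrow> htm \<Rightarrow> htm \<Rightarrow> htm \<Rightarrow> htm \<Rightarrow> bool" where
  "tyeq s G A p B q \<longleftrightarrow> deq G A B (HUniv (level s)) \<and> deq G p q (hlevel_pred s A)"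

text \<open>The typing of a chosen proof term applied to its arguments and the congruence of such an
  application are two instances of one statement about a relation \<open>R\<close>.\<close>

definition typing_rel :: "(hctx \<Rightarrow> htm \<Rightarrow> htm \<Rightarrow> htm \<Rightarrow> bool) \<Rightarrow> bool" where
  "typing_rel R \<longleftrightarrow> (\<forall>G f T. G \<turnstile> f \<Ztypecolon> T \<longrightarrow> R G f f T) \<and>
    (\<forall>G f f' a a' A B. R G f f' (HPi A B) \<longrightarrow> R G a a' A \<longrightarrow> R G (HApp f a) (HApp f' a') (hinst B a)) \<and>
    (\<forall>G b b' A B. R (A # G) b b' B \<longrightarrow> R G (HLam b) (HLam b') (HPi A B)) \<and>
    (\<forall>G a b A B i. R G a b A \<longrightarrow> G \<turnstile> A \<simeq> B \<Ztypecolon> HUniv i \<longrightarrow> R G a b B)"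

lemma typing_rel_tm: "typing_rel (\<lambda>G a b A. a = b \<and> G \<turnstile> a \<Ztypecolon> A)"
  by (auto simp: typing_rel_def intro: hott.pi_elim hott.pi_intro hott.conv)

lemma typing_rel_eq: "typing_rel (\<lambda>G a b A. G \<turnstile> a \<simeq> b \<Ztypecolon> A)"
  by (auto simp: typing_rel_def intro: hott.pi_elim_eq hott.pi_intro_eq hott.conv_eq hott.eq_refl)

lemma typing_relD:
  assumes "typing_rel R"
  shows rel_closed: "\<turnstile> G \<Longrightarrow> [] \<turnstile> c \<Ztypecolon> T \<Longrightarrow> R G c c T"
    and rel_app: "R G f f' (HPi A B) \<Longrightarrow> R G a a' A \<Longrightarrow> R G (HApp f a) (HApp f' a') (hinst B a)"
    and rel_lam: "R (A # G) b b' B \<Longrightarrow> R G (HLam b) (HLam b') (HPi A B)"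
    and rel_conv: "R G a a' A \<Longrightarrow> G \<turnstile> A \<simeq> B \<Ztypecolon> HUniv i \<Longrightarrow> R G a a' B"
proof -
  show "\<turnstile> G \<Longrightarrow> [] \<turnstile> c \<Ztypecolon> T \<Longrightarrow> R G c c T"
    using assms closed_tm[of c T G] by (simp add: typing_rel_def)
qed (use assms in \<open>unfold typing_rel_def, blast+\<close>)

section \<open>Typing and congruence of the chosen proof terms\<close>

lemma choice_typed:
  "[] \<turnstile> p_0 ch \<Ztypecolon> hisprop HEmpty"
  "[] \<turnstile> p_imp ch \<Ztypecolon> HPi (HUniv 1) (HPi (HUniv 1) (HPi (hisprop (HVar 0))
     (hisprop (hfun (HVar 2) (HVar 1)))))"
  "[] \<turnstile> p_and ch \<Ztypecolon> HPi (HUniv 1) (HPi (HUniv 1) (HPi (hisprop (HVar 1)) (HPi (hisprop (HVar 1))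
     (hisprop (hprod (HVar 3) (HVar 2))))))"
  "[] \<turnstile> p_all ch \<Ztypecolon> HPi (HUniv 1) (HPi (hfun (HVar 0) (HUniv 1))
     (HPi (HPi (HVar 1) (hisprop (HApp (HVar 1) (HVar 0))))
     (hisprop (HPi (HVar 2) (HApp (HVar 2) (HVar 0))))))"
  "[] \<turnstile> p_or ch \<Ztypecolon> HPi (HUniv 1) (HPi (HUniv 1) (hisprop (hor (HVar 1) (HVar 0))))"
  "[] \<turnstile> p_ex ch \<Ztypecolon> HPi (HUniv 1) (HPi (hfun (HVar 0) (HUniv 1))
     (hisprop (hex (HVar 1) (HApp (HVar 1) (HVar 0)))))"
  "[] \<turnstile> p_id ch \<Ztypecolon> HPi (HUniv 1) (HPi (hisset (HVar 0)) (HPi (HVar 1) (HPi (HVar 2)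
     (hisprop (HId (HVar 3) (HVar 1) (HVar 0))))))"
  "[] \<turnstile> s_coe ch \<Ztypecolon> HPi (HUniv 1) (hfun (hisprop (HVar 0)) (hisset (HVar 0)))"
  "[] \<turnstile> s_0 ch \<Ztypecolon> hisset HEmpty"
  "[] \<turnstile> s_1 ch \<Ztypecolon> hisset HUnit"
  "[] \<turnstile> s_pi ch \<Ztypecolon> HPi (HUniv 1) (HPi (hfun (HVar 0) (HUniv 1))
     (HPi (HPi (HVar 1) (hisset (HApp (HVar 1) (HVar 0))))
     (hisset (HPi (HVar 2) (HApp (HVar 2) (HVar 0))))))"
  "[] \<turnstile> s_sig ch \<Ztypecolon> HPi (HUniv 1) (HPi (hfun (HVar 0) (HUniv 1)) (HPi (hisset (HVar 1))
     (HPi (HPi (HVar 2) (hisset (HApp (HVar 2) (HVar 0))))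
     (hisset (HSig (HVar 3) (HApp (HVar 3) (HVar 0)))))))"
  "[] \<turnstile> s_sum ch \<Ztypecolon> HPi (HUniv 1) (HPi (HUniv 1) (HPi (hisset (HVar 1)) (HPi (hisset (HVar 1))
     (hisset (HSum (HVar 3) (HVar 2))))))"
  "[] \<turnstile> s_list ch \<Ztypecolon> HPi (HUniv 1) (HPi (hisset (HVar 0)) (hisset (HList (HVar 1))))"
  "[] \<turnstile> s_PROP ch \<Ztypecolon> hisset (hPROP 0)"
  using choice by (simp_all add: is_choice_def)

lemma hfun_Pi: "hfun A (HUniv i) = HPi A (HUniv i)"
  by (simp add: hfun_def sub_simps)

text \<open>The types of the chosen terms apply a family to the variable just bound;
  \<open>fam F\<close> is that application, with \<open>F\<close> weakened.\<close>

abbreviation fam :: "htm \<Rightarrow> htm"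
  where "fam F \<equiv> HApp (hsub (\<lambda>n. HVar (Suc n)) F) (HVar 0)"

lemmas app_simps = def_sub hfun_Pi sub_simps eval_nat_numeral

text \<open>Computes numerals and substitutions, so that after each application the resulting type
  is again literally an \<open>HPi\<close> to which the next argument can be given.\<close>

lemmas app_norm = BitM.simps numeral_One app_simps hsub.simps nat.case One_nat_def add_0 add_0_right add_Suc_right add_Suc hsub_HVar

text \<open>The product types of the chosen terms are peeled one argument at a time. Result types
  mention the left-hand arguments only, as in \<open>pi_elim_eq\<close>.\<close>

lemma rel_choice:
  assumes R: "typing_rel R" and G: "\<turnstile> G" and A: "R G A A' (HUniv (Suc 0))"
  shows s_coe_app: "R G p p' (hisprop A) \<Longrightarrow>
      R G (happs (s_coe ch) [A, p]) (happs (s_coe ch) [A', p']) (hisset A)"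
    and s_list_app: "R G p p' (hisset A) \<Longrightarrow>
      R G (happs (s_list ch) [A, p]) (happs (s_list ch) [A', p']) (hisset (HList A))"
    and s_sum_app: "R G B B' (HUniv (Suc 0)) \<Longrightarrow> R G p p' (hisset A) \<Longrightarrow> R G q q' (hisset B) \<Longrightarrow>
      R G (happs (s_sum ch) [A, B, p, q]) (happs (s_sum ch) [A', B', p', q']) (hisset (HSum A B))"
    and p_and_app: "R G B B' (HUniv (Suc 0)) \<Longrightarrow> R G p p' (hisprop A) \<Longrightarrow> R G q q' (hisprop B) \<Longrightarrow>
      R G (happs (p_and ch) [A, B, p, q]) (happs (p_and ch) [A', B', p', q']) (hisprop (hprod A B))"
    and p_imp_app: "R G B B' (HUniv (Suc 0)) \<Longrightarrow> R G q q' (hisprop B) \<Longrightarrow>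
      R G (happs (p_imp ch) [A, B, q]) (happs (p_imp ch) [A', B', q']) (hisprop (hfun A B))"
    and p_or_app: "R G B B' (HUniv (Suc 0)) \<Longrightarrow>
      R G (happs (p_or ch) [A, B]) (happs (p_or ch) [A', B']) (hisprop (hor A B))"
    and p_id_app: "R G p p' (hisset A) \<Longrightarrow> R G a a' A \<Longrightarrow> R G b b' A \<Longrightarrow>
      R G (happs (p_id ch) [A, p, a, b]) (happs (p_id ch) [A', p', a', b']) (hisprop (HId A a b))"
    and p_ex_app: "R G F F' (HPi A (HUniv (Suc 0))) \<Longrightarrow>
      R G (happs (p_ex ch) [A, F]) (happs (p_ex ch) [A', F']) (hisprop (hex A (fam F)))"
    and s_sig_app: "R G F F' (HPi A (HUniv (Suc 0))) \<Longrightarrow> R G p p' (hisset A) \<Longrightarrow>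
      R G q q' (HPi A (hisset (fam F))) \<Longrightarrow>
      R G (happs (s_sig ch) [A, F, p, q]) (happs (s_sig ch) [A', F', p', q'])
        (hisset (HSig A (fam F)))"
    and s_pi_app: "R G F F' (HPi A (HUniv (Suc 0))) \<Longrightarrow> R G q q' (HPi A (hisset (fam F))) \<Longrightarrow>
      R G (happs (s_pi ch) [A, F, q]) (happs (s_pi ch) [A', F', q']) (hisset (HPi A (fam F)))"
    and p_all_app: "R G F F' (HPi A (HUniv (Suc 0))) \<Longrightarrow> R G q q' (HPi A (hisprop (fam F))) \<Longrightarrow>
      R G (happs (p_all ch) [A, F, q]) (happs (p_all ch) [A', F', q']) (hisprop (HPi A (fam F)))"
proof -
  note const = rel_closed[OF R G]
  note app = rel_app[OF R]
  show "R G (happs (s_coe ch) [A, p]) (happs (s_coe ch) [A', p']) (hisset A)"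
    if "R G p p' (hisprop A)"
    \<comment> \<open>The last arrow in the type of \<open>s_coe ch\<close> is an
      \<open>hfun\<close>, unfolded here so that the second application finds an
      \<open>HPi\<close>.\<close>
    using app[OF app[OF const[OF choice_typed(8), simplified app_norm] A, simplified app_norm hfun_def] that]
    by (simp add: app_simps)
  show "R G (happs (s_list ch) [A, p]) (happs (s_list ch) [A', p']) (hisset (HList A))"
    if "R G p p' (hisset A)"
    using app[OF app[OF const[OF choice_typed(14), simplified app_norm] A, simplified app_norm] that]
    by (simp add: app_simps)
  show "R G (happs (s_sum ch) [A, B, p, q]) (happs (s_sum ch) [A', B', p', q']) (hisset (HSum A B))"
    if "R G B B' (HUniv (Suc 0))" "R G p p' (hisset A)" "R G q q' (hisset B)"
    using app[OF app[OF app[OF app[OF const[OF choice_typed(13), simplified app_norm] A, simplified app_norm] that(1), simplified app_norm] that(2), simplified app_norm] that(3)]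
    by (simp add: app_simps)
  show "R G (happs (p_and ch) [A, B, p, q]) (happs (p_and ch) [A', B', p', q']) (hisprop (hprod A B))"
    if "R G B B' (HUniv (Suc 0))" "R G p p' (hisprop A)" "R G q q' (hisprop B)"
    using app[OF app[OF app[OF app[OF const[OF choice_typed(3), simplified app_norm] A, simplified app_norm] that(1), simplified app_norm] that(2), simplified app_norm] that(3)]
    by (simp add: app_simps)
  show "R G (happs (p_imp ch) [A, B, q]) (happs (p_imp ch) [A', B', q']) (hisprop (hfun A B))"
    if "R G B B' (HUniv (Suc 0))" "R G q q' (hisprop B)"
    using app[OF app[OF app[OF const[OF choice_typed(2), simplified app_norm] A, simplified app_norm] that(1), simplified app_norm] that(2)]
    by (simp add: app_simps)
  show "R G (happs (p_or ch) [A, B]) (happs (p_or ch) [A', B']) (hisprop (hor A B))"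
    if "R G B B' (HUniv (Suc 0))"
    using app[OF app[OF const[OF choice_typed(5), simplified app_norm] A, simplified app_norm] that]
    by (simp add: app_simps)
  show "R G (happs (p_id ch) [A, p, a, b]) (happs (p_id ch) [A', p', a', b']) (hisprop (HId A a b))"
    if "R G p p' (hisset A)" "R G a a' (A)" "R G b b' (A)"
    using app[OF app[OF app[OF app[OF const[OF choice_typed(7), simplified app_norm] A, simplified app_norm] that(1), simplified app_norm] that(2), simplified app_norm] that(3)]
    by (simp add: app_simps)
  show "R G (happs (p_ex ch) [A, F]) (happs (p_ex ch) [A', F']) (hisprop (hex A (fam F)))"
    if "R G F F' (HPi A (HUniv (Suc 0)))"
    using app[OF app[OF const[OF choice_typed(6), simplified app_norm] A, simplified app_norm] that]
    by (simp add: app_simps)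
  show "R G (happs (s_sig ch) [A, F, p, q]) (happs (s_sig ch) [A', F', p', q']) (hisset (HSig A (fam F)))"
    if "R G F F' (HPi A (HUniv (Suc 0)))" "R G p p' (hisset A)" "R G q q' (HPi A (hisset (fam F)))"
    using app[OF app[OF app[OF app[OF const[OF choice_typed(12), simplified app_norm] A, simplified app_norm] that(1), simplified app_norm] that(2), simplified app_norm] that(3)]
    by (simp add: app_simps)
  show "R G (happs (s_pi ch) [A, F, q]) (happs (s_pi ch) [A', F', q']) (hisset (HPi A (fam F)))"
    if "R G F F' (HPi A (HUniv (Suc 0)))" "R G q q' (HPi A (hisset (fam F)))"
    using app[OF app[OF app[OF const[OF choice_typed(11), simplified app_norm] A, simplified app_norm] that(1), simplified app_norm] that(2)]
    by (simp add: app_simps)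
  show "R G (happs (p_all ch) [A, F, q]) (happs (p_all ch) [A', F', q']) (hisprop (HPi A (fam F)))"
    if "R G F F' (HPi A (HUniv (Suc 0)))" "R G q q' (HPi A (hisprop (fam F)))"
    using app[OF app[OF app[OF const[OF choice_typed(4), simplified app_norm] A, simplified app_norm] that(1), simplified app_norm] that(2)]
    by (simp add: app_simps)
qed

text \<open>The bridge between the redex in the type of a chosen term applied to
  \<open>HLam B\<close> and the type \<open>B\<close> of the interpretation.\<close>

lemma fam_beta:
  assumes A: "G \<turnstile> A \<Ztypecolon> HUniv i" and B: "A # G \<turnstile> B \<Ztypecolon> HUniv j"
  shows "deq (A # G) (fam (HLam B)) B (HUniv j)"
proof -
  have A1: "A # G \<turnstile> hsub (\<lambda>n. HVar (Suc n)) A \<Ztypecolon> HUniv i"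
    using wk1_ty[OF A A] by (simp add: sub_simps)
  note B1 = sub_tm[OF B hott.ctx_ext[OF A1] sub_ok_hup[OF sub_ok_shift1[OF A] A1], simplified]
  have v: "A # G \<turnstile> HVar 0 \<Ztypecolon> hsub (\<lambda>n. HVar (Suc n)) A"
    using var0[OF A] by (simp add: sub_simps)
  show ?thesis
    using hott.pi_elim[OF hott.pi_intro[OF B1] v] hott.pi_beta[OF B1 v] B
    by (simp add: deq_def sub_simps)
qed

text \<open>A proof for \<open>B\<close> is abstracted only after conversion to the redex, since
  this is the argument type that a chosen term for a binder expects.\<close>

lemma rel_lam_pred:
  assumes R: "typing_rel R" and G: "wf G" and A: "G \<turnstile> A \<Ztypecolon> HUniv i" and B: "A # G \<turnstile> B \<Ztypecolon> HUniv j"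
    and p: "R (A # G) p p' (hlevel_pred s B)"
  shows "R G (HLam p) (HLam p') (HPi A (hlevel_pred s (fam (HLam B))))"
  using hlevel_pred_cong[OF wf.intros(2)[OF G A] fam_beta[OF A B]]
  by (intro rel_lam[OF R] rel_conv[OF R p]) (auto simp: deq_def intro: hott.eq_sym)

lemma rel_conv_pred:
  assumes "typing_rel R" "wf G" "deq G A B (HUniv i)" "R G p p' (hlevel_pred s A)"
  shows "R G p p' (hlevel_pred s B)"
  using rel_conv[OF assms(1,4)] deqD(3)[OF hlevel_pred_cong[OF assms(2,3)]] by blast

section \<open>Calculus of equal types with equal proofs\<close>

text \<open>The proof \<open>q\<close> comes naturally typed at the predicate of \<open>B\<close>,
  whereas \<open>tyeq\<close> wants it at that of \<open>A\<close>; the conversion is made here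
  once.\<close>

lemma tyeqI:
  assumes G: "wf G" and AB: "deq G A B (HUniv (level s))" and p: "G \<turnstile> p \<Ztypecolon> hlevel_pred s A"
    and q: "G \<turnstile> q \<Ztypecolon> hlevel_pred s B" and pq: "G \<turnstile> p \<simeq> q \<Ztypecolon> hlevel_pred s A"
  shows "tyeq s G A p B q"
  using rel_conv_pred[OF typing_rel_tm G deq_sym[OF AB], of q q s] assms
  by (auto simp: tyeq_def deq_def)

text \<open>Besides the components, the types are delivered at \<open>HUniv (Suc 0)\<close>, the
  universe at which the chosen terms accept them.\<close>

lemma tyeqD:
  assumes G: "wf G" and eq: "tyeq s G A p B q"
  shows "deq G A B (HUniv (level s))" "deq G A B (HUniv (Suc 0))"
    "G \<turnstile> A \<Ztypecolon> HUniv (Suc 0)" "G \<turnstile> B \<Ztypecolon> HUniv (Suc 0)" "G \<turnstile> A \<simeq> B \<Ztypecolon> HUniv (Suc 0)"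
    "G \<turnstile> p \<Ztypecolon> hlevel_pred s A" "G \<turnstile> q \<Ztypecolon> hlevel_pred s B" "G \<turnstile> p \<simeq> q \<Ztypecolon> hlevel_pred s A"
proof -
  show 1: "deq G A B (HUniv (level s))" using eq by (simp add: tyeq_def)
  then show 2: "deq G A B (HUniv (Suc 0))" by (rule deq_cumul[OF _ level_le])
  then show "G \<turnstile> A \<Ztypecolon> HUniv (Suc 0)" "G \<turnstile> B \<Ztypecolon> HUniv (Suc 0)" "G \<turnstile> A \<simeq> B \<Ztypecolon> HUniv (Suc 0)"
    by (rule deqD)+
  show "G \<turnstile> p \<Ztypecolon> hlevel_pred s A" "G \<turnstile> p \<simeq> q \<Ztypecolon> hlevel_pred s A"
    using eq by (auto simp: tyeq_def deq_def)
  show "G \<turnstile> q \<Ztypecolon> hlevel_pred s B"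
    using rel_conv_pred[OF typing_rel_tm G 1, of q q s] eq by (auto simp: tyeq_def deq_def)
qed

lemma tyeq_sym: "wf G \<Longrightarrow> tyeq s G A p B q \<Longrightarrow> tyeq s G B q A p"
  using hlevel_pred_cong[of G A B "level s" s] deq_conv[of G q p "hlevel_pred s A"]
  by (auto simp: tyeq_def intro: deq_sym) (meson deqD(3) deq_sym)

lemma tyeq_trans:
  assumes "wf G" "tyeq s G A p B q" "tyeq s G B q C r"
  shows "tyeq s G A p C r"
  using hlevel_pred_cong[OF assms(1) deq_sym[OF tyeqD(1)[OF assms(1,2)]], of s]
    deq_conv[of G q r "hlevel_pred s B"] assms(2,3)
  unfolding tyeq_def by (meson deqD(3) deq_trans)

text \<open>For a binder with changed domain, the right-hand codomain and its proof must be typed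
  over the right-hand domain.\<close>

lemma tyeq_ctx:
  assumes G: "wf G" and A: "deq G A A' (HUniv i)" and B: "tyeq s (A # G) B p B' q"
  shows "A' # G \<turnstile> B' \<Ztypecolon> HUniv (Suc 0)" "A' # G \<turnstile> q \<Ztypecolon> hlevel_pred s B'"
proof -
  note s = ctx_conv[OF wf_ctx[OF G] A]
  have c: "\<turnstile> A' # G" using A by (auto simp: deq_def intro: hott.ctx_ext)
  have AG: "wf (A # G)" using G A by (auto simp: deq_def intro: wf.intros)
  show "A' # G \<turnstile> B' \<Ztypecolon> HUniv (Suc 0)" "A' # G \<turnstile> q \<Ztypecolon> hlevel_pred s B'"
    using sub_tm[OF tyeqD(4)[OF AG B] c s] sub_tm[OF tyeqD(7)[OF AG B] c s] by simp_all
qed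

text \<open>Passing from a proposition to a set or collection wraps the proof in
  \<open>s_coe\<close>, which respects equality like any chosen term. The other two inclusions keep
  the proof and only raise the universe.\<close>

lemma tyeq_subsort:
  assumes G: "wf G" and eq: "tyeq s G A p B q" and s: "subsort s s'"
  shows "tyeq s' G A (if is_prop s \<and> \<not> is_prop s' then happs (s_coe ch) [A, p] else p)
    B (if is_prop s \<and> \<not> is_prop s' then happs (s_coe ch) [B, q] else q)"
proof -
  note D = tyeqD[OF G eq]
  have 1: "deq G A B (HUniv (level s'))"
    using s deq_cumul[OF D(1), of "level s'"] by (cases rule: subsort.cases) auto
  show ?thesis
  proof (cases "is_prop s \<and> \<not> is_prop s'")
    case True
    then have s: "hlevel_pred s = hisprop" "hlevel_pred s' = hisset"
      by (auto simp: hlevel_pred_def fun_eq_iff)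
    note D = D[unfolded s]
    show ?thesis
      using s_coe_app[OF typing_rel_tm wf_ctx[OF G] _ , of A A p p]
        s_coe_app[OF typing_rel_tm wf_ctx[OF G] _ , of B B q q]
        s_coe_app[OF typing_rel_eq wf_ctx[OF G] D(5,8)] D True
      by (intro tyeqI[OF G 1]) (simp_all add: s)
  next
    case False
    have "hlevel_pred s' = hlevel_pred s"
      using s False by (cases rule: subsort.cases) (auto simp: hlevel_pred_def fun_eq_iff)
    with False 1 eq show ?thesis by (auto simp: tyeq_def)
  qed
qed

lemma level_domsort [simp]: "level (domsort s) = level s"
  by (cases s) auto

lemma hlevel_pred_domsort [simp]: "hlevel_pred (domsort s) A = hisset A"
  by (cases s) (auto simp: hlevel_pred_def)

section \<open>The type formers of \<open>mTT\<close> with their proofs\<close>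

lemma tyeq_const:
  assumes "\<turnstile> G"
  shows tyeq_N0: "tyeq SSet G HEmpty (s_0 ch) HEmpty (s_0 ch)"
    and tyeq_N1: "tyeq SSet G HUnit (s_1 ch) HUnit (s_1 ch)"
    and tyeq_Props: "tyeq SCol G (hPROP 0) (s_PROP ch) (hPROP 0) (s_PROP ch)"
    and tyeq_Bot: "tyeq SProps G HEmpty (p_0 ch) HEmpty (p_0 ch)"
  using assms hPROP_form[of G 0]
  by (simp_all add: tyeq_def deq_refl hlevel_pred_def closed_tm[OF choice_typed(1)]
    closed_tm[OF choice_typed(9)] closed_tm[OF choice_typed(10)] closed_tm[OF choice_typed(15)]
    hott.empty_form hott.unit_form)

lemma tyeq_List:
  assumes G: "wf G" and A: "tyeq SSet G A p A' p'"
  shows "tyeq SSet G (HList A) (happs (s_list ch) [A, p]) (HList A') (happs (s_list ch) [A', p'])"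
proof -
  note c = wf_ctx[OF G]
  note D = tyeqD[OF G A, unfolded hlevel_pred_def]
  show ?thesis
    using s_list_app[OF typing_rel_tm c, of A A p p] s_list_app[OF typing_rel_tm c, of A' A' p' p']
      s_list_app[OF typing_rel_eq c D(5), of p p'] D
    by (intro tyeqI[OF G list_cong[OF D(1)]]) (simp_all add: hlevel_pred_def)
qed

lemma tyeq_Sum:
  assumes G: "wf G" and A: "tyeq SSet G A p A' p'" and B: "tyeq SSet G B q B' q'"
  shows "tyeq SSet G (HSum A B) (happs (s_sum ch) [A, B, p, q])
    (HSum A' B') (happs (s_sum ch) [A', B', p', q'])"
proof -
  note c = wf_ctx[OF G]
  note D = tyeqD[OF G A, unfolded hlevel_pred_def] tyeqD[OF G B, unfolded hlevel_pred_def]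
  show ?thesis
    using s_sum_app[OF typing_rel_tm c, of A A B B p p q q]
      s_sum_app[OF typing_rel_tm c, of A' A' B' B' p' p' q' q']
      s_sum_app[OF typing_rel_eq c D(5), of B B' p p' q q'] D
    by (intro tyeqI[OF G sum_cong[OF D(1,9)]]) (simp_all add: hlevel_pred_def)
qed

lemma tyeq_And:
  assumes G: "wf G" and s: "is_prop s" and A: "tyeq s G A p A' p'" and B: "tyeq s G B q B' q'"
  shows "tyeq s G (hprod A B) (happs (p_and ch) [A, B, p, q])
    (hprod A' B') (happs (p_and ch) [A', B', p', q'])"
proof -
  note c = wf_ctx[OF G]
  note D = tyeqD[OF G A, unfolded hlevel_pred_def] tyeqD[OF G B, unfolded hlevel_pred_def]
  show ?thesis
    using p_and_app[OF typing_rel_tm c, of A A B B p p q q]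
      p_and_app[OF typing_rel_tm c, of A' A' B' B' p' p' q' q']
      p_and_app[OF typing_rel_eq c D(5), of B B' p p' q q'] D s
    by (intro tyeqI[OF G hprod_cong[OF c D(1,9)]]) (simp_all add: hlevel_pred_def)
qed

lemma tyeq_Or:
  assumes G: "wf G" and s: "is_prop s" and A: "tyeq s G A p A' p'" and B: "tyeq s G B q B' q'"
  shows "tyeq s G (hor A B) (happs (p_or ch) [A, B]) (hor A' B') (happs (p_or ch) [A', B'])"
proof -
  note c = wf_ctx[OF G]
  note D = tyeqD[OF G A, unfolded hlevel_pred_def] tyeqD[OF G B, unfolded hlevel_pred_def]
  show ?thesis
    using p_or_app[OF typing_rel_tm c, of A A B B] p_or_app[OF typing_rel_tm c, of A' A' B' B']
      p_or_app[OF typing_rel_eq c D(5), of B B'] D s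
    by (intro tyeqI[OF G hor_cong[OF D(1,9)]]) (simp_all add: hlevel_pred_def)
qed

lemma tyeq_Imp:
  assumes G: "wf G" and s: "is_prop s" and A: "tyeq s G A p A' p'" and B: "tyeq s G B q B' q'"
  shows "tyeq s G (hfun A B) (happs (p_imp ch) [A, B, q]) (hfun A' B') (happs (p_imp ch) [A', B', q'])"
proof -
  note c = wf_ctx[OF G]
  note D = tyeqD[OF G A, unfolded hlevel_pred_def] tyeqD[OF G B, unfolded hlevel_pred_def]
  show ?thesis
    using p_imp_app[OF typing_rel_tm c, of A A B B q q] p_imp_app[OF typing_rel_tm c, of A' A' B' B' q' q']
      p_imp_app[OF typing_rel_eq c D(5), of B B' q q'] D s
    by (intro tyeqI[OF G hfun_cong[OF c D(1,9)]]) (simp_all add: hlevel_pred_def)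
qed

lemma tyeq_Id:
  assumes G: "wf G" and s: "is_prop s" and A: "tyeq (domsort s) G A p A' p'"
    and a: "deq G a a' A" and b: "deq G b b' A"
  shows "tyeq s G (HId A a b) (happs (p_id ch) [A, p, a, b]) (HId A' a' b') (happs (p_id ch) [A', p', a', b'])"
proof -
  note c = wf_ctx[OF G]
  note D = tyeqD[OF G A, simplified]
  note a' = deq_conv[OF a D(5)] and b' = deq_conv[OF b D(5)]
  have "deq G (HId A a b) (HId A' a' b') (HUniv (level s))"
    using id_cong[OF D(1) a b] .
  then show ?thesis
    using p_id_app[OF typing_rel_tm c, of A A p p a a b b]
      p_id_app[OF typing_rel_tm c, of A' A' p' p' a' a' b' b']
      p_id_app[OF typing_rel_eq c D(5), of p p' a a' b b'] D s a b a' b'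
    by (intro tyeqI[OF G]) (simp_all add: hlevel_pred_def deq_def)
qed

text \<open>The raw application of a chosen term proves the predicate of \<open>hex\<close>,
  \<open>HSig\<close> or \<open>HPi\<close> of \<open>A\<close> and \<open>fam (HLam B)\<close>; the
  congruence of that former along \<open>fam_beta\<close> turns it into the predicate for
  \<open>B\<close>. The last part treats universal quantification and products of sets at
  once.\<close>

lemma fam_cong:
  assumes R: "typing_rel R" and G: "wf G" and A: "G \<turnstile> A \<Ztypecolon> HUniv (Suc 0)"
    and B: "A # G \<turnstile> B \<Ztypecolon> HUniv (Suc 0)"
    and AA: "R G A A' (HUniv (Suc 0))" and BB: "R (A # G) B B' (HUniv (Suc 0))"
  shows rel_Ex: "R G (happs (p_ex ch) [A, HLam B]) (happs (p_ex ch) [A', HLam B']) (hisprop (hex A B))"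
    and rel_Sig: "R G p p' (hisset A) \<Longrightarrow> R (A # G) q q' (hisset B) \<Longrightarrow>
      R G (happs (s_sig ch) [A, HLam B, p, HLam q]) (happs (s_sig ch) [A', HLam B', p', HLam q'])
        (hisset (HSig A B))"
    and rel_Pi: "R (A # G) q q' (hlevel_pred s B) \<Longrightarrow>
      R G (happs (if is_prop s then p_all ch else s_pi ch) [A, HLam B, HLam q])
        (happs (if is_prop s then p_all ch else s_pi ch) [A', HLam B', HLam q'])
        (hlevel_pred s (HPi A B))"
proof -
  note c = wf_ctx[OF G]
  have A1: "deq G A A (HUniv (Suc 0))" using A by (simp add: deq_refl)
  note F = rel_lam[OF R BB] and b = fam_beta[OF A B]
  show "R G (happs (p_ex ch) [A, HLam B]) (happs (p_ex ch) [A', HLam B']) (hisprop (hex A B))"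
    using rel_conv_pred[OF R G hex_cong[OF c A1 b], of _ _ SProp] p_ex_app[OF R c AA F]
    by (simp add: hlevel_pred_def)
  show "R G (happs (s_sig ch) [A, HLam B, p, HLam q]) (happs (s_sig ch) [A', HLam B', p', HLam q'])
        (hisset (HSig A B))" if "R G p p' (hisset A)" "R (A # G) q q' (hisset B)"
    using rel_conv_pred[OF R G sig_cong[OF c A1 b], of _ _ SSet] s_sig_app[OF R c AA F that(1)]
      rel_lam_pred[OF R G A B, of q q' SSet] that(2)
    by (simp add: hlevel_pred_def)
  show "R G (happs (if is_prop s then p_all ch else s_pi ch) [A, HLam B, HLam q])
        (happs (if is_prop s then p_all ch else s_pi ch) [A', HLam B', HLam q'])
        (hlevel_pred s (HPi A B))" if "R (A # G) q q' (hlevel_pred s B)"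
    using rel_conv_pred[OF R G pi_cong[OF c A1 b], of _ _ s] s_pi_app[OF R c AA F] p_all_app[OF R c AA F]
      rel_lam_pred[OF R G A B that]
    by (cases "is_prop s") (simp_all add: hlevel_pred_def)
qed

lemma tyeq_Sig:
  assumes G: "wf G" and s: "\<not> is_prop s" and A: "tyeq s G A p A' p'" and B: "tyeq s (A # G) B q B' q'"
  shows "tyeq s G (HSig A B) (happs (s_sig ch) [A, HLam B, p, HLam q])
    (HSig A' B') (happs (s_sig ch) [A', HLam B', p', HLam q'])"
proof -
  note DA = tyeqD[OF G A, unfolded hlevel_pred_def]
  note DB = tyeqD[OF wf.intros(2)[OF G DA(3)] B, unfolded hlevel_pred_def]
  note DB' = tyeq_ctx[OF G DA(1) B, unfolded hlevel_pred_def]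
  show ?thesis
    using rel_Sig[OF typing_rel_tm G DA(3) DB(3), of A B p p q q]
      rel_Sig[OF typing_rel_tm G DA(4) DB'(1), of A' B' p' p' q' q']
      rel_Sig[OF typing_rel_eq G DA(3) DB(3) DA(5) DB(5), of p p' q q'] DA DB DB' s
    by (intro tyeqI[OF G sig_cong[OF wf_ctx[OF G] DA(1) DB(1)]]) (simp_all add: hlevel_pred_def)
qed

lemma tyeq_Ex:
  assumes G: "wf G" and s: "is_prop s" and A: "tyeq (domsort s) G A p A' p'"
    and B: "tyeq s (A # G) B q B' q'"
  shows "tyeq s G (hex A B) (happs (p_ex ch) [A, HLam B]) (hex A' B') (happs (p_ex ch) [A', HLam B'])"
proof -
  note DA = tyeqD[OF G A, simplified]
  note DB = tyeqD[OF wf.intros(2)[OF G DA(3)] B]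
  note DB' = tyeq_ctx[OF G DA(1) B]
  show ?thesis
    using rel_Ex[OF typing_rel_tm G DA(3) DB(3), of A B]
      rel_Ex[OF typing_rel_tm G DA(4) DB'(1), of A' B']
      rel_Ex[OF typing_rel_eq G DA(3) DB(3) DA(5) DB(5)] DA DB DB' s
    by (intro tyeqI[OF G hex_cong[OF wf_ctx[OF G] DA(1) DB(1)]]) (simp_all add: hlevel_pred_def)
qed

text \<open>Uniform in the sort: propositional sorts give universal quantification,
  \<open>SSet\<close> gives products of sets, and \<open>SCol\<close> is used for functions into the
  collection of small propositions.\<close>

lemma tyeq_Pi:
  assumes G: "wf G" and A: "tyeq (domsort s) G A p A' p'"
    and B: "tyeq s (A # G) B q B' q'"
  shows "tyeq s G (HPi A B) (happs (if is_prop s then p_all ch else s_pi ch) [A, HLam B, HLam q])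
    (HPi A' B') (happs (if is_prop s then p_all ch else s_pi ch) [A', HLam B', HLam q'])"
proof -
  note DA = tyeqD[OF G A, simplified]
  note DB = tyeqD[OF wf.intros(2)[OF G DA(3)] B]
  note DB' = tyeq_ctx[OF G DA(1) B]
  show ?thesis
    using rel_Pi[OF typing_rel_tm G DA(3) DB(3), of A B q q s]
      rel_Pi[OF typing_rel_tm G DA(4) DB'(1), of A' B' q' q' s]
      rel_Pi[OF typing_rel_eq G DA(3) DB(3) DA(5) DB(5), of q q' s] DA DB DB'
    by (intro tyeqI[OF G pi_cong[OF wf_ctx[OF G] DA(1) DB(1)]]) (simp_all del: foldl.simps)
qed

text \<open>A constant product over a domain first promoted from set to collection. This leaves the
  proof unchanged, and \<open>hPROP 0\<close> is closed, so \<open>hfun\<close> and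
  \<open>HPi\<close> coincide on it.\<close>

lemma tyeq_FunProps:
  assumes G: "wf G" and A: "tyeq SSet G A p A' p'"
  shows "tyeq SCol G (hfun A (hPROP 0)) (happs (s_pi ch) [A, HLam (hPROP 0), HLam (s_PROP ch)])
    (hfun A' (hPROP 0)) (happs (s_pi ch) [A', HLam (hPROP 0), HLam (s_PROP ch)])"
proof -
  have A1: "tyeq (domsort SCol) G A p A' p'"
    using tyeq_subsort[OF G A subsort.intros(3)] by simp
  have "\<turnstile> A # G" by (rule hott.ctx_ext[OF tyeqD(3)[OF G A]])
  from tyeq_Pi[OF G A1 tyeq_Props[OF this]] show ?thesis
    by (simp add: hfun_def hwk_sub hPROP_sub)
qed

section \<open>Small propositions as elements of \<open>hPROP 0\<close>\<close>

text \<open>A code is the pair of a type and its proof. Decoding projects both components, and the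
  beta rules of the projections return the original type and proof; these are the definitional
  equalities of \<open>TTau\<close> on codes.\<close>

lemma pair_PROP:
  assumes G: "wf G" and P: "tyeq SProps G P p P p"
  shows "G \<turnstile> HPair P p \<Ztypecolon> hPROP 0"
    and "tyeq SProps G (hpr1 (HPair P p)) (hpr2 (HPair P p)) P p"
proof -
  have U: "G \<turnstile> HUniv 0 \<Ztypecolon> HUniv (Suc 0)" by (intro hott.univ wf_ctx G)
  have V: "HUniv 0 # G \<turnstile> hisprop (HVar 0) \<Ztypecolon> HUniv 0"
    using hisprop_form[of "HUniv 0 # G" "HVar 0" 0] var0[OF U] by (simp add: sub_simps)
  have D: "G \<turnstile> P \<Ztypecolon> HUniv 0" "G \<turnstile> p \<Ztypecolon> hinst (hisprop (HVar 0)) P"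
    using P by (simp_all add: tyeq_def hlevel_pred_def deq_refl def_sub)
  show "G \<turnstile> HPair P p \<Ztypecolon> hPROP 0"
    unfolding hPROP_def by (rule hott.sig_intro[OF V D])
  show "tyeq SProps G (hpr1 (HPair P p)) (hpr2 (HPair P p)) P p"
    using deq_sym[OF pr1_beta_deq[OF U V D]] deq_sym[OF pr2_beta_deq[OF G U V D]]
    by - (rule tyeq_sym[OF G], simp add: tyeq_def hlevel_pred_def def_sub)
qed

lemma tyeq_Tau:
  assumes G: "wf G" and p: "G \<turnstile> p \<Ztypecolon> hPROP 0"
  shows "tyeq SProps G (hpr1 p) (hpr2 p) (hpr1 p) (hpr2 p)"
proof -
  have U: "G \<turnstile> HUniv 0 \<Ztypecolon> HUniv (Suc 0)" by (intro hott.univ wf_ctx G)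
  have V: "HUniv 0 # G \<turnstile> hisprop (HVar 0) \<Ztypecolon> HUniv 0"
    using hisprop_form[of "HUniv 0 # G" "HVar 0" 0] var0[OF U] by (simp add: sub_simps)
  show ?thesis
    using pr1_tm[OF U V] pr2_tm[OF G U V] p
    by (simp add: tyeq_def hlevel_pred_def deq_refl hPROP_def def_sub)
qed

text \<open>\<open>hPROP\<close> and \<open>hSET\<close> are both the Sigma type of
  \<open>hlevel_pred\<close> over a universe, so congruence of pairing covers all four
  sorts.\<close>

lemma tyeq_pair:
  assumes G: "wf G" and eq: "tyeq s G A p B q"
  shows "G \<turnstile> HPair A p \<simeq> HPair B q \<Ztypecolon> hlevel_univ s"
proof -
  let ?U = "HUniv (level s)"
  have "hlevel_univ s = HSig ?U (hlevel_pred s (HVar 0))"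
    by (simp add: hlevel_univ_def hlevel_pred_def hPROP_def hSET_def)
  moreover have "?U # G \<turnstile> hlevel_pred s (HVar 0) \<Ztypecolon> ?U"
    using hlevel_pred_form[of "?U # G" "HVar 0" "level s" s] var0[OF hott.univ[OF wf_ctx[OF G]]]
    by (simp add: sub_simps)
  ultimately show ?thesis
    using tyeqD[OF G eq] by (auto simp: hlevel_pred_sub deq_def intro: hott.sig_intro_eq)
qed

end

section \<open>Soundness of the interpretation\<close>

text \<open>The presupposition of the variable rule: \<open>wf\<close> records a universe for each
  entry, and weakening carries it to the whole context.\<close>

lemma (in hott_theory) wf_nth:
  "wf G \<Longrightarrow> n < length G \<Longrightarrow> \<exists>i. G \<turnstile> hwk (Suc n) (G ! n) \<Ztypecolon> HUniv i"
proof (induction arbitrary: n rule: wf.induct)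
  case (2 G A i)
  show ?case
  proof (cases n)
    case 0
    then show ?thesis using wk1_ty[OF 2(2) 2(2)] by (auto simp: eval_nat_numeral)
  next
    case (Suc m)
    then obtain j where "G \<turnstile> hwk (Suc m) (G ! m) \<Ztypecolon> HUniv j" using 2 by auto
    from wk1_ty[OF this 2(2)] show ?thesis using Suc by (auto simp: sub_simps)
  qed
qed simp

context hott_theory
begin

section \<open>Elimination of disjunctions and existentials through truncation\<close>

text \<open>In \<open>hind_or\<close> a branch sits below the extra variable for the untruncated
  sum. The renaming \<open>upr Suc\<close> is the lift of a weakening, so the branch stays
  typed.\<close>

lemma or_branch:
  assumes A: "G \<turnstile> A \<Ztypecolon> HUniv i" and S: "G \<turnstile> S \<Ztypecolon> HUniv i" and l: "A # G \<turnstile> l \<Ztypecolon> hwk 1 C"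
  shows "hwk 1 A # S # G \<turnstile> hren (upr Suc) l \<Ztypecolon> hwk 2 C"
proof -
  have A1: "S # G \<turnstile> hsub (\<lambda>n. HVar (Suc n)) A \<Ztypecolon> HUniv i"
    using wk1_ty[OF A S] by (simp add: sub_simps)
  show ?thesis
    using sub_tm[OF l hott.ctx_ext[OF A1] sub_ok_hup[OF sub_ok_shift1[OF S] A1]]
    by (simp add: sub_simps eval_nat_numeral)
qed

text \<open>Inside the truncation eliminator a case distinction is made on the bound variable, with
  the target weakened to a constant motive. The beta rules compose that of the truncation with that
  of the sum; instantiating the bound variable cancels the renaming of the branches.\<close>

lemma or_elim:
  assumes A: "G \<turnstile> A \<Ztypecolon> HUniv i" and B: "G \<turnstile> B \<Ztypecolon> HUniv i" and C: "G \<turnstile> C \<Ztypecolon> HUniv j"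
    and l: "A # G \<turnstile> l \<Ztypecolon> hwk 1 C" and r: "B # G \<turnstile> r \<Ztypecolon> hwk 1 C" and s: "G \<turnstile> s \<Ztypecolon> hisprop C"
  shows or_elim_tm: "G \<turnstile> d \<Ztypecolon> hor A B \<Longrightarrow> G \<turnstile> hind_or d l r s \<Ztypecolon> C"
    and or_beta_inl: "G \<turnstile> a \<Ztypecolon> A \<Longrightarrow> G \<turnstile> hind_or (hinl_or a) l r s \<simeq> hinst l a \<Ztypecolon> C"
    and or_beta_inr: "G \<turnstile> b \<Ztypecolon> B \<Longrightarrow> G \<turnstile> hind_or (hinr_or b) l r s \<simeq> hinst r b \<Ztypecolon> C"
proof -
  let ?S = "HSum A B"
  let ?c = "HIndSum (HVar 0) (hren (upr Suc) l) (hren (upr Suc) r)"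
  have S: "G \<turnstile> ?S \<Ztypecolon> HUniv i" by (rule hott.sum_form[OF A B])
  have A1: "?S # G \<turnstile> hwk 1 A \<Ztypecolon> HUniv i" and B1: "?S # G \<turnstile> hwk 1 B \<Ztypecolon> HUniv i"
    and C1: "?S # G \<turnstile> hwk 1 C \<Ztypecolon> HUniv j"
    using wk1_ty[OF _ S] A B C by auto
  have C2: "HSum (hwk 1 A) (hwk 1 B) # ?S # G \<turnstile> hwk 2 C \<Ztypecolon> HUniv j"
    using wk1_ty[OF C1 hott.sum_form[OF A1 B1]] by (simp add: sub_simps)
  have c: "?S # G \<turnstile> ?c \<Ztypecolon> hwk 1 C"
    using hott.sum_elim[OF C2, of "hren (upr Suc) l" "hren (upr Suc) r" "HVar 0"]
      or_branch[OF A S l] or_branch[OF B S r] var0[OF S]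
    by (simp add: sub_simps)
  show "G \<turnstile> hind_or d l r s \<Ztypecolon> C" if "G \<turnstile> d \<Ztypecolon> hor A B"
    using hott.trunc_elim[OF C _ c s] that by (simp add: hor_def hind_or_def)
  have l': "A # G \<turnstile> l \<Ztypecolon> hat 1 (HInl (HVar 0)) (hwk 1 C)"
    and r': "B # G \<turnstile> r \<Ztypecolon> hat 1 (HInr (HVar 0)) (hwk 1 C)"
    using l r by (simp_all add: sub_simps)
  show "G \<turnstile> hind_or (hinl_or a) l r s \<simeq> hinst l a \<Ztypecolon> C" if "G \<turnstile> a \<Ztypecolon> A"
    using hott.eq_trans[OF hott.trunc_beta[OF C hott.sum_inl[OF B that] c s]]
      hott.sum_beta_inl[OF C1 l' r' that]
    by (simp add: hind_or_def hinl_or_def sub_simps)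
  show "G \<turnstile> hind_or (hinr_or b) l r s \<simeq> hinst r b \<Ztypecolon> C" if "G \<turnstile> b \<Ztypecolon> B"
    using hott.eq_trans[OF hott.trunc_beta[OF C hott.sum_inr[OF A that] c s]]
      hott.sum_beta_inr[OF C1 l' r' that]
    by (simp add: hind_or_def hinr_or_def sub_simps)
qed

text \<open>As for disjunction, with the Sigma eliminator inside; the branch binds two variables, so
  the weakening is lifted twice.\<close>

lemma ex_elim:
  assumes A: "G \<turnstile> A \<Ztypecolon> HUniv i" and B: "A # G \<turnstile> B \<Ztypecolon> HUniv i" and C: "G \<turnstile> C \<Ztypecolon> HUniv j"
    and c: "B # A # G \<turnstile> c \<Ztypecolon> hwk 2 C" and s: "G \<turnstile> s \<Ztypecolon> hisprop C"
  shows ex_elim_tm: "G \<turnstile> d \<Ztypecolon> hex A B \<Longrightarrow> G \<turnstile> hind_ex d c s \<Ztypecolon> C"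
    and ex_beta: "G \<turnstile> a \<Ztypecolon> A \<Longrightarrow> G \<turnstile> b \<Ztypecolon> hinst B a \<Longrightarrow>
      G \<turnstile> hind_ex (hpair_ex a b) c s \<simeq> hsub (b \<rhd> a \<rhd> HVar) c \<Ztypecolon> C"
proof -
  let ?S = "HSig A B" and ?w = "\<lambda>n. HVar (Suc n)"
  let ?c = "HIndSig (HVar 0) (hren (upr (upr Suc)) c)"
  have S: "G \<turnstile> ?S \<Ztypecolon> HUniv i" by (rule hott.sig_form[OF A B])
  have A1: "?S # G \<turnstile> hsub ?w A \<Ztypecolon> HUniv i" and C1: "?S # G \<turnstile> hwk 1 C \<Ztypecolon> HUniv j"
    using wk1_ty[OF A S] wk1_ty[OF C S] by (simp_all add: sub_simps)
  note u1 = sub_ok_hup[OF sub_ok_shift1[OF S] A1]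
  have B1: "hsub ?w A # ?S # G \<turnstile> hsub (hup ?w) B \<Ztypecolon> HUniv i"
    using sub_tm[OF B hott.ctx_ext[OF A1] u1] by simp
  note u2 = sub_ok_hup[OF u1 B1]
  have c2: "hsub (hup ?w) B # hsub ?w A # ?S # G \<turnstile> hren (upr (upr Suc)) c \<Ztypecolon> hwk 3 C"
    using sub_tm[OF c hott.ctx_ext[OF B1] u2] by (simp add: sub_simps eval_nat_numeral)
  have C2: "HSig (hsub ?w A) (hsub (hup ?w) B) # ?S # G \<turnstile> hwk 2 C \<Ztypecolon> HUniv j"
    using wk1_ty[OF C1 hott.sig_form[OF A1 B1]] by (simp add: sub_simps)
  have c1: "?S # G \<turnstile> ?c \<Ztypecolon> hwk 1 C"
    using hott.sig_elim[OF C2, of "hren (upr (upr Suc)) c" "HVar 0"] c2 var0[OF S]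
    by (simp add: sub_simps eval_nat_numeral)
  show "G \<turnstile> hind_ex d c s \<Ztypecolon> C" if "G \<turnstile> d \<Ztypecolon> hex A B"
    using hott.trunc_elim[OF C _ c1 s] that by (simp add: hex_def hind_ex_def)
  have c': "B # A # G \<turnstile> c \<Ztypecolon> hat 2 (HPair (HVar 1) (HVar 0)) (hwk 1 C)"
    using c by (simp add: sub_simps)
  show "G \<turnstile> hind_ex (hpair_ex a b) c s \<simeq> hsub (b \<rhd> a \<rhd> HVar) c \<Ztypecolon> C"
    if "G \<turnstile> a \<Ztypecolon> A" "G \<turnstile> b \<Ztypecolon> hinst B a"
    using hott.eq_trans[OF hott.trunc_beta[OF C hott.sig_intro[OF B that] c1 s]]
      hott.sig_beta[OF C1 c' that]
    by (simp add: hind_ex_def hpair_ex_def sub_simps)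
qed

end

context hott_choice
begin

section \<open>Interpretation of the instances occurring in the rules\<close>

lemma i_ty_ren: "ity ch A = Some A' \<Longrightarrow> ity ch (mwkT k A) = Some (hwk k A')"
  by (simp add: mwkT_def hwk_sub i_ren)

lemma i_ty_sub: "ity ch A = Some A' \<Longrightarrow> (\<And>n. itm ch (\<sigma> n) = Some (\<sigma>' n)) \<Longrightarrow>
    ity ch (msubT \<sigma> A) = Some (hsub \<sigma>' A')"
  by (simp add: i_sub)

lemma i_tm_sub: "itm ch a = Some a' \<Longrightarrow> (\<And>n. itm ch (\<sigma> n) = Some (\<sigma>' n)) \<Longrightarrow>
    itm ch (msub \<sigma> a) = Some (hsub \<sigma>' a')"
  by (simp add: i_sub)

lemma i_scons: "itm ch a = Some a' \<Longrightarrow> (\<And>n. itm ch (\<sigma> n) = Some (\<sigma>' n)) \<Longrightarrow>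
    itm ch ((a \<rhd> \<sigma>) n) = Some ((a' \<rhd> \<sigma>') n)"
  by (simp split: nat.split)

lemmas i_subst = i_ty_ren i_ty_sub i_tm_sub i_scons

lemma i_inst:
  "itm ch a = Some a' \<Longrightarrow> ity ch C = Some C' \<Longrightarrow> ity ch (minstT C a) = Some (hinst C' a')"
  "itm ch a = Some a' \<Longrightarrow> itm ch c = Some c' \<Longrightarrow> itm ch (minst c a) = Some (hinst c' a')"
  "itm ch a = Some a' \<Longrightarrow> ity ch C = Some C' \<Longrightarrow> ity ch (matT k a C) = Some (hat k a' C')"
  "itm ch a = Some a' \<Longrightarrow> itm ch b = Some b' \<Longrightarrow> ity ch C = Some C' \<Longrightarrow>
    ity ch (msubT (b \<rhd> a \<rhd> MVar) C) = Some (hsub (b' \<rhd> a' \<rhd> HVar) C')"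
  "itm ch a = Some a' \<Longrightarrow> itm ch b = Some b' \<Longrightarrow> itm ch c = Some c' \<Longrightarrow>
    itm ch (msub (b \<rhd> a \<rhd> MVar) c) = Some (hsub (b' \<rhd> a' \<rhd> HVar) c')"
  "itm ch a = Some a' \<Longrightarrow> itm ch b = Some b' \<Longrightarrow> itm ch d = Some d' \<Longrightarrow> itm ch c = Some c' \<Longrightarrow>
    itm ch (msub (d \<rhd> b \<rhd> a \<rhd> MVar) c) = Some (hsub (d' \<rhd> b' \<rhd> a' \<rhd> HVar) c')"
  "ity ch C = Some C' \<Longrightarrow> ity ch (msubT (MVar 0 \<rhd> MVar 0 \<rhd> (\<lambda>n. MVar (n + 1))) C) =
    Some (hsub (HVar 0 \<rhd> HVar 0 \<rhd> (\<lambda>n. HVar (n + 1))) C')"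
  unfolding matT_def hat_def by ((rule i_subst itm.simps | assumption)+)

text \<open>\<open>iprP\<close> is defined only on propositional type formers, and these are the
  ones handled by the last clause of \<open>iprS\<close>.\<close>

lemma iprS_prop: "iprP ch A = Some p \<Longrightarrow> ity ch A = Some A' \<Longrightarrow>
    iprS ch A = Some (happs (s_coe ch) [A', p])"
  by (cases A) (simp_all del: foldl.simps)

lemma ity_proof_subsort:
  assumes "subsort s s'" "ity_proof ch s A = Some p" "ity ch A = Some A'"
  shows "ity_proof ch s' A =
    Some (if is_prop s \<and> \<not> is_prop s' then happs (s_coe ch) [A', p] else p)"
  using assms iprS_prop[of A p A']
  by (cases rule: subsort.cases) (auto simp: ity_proof_def)

lemma ity_proof_simps [simp]:
  "ity_proof ch SSet = iprS ch" "ity_proof ch SCol = iprS ch"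
  "ity_proof ch SProp = iprP ch" "ity_proof ch SProps = iprP ch"
  "ity_proof ch (domsort s) = iprS ch"
  by (auto simp: ity_proof_def fun_eq_iff) (cases s; simp)

lemma ictx_append:
  "ictx ch (D @ G) = Some H \<Longrightarrow> \<exists>D' G'. H = D' @ G' \<and> ictx ch G = Some G' \<and>
    length D' = length D \<and> (\<forall>i<length D. ity ch (D ! i) = Some (D' ! i))"
proof (induction D arbitrary: H)
  case (Cons A D)
  then obtain H1 A' where H: "ictx ch (D @ G) = Some H1" "ity ch A = Some A'" "H = A' # H1"
    by (auto simp: bind_eq_Some_conv)
  from Cons.IH[OF H(1)] obtain D' G' where "H1 = D' @ G'" "ictx ch G = Some G'"
    "length D' = length D" "\<forall>i<length D. ity ch (D ! i) = Some (D' ! i)" by auto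
  with H show ?case
    by (intro exI[of _ "A' # D'"] exI[of _ G']) (auto simp: less_Suc_eq_0_disj)
qed auto

text \<open>The induction hypothesis: \<open>holds\<close> together with the presuppositions of the judgement.\<close>

fun valid :: "mjudg \<Rightarrow> bool" where
  "valid (JCtx G) \<longleftrightarrow> (\<exists>G'. ictx ch G = Some G' \<and> wf G')"
| "valid (JTy s G A) \<longleftrightarrow> (\<exists>G' A' p. ictx ch G = Some G' \<and> wf G' \<and> ity ch A = Some A' \<and>
     ity_proof ch s A = Some p \<and> tyeq s G' A' p A' p)"
| "valid (JTyEq s G A B) \<longleftrightarrow> (\<exists>G' A' p B' q. ictx ch G = Some G' \<and> wf G' \<and> ity ch A = Some A' \<and>
     ity_proof ch s A = Some p \<and> ity ch B = Some B' \<and> ity_proof ch s B = Some q \<and>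
     tyeq s G' A' p B' q)"
| "valid (JTm G a A) \<longleftrightarrow> (\<exists>G' a' A' i. ictx ch G = Some G' \<and> wf G' \<and> itm ch a = Some a' \<and>
     ity ch A = Some A' \<and> G' \<turnstile> A' \<Ztypecolon> HUniv i \<and> G' \<turnstile> a' \<Ztypecolon> A')"
| "valid (JEq G a b A) \<longleftrightarrow> (\<exists>G' a' b' A' i. ictx ch G = Some G' \<and> wf G' \<and> itm ch a = Some a' \<and>
     itm ch b = Some b' \<and> ity ch A = Some A' \<and> G' \<turnstile> A' \<Ztypecolon> HUniv i \<and> deq G' a' b' A')"

lemma valid_holds: "valid J \<Longrightarrow> holds E ch J"
proof (induction J rule: valid.induct)
  case (2 s G A)
  then show ?case using tyeqD(1,6) by (fastforce simp: deq_def)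
next
  case (3 s G A B)
  then show ?case using tyeq_pair by fastforce
qed (auto simp: deq_def intro: wf_ctx)

section \<open>Soundness of the substitution of equals\<close>

text \<open>Translates the premises shared by the two substitution rules of \<open>mTT\<close> into
  those of \<open>sub_cong\<close>; the induction hypotheses, unlike \<open>holds\<close>, also give
  the typing of both terms of every equation.\<close>

lemma valid_sub:
  assumes D: "ictx ch (D @ G) = Some H" "wf H" and len: "length as = length D" "length bs = length D"
    and eq: "\<forall>i<length D. valid (JEq G (as ! i) (bs ! i) (msubT (mlist (drop (Suc i) as)) (D ! i)))"
  obtains G' \<sigma> \<tau> where "ictx ch G = Some G'" "wf G'" "\<And>n. itm ch (mlist as n) = Some (\<sigma> n)"
    "\<And>n. itm ch (mlist bs n) = Some (\<tau> n)" "sub_ok G' \<sigma> H" "sub_ok G' \<tau> H"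
    "\<And>c C i. H \<turnstile> c \<Ztypecolon> C \<Longrightarrow> H \<turnstile> C \<Ztypecolon> HUniv i \<Longrightarrow> G' \<turnstile> hsub \<sigma> c \<simeq> hsub \<tau> c \<Ztypecolon> hsub \<sigma> C"
proof -
  from ictx_append[OF D(1)] obtain D' G' where H: "H = D' @ G'" and G': "ictx ch G = Some G'"
    and len': "length D' = length D" and D': "\<And>i. i < length D \<Longrightarrow> ity ch (D ! i) = Some (D' ! i)"
    by auto
  \<comment> \<open>\<open>the\<close> is harmless: every premise asserts that both of its terms
    have an interpretation.\<close>
  define as' bs' where "as' = map (the \<circ> itm ch) as" and "bs' = map (the \<circ> itm ch) bs"
  have def: "itm ch (as ! i) = Some (as' ! i)" "itm ch (bs ! i) = Some (bs' ! i)" if "i < length D" for i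
    using eq[rule_format, OF that] that len by (auto simp: as'_def bs'_def)
  have l: "length as' = length D'" "length bs' = length D'"
    using len len' by (auto simp: as'_def bs'_def)
  \<comment> \<open>Stated for all suffixes, because the type of the \<open>i\<close>-th equation is
    substituted by the terms after position \<open>i\<close>.\<close>
  have list: "itm ch (mlist (drop k xs) n) = Some (hlist (drop k xs') n)"
    if "\<And>i. i < length D \<Longrightarrow> itm ch (xs ! i) = Some (xs' ! i)" "length xs = length D" "length xs' = length D"
    for k n xs xs'
    using that by (auto simp: mlist_def hlist_def)
  have "deq G' (as' ! i) (bs' ! i) (hsub (hlist (drop (Suc i) as')) (D' ! i))" if i: "i < length D" for i
  proof -
    have "ity ch (msubT (mlist (drop (Suc i) as)) (D ! i)) = Some (hsub (hlist (drop (Suc i) as')) (D' ! i))"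
      using i_ty_sub[OF D'[OF i] list[OF def(1)]] len l len' by auto
    then show ?thesis
      using eq[rule_format, OF i] def[OF i] G' by auto
  qed
  then have cong: "sub_ok G' (hlist as') H \<and> sub_ok G' (hlist bs') H \<and>
    (\<forall>c C i. H \<turnstile> c \<Ztypecolon> C \<longrightarrow> H \<turnstile> C \<Ztypecolon> HUniv i \<longrightarrow>
      G' \<turnstile> hsub (hlist as') c \<simeq> hsub (hlist bs') c \<Ztypecolon> hsub (hlist as') C)"
    using sub_cong[of D' G' as' bs'] D(2) l len' by (auto simp: H)
  have "wf G'" using D(2) H wf_appendD by auto
  moreover have "itm ch (mlist as n) = Some (hlist as' n)" "itm ch (mlist bs n) = Some (hlist bs' n)" for n
    using list[where xs = as and xs' = as' and k = 0] list[where xs = bs and xs' = bs' and k = 0]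
      def l len len' by auto
  ultimately show thesis using that[of G' "hlist as'" "hlist bs'"] G' cong by blast
qed

text \<open>The proof component is a term like any other, so the substitution of equals is used
  twice: for the type in its universe, and for the proof in the predicate of that type.\<close>

lemma valid_sub_ty:
  assumes "valid (JTy s (D @ G) C)" "length as = length D" "length bs = length D"
    and "\<forall>i<length D. valid (JEq G (as ! i) (bs ! i) (msubT (mlist (drop (Suc i) as)) (D ! i)))"
  shows "valid (JTyEq s G (msubT (mlist as) C) (msubT (mlist bs) C))"
proof -
  from assms(1) obtain H C' p where H: "ictx ch (D @ G) = Some H" "wf H" and C: "ity ch C = Some C'"
    "ity_proof ch s C = Some p" and eq: "tyeq s H C' p C' p" by auto
  obtain G' \<sigma> \<tau> where G: "ictx ch G = Some G'" "wf G'" and s: "\<And>n. itm ch (mlist as n) = Some (\<sigma> n)"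
    "\<And>n. itm ch (mlist bs n) = Some (\<tau> n)" and ok: "sub_ok G' \<sigma> H" "sub_ok G' \<tau> H" and
    cong: "\<And>c C i. H \<turnstile> c \<Ztypecolon> C \<Longrightarrow> H \<turnstile> C \<Ztypecolon> HUniv i \<Longrightarrow> G' \<turnstile> hsub \<sigma> c \<simeq> hsub \<tau> c \<Ztypecolon> hsub \<sigma> C"
    by (rule valid_sub[OF H assms(2-4)]) (assumption | rule that)+
  note c = wf_ctx[OF G(2)]
  note D = tyeqD[OF H(2) eq]
  have C0: "H \<turnstile> C' \<Ztypecolon> HUniv (level s)" using D(1) by (rule deqD)
  have "deq G' (hsub \<sigma> C') (hsub \<tau> C') (HUniv (level s))"
    using sub_tm[OF C0 c ok(1)] sub_tm[OF C0 c ok(2)] cong[OF C0 hott.univ[OF wf_ctx[OF H(2)]]]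
    by (simp add: deq_def)
  then have "tyeq s G' (hsub \<sigma> C') (hsub \<sigma> p) (hsub \<tau> C') (hsub \<tau> p)"
    using sub_tm[OF D(6) c ok(1)] sub_tm[OF D(6) c ok(2)] cong[OF D(6) hlevel_pred_form[OF C0]]
    by (intro tyeqI[OF G(2)]) (simp_all add: hlevel_pred_sub)
  moreover have "ity_proof ch s (msubT (mlist as) C) = Some (hsub \<sigma> p)"
    "ity_proof ch s (msubT (mlist bs) C) = Some (hsub \<tau> p)"
    using C(2) i_sub(1)[OF s(1)] i_sub(1)[OF s(2)] by (auto simp: ity_proof_def)
  ultimately show ?thesis
    using G i_ty_sub[OF C(1) s(1)] i_ty_sub[OF C(1) s(2)] by auto
qed

text \<open>The right-hand term is typed at the \<open>bs\<close> instance of \<open>C\<close>;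
  equality of the two instances of \<open>C\<close> moves it to the \<open>as\<close>
  instance.\<close>

lemma valid_sub_tm:
  assumes "valid (JTm (D @ G) c C)" "length as = length D" "length bs = length D"
    and "\<forall>i<length D. valid (JEq G (as ! i) (bs ! i) (msubT (mlist (drop (Suc i) as)) (D ! i)))"
  shows "valid (JEq G (msub (mlist as) c) (msub (mlist bs) c) (msubT (mlist as) C))"
proof -
  from assms(1) obtain H C' c' i where H: "ictx ch (D @ G) = Some H" "wf H" and C: "ity ch C = Some C'"
    "itm ch c = Some c'" and ty: "H \<turnstile> C' \<Ztypecolon> HUniv i" "H \<turnstile> c' \<Ztypecolon> C'" by auto
  obtain G' \<sigma> \<tau> where G: "ictx ch G = Some G'" "wf G'" and s: "\<And>n. itm ch (mlist as n) = Some (\<sigma> n)"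
    "\<And>n. itm ch (mlist bs n) = Some (\<tau> n)" and ok: "sub_ok G' \<sigma> H" "sub_ok G' \<tau> H" and
    cong: "\<And>c C i. H \<turnstile> c \<Ztypecolon> C \<Longrightarrow> H \<turnstile> C \<Ztypecolon> HUniv i \<Longrightarrow> G' \<turnstile> hsub \<sigma> c \<simeq> hsub \<tau> c \<Ztypecolon> hsub \<sigma> C"
    by (rule valid_sub[OF H assms(2-4)]) (assumption | rule that)+
  note c = wf_ctx[OF G(2)]
  have "G' \<turnstile> hsub \<tau> C' \<simeq> hsub \<sigma> C' \<Ztypecolon> HUniv i"
    using hott.eq_sym[OF cong[OF ty(1) hott.univ[OF wf_ctx[OF H(2)]]]] by simp
  then have "deq G' (hsub \<sigma> c') (hsub \<tau> c') (hsub \<sigma> C')"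
    using sub_tm[OF ty(2) c ok(1)] hott.conv[OF sub_tm[OF ty(2) c ok(2)]] cong[OF ty(2,1)]
    by (auto simp: deq_def)
  then show ?thesis
    using G i_ty_sub[OF C(1) s(1)] i_tm_sub[OF C(2) s(1)] i_tm_sub[OF C(2) s(2)] sub_tm[OF ty(1) c ok(1)]
    by auto
qed

text \<open>Iterated applications stay folded from here on, so that interpreted proof terms match
  the \<open>tyeq\<close> lemmas syntactically.\<close>

declare foldl.simps [simp del]

lemma ictx_Cons: "ictx ch G = Some G' \<Longrightarrow> ity ch A = Some A' \<Longrightarrow> ictx ch (A # G) = Some (A' # G')"
  by simp

text \<open>The motive of the \<open>mTT\<close> eliminator depends on the two end points only, that
  of \<open>id_elim\<close> also on the path; weakening by the path variable reduces one to the
  other.\<close>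

lemma path_elim:
  assumes A: "G \<turnstile> A \<Ztypecolon> HUniv i" and C: "hwk 1 A # A # G \<turnstile> C \<Ztypecolon> HUniv j"
    and e: "A # G \<turnstile> e \<Ztypecolon> hsub (HVar 0 \<rhd> HVar 0 \<rhd> (\<lambda>n. HVar (n + 1))) C"
  shows "\<turnstile> G \<Longrightarrow> G \<turnstile> a \<Ztypecolon> A \<Longrightarrow> G \<turnstile> b \<Ztypecolon> A \<Longrightarrow> G \<turnstile> hsub (b \<rhd> a \<rhd> HVar) C \<Ztypecolon> HUniv j"
    and "G \<turnstile> a \<Ztypecolon> A \<Longrightarrow> G \<turnstile> b \<Ztypecolon> A \<Longrightarrow> G \<turnstile> p \<Ztypecolon> HId A a b \<Longrightarrow>
      G \<turnstile> HIndId p e \<Ztypecolon> hsub (b \<rhd> a \<rhd> HVar) C"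
    and "G \<turnstile> a \<Ztypecolon> A \<Longrightarrow> G \<turnstile> HIndId (HRefl a) e \<simeq> hinst e a \<Ztypecolon> hsub (a \<rhd> a \<rhd> HVar) C"
proof -
  have C1: "HId (hwk 2 A) (HVar 1) (HVar 0) # hwk 1 A # A # G \<turnstile> hwk 1 C \<Ztypecolon> HUniv j"
    by (rule wk1_ty[OF C id_vars_form[OF A]])
  have e1: "A # G \<turnstile> e \<Ztypecolon> hsub (HRefl (HVar 0) \<rhd> HVar 0 \<rhd> HVar 0 \<rhd> (\<lambda>n. HVar (n + 1))) (hwk 1 C)"
    using e by (simp add: sub_simps)
  show "G \<turnstile> hsub (b \<rhd> a \<rhd> HVar) C \<Ztypecolon> HUniv j" if "\<turnstile> G" "G \<turnstile> a \<Ztypecolon> A" "G \<turnstile> b \<Ztypecolon> A"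
    using sub_tm[OF C that(1) sub_ok_scons[OF sub_ok_scons[OF sub_ok_id[OF that(1)]]], of a b] that
    by (simp add: sub_simps)
  show "G \<turnstile> HIndId p e \<Ztypecolon> hsub (b \<rhd> a \<rhd> HVar) C"
    if "G \<turnstile> a \<Ztypecolon> A" "G \<turnstile> b \<Ztypecolon> A" "G \<turnstile> p \<Ztypecolon> HId A a b"
    using hott.id_elim[OF C1 e1 that] by (simp add: sub_simps)
  show "G \<turnstile> HIndId (HRefl a) e \<simeq> hinst e a \<Ztypecolon> hsub (a \<rhd> a \<rhd> HVar) C" if "G \<turnstile> a \<Ztypecolon> A"
    using hott.id_beta[OF C1 e1 that] by (simp add: sub_simps)
qed

lemma valid_ctx: "valid (JTy s G A) \<Longrightarrow> \<exists>G'. ictx ch G = Some G' \<and> wf G'"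
  by auto

lemma valid_ctx_tm: "valid (JTm G a A) \<Longrightarrow> \<exists>G'. ictx ch G = Some G' \<and> wf G'"
  by auto

text \<open>This lemma and the next open an induction hypothesis relative to an interpretation of
  the context, and for terms also of the type, already fixed; thus all premises of a rule speak
  about the same \<open>G'\<close>.\<close>

lemma valid_ty: "valid (JTy s G A) \<Longrightarrow> ictx ch G = Some G' \<Longrightarrow>
    \<exists>A' p. ity ch A = Some A' \<and> ity_proof ch s A = Some p \<and> tyeq s G' A' p A' p \<and>
      wf (A' # G') \<and> G' \<turnstile> A' \<Ztypecolon> HUniv (Suc 0) \<and> G' \<turnstile> p \<Ztypecolon> hlevel_pred s A'"
  by (auto dest: tyeqD(3,6) intro: wf.intros)

lemma valid_tm: "valid (JTm G a A) \<Longrightarrow> ictx ch G = Some G' \<Longrightarrow> ity ch A = Some A' \<Longrightarrow>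
    \<exists>a'. itm ch a = Some a' \<and> G' \<turnstile> a' \<Ztypecolon> A'"
  by auto

lemma valid_tmI: "ictx ch G = Some G' \<Longrightarrow> wf G' \<Longrightarrow> itm ch a = Some a' \<Longrightarrow> ity ch A = Some A' \<Longrightarrow>
    G' \<turnstile> A' \<Ztypecolon> HUniv i \<Longrightarrow> G' \<turnstile> a' \<Ztypecolon> A' \<Longrightarrow> valid (JTm G a A)"
  by auto

lemma valid_eqI: "ictx ch G = Some G' \<Longrightarrow> wf G' \<Longrightarrow> itm ch a = Some a' \<Longrightarrow> itm ch b = Some b' \<Longrightarrow>
    ity ch A = Some A' \<Longrightarrow> G' \<turnstile> A' \<Ztypecolon> HUniv i \<Longrightarrow> G' \<turnstile> a' \<Ztypecolon> A' \<Longrightarrow> G' \<turnstile> b' \<Ztypecolon> A' \<Longrightarrow>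
    G' \<turnstile> a' \<simeq> b' \<Ztypecolon> A' \<Longrightarrow> valid (JEq G a b A)"
  by (auto simp: deq_def)

lemma valid_tyI: "ictx ch G = Some G' \<Longrightarrow> wf G' \<Longrightarrow> ity ch A = Some A' \<Longrightarrow> ity_proof ch s A = Some p \<Longrightarrow>
    tyeq s G' A' p A' p \<Longrightarrow> valid (JTy s G A)"
  by auto

text \<open>Formation and congruence rules reduce to the \<open>tyeq\<close> lemmas. For a term rule
  the premises are interpreted over a common context and the rule of the target theory is applied; a
  beta rule needs in addition the typing of both sides, because \<open>deq\<close> carries
  it.\<close>

lemma mtt_valid: "mtt J \<Longrightarrow> valid J"
proof (induction rule: mtt.induct)

  \<comment> \<open>Structural rules\<close>
  case ctx_empty
  show ?case by (simp add: wf.intros)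
next
  case (ctx_ext s G A)
  then show ?case using tyeqD(3) by (fastforce intro: wf.intros)
next
  case (var G n)
  then obtain G' where G: "ictx ch G = Some G'" "wf G'" by auto
  \<comment> \<open>With an empty tail, \<open>ictx_append\<close> interprets the context entry by
    entry.\<close>
  from ictx_append[of G "[]" G'] G have l: "length G' = length G" and "ity ch (G ! n) = Some (G' ! n)"
    using var.hyps by auto
  then have "ity ch (mwkT (Suc n) (G ! n)) = Some (hwk (Suc n) (G' ! n))" by (intro i_ty_ren)
  moreover obtain i where "G' \<turnstile> hwk (Suc n) (G' ! n) \<Ztypecolon> HUniv i"
    using wf_nth[OF G(2), of n] l var.hyps by auto
  ultimately show ?case
    using G l hott.var[OF wf_ctx[OF G(2)], of n] var.hyps by auto
next
  case (subsume s G A s')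
  then show ?case using tyeq_subsort ity_proof_subsort by (fastforce simp del: ity_proof_simps)
next
  case (subsume_eq s G A B s')
  then show ?case using tyeq_subsort ity_proof_subsort by (fastforce simp del: ity_proof_simps)
next
  case (ty_refl s G A)
  then show ?case by auto
next
  case (ty_sym s G A B)
  then show ?case by (auto intro: tyeq_sym)
next
  case (ty_trans s G A B C)
  then show ?case by (auto intro: tyeq_trans)
next
  case (tm_refl G a A)
  then show ?case by (auto simp: deq_refl)
next
  case (tm_sym G a b A)
  then show ?case by (auto intro: deq_sym)
next
  case (tm_trans G a b A c)
  then show ?case by (auto intro: deq_trans)
next
  case (conv G a A s B)
  then obtain G' a' A' p B' q where G: "ictx ch G = Some G'" "wf G'" "itm ch a = Some a'" "ity ch B = Some B'"
    and a: "G' \<turnstile> a' \<Ztypecolon> A'" and eq: "tyeq s G' A' p B' q" by auto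
  show ?case
    using G tyeqD(4)[OF G(2) eq] hott.conv[OF a tyeqD(5)[OF G(2) eq]] by auto
next
  case (conv_eq G a b A s B)
  then obtain G' a' b' A' p B' q where G: "ictx ch G = Some G'" "wf G'" "itm ch a = Some a'"
    "itm ch b = Some b'" "ity ch B = Some B'"
    and a: "deq G' a' b' A'" and eq: "tyeq s G' A' p B' q" by auto
  show ?case
    using G tyeqD(4)[OF G(2) eq] deq_conv[OF a tyeqD(5)[OF G(2) eq]] by auto
next
  case (sub_ty s D G C as bs)
  then show ?case by (intro valid_sub_ty) auto
next
  case (sub_tm D G c C as bs)
  then show ?case by (intro valid_sub_tm) auto
next

  \<comment> \<open>Formation of types and its congruence\<close>
  case (N0_form G)
  then show ?case by (auto simp: bind_eq_Some_conv intro: tyeq_N0 wf_ctx)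
next
  case (N1_form G)
  then show ?case by (auto simp: bind_eq_Some_conv intro: tyeq_N1 wf_ctx)
next
  case (Props_form G)
  then show ?case by (auto simp: bind_eq_Some_conv intro: tyeq_Props wf_ctx)
next
  case (Bot_form G)
  then show ?case by (auto simp: bind_eq_Some_conv intro: tyeq_Bot wf_ctx)
next
  case (List_form G A)
  then show ?case by (auto simp: bind_eq_Some_conv intro: tyeq_List)
next
  case (List_form_eq G A A')
  then show ?case by (auto simp: bind_eq_Some_conv intro: tyeq_List)
next
  case (Sum_form G A B)
  then show ?case by (auto simp: bind_eq_Some_conv intro: tyeq_Sum)
next
  case (Sum_form_eq G A A' B B')
  then show ?case by (auto simp: bind_eq_Some_conv intro: tyeq_Sum)
next
  case (FunProps_form G A)
  then show ?case by (auto simp: bind_eq_Some_conv intro: tyeq_FunProps)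
next
  case (FunProps_form_eq G A A')
  then show ?case by (auto simp: bind_eq_Some_conv intro: tyeq_FunProps)
next
  case (Or_form s G A B)
  then show ?case by (auto simp: bind_eq_Some_conv ity_proof_def intro: tyeq_Or)
next
  case (Or_form_eq s G A A' B B')
  then show ?case by (auto simp: bind_eq_Some_conv ity_proof_def intro: tyeq_Or)
next
  case (And_form s G A B)
  then show ?case by (auto simp: bind_eq_Some_conv ity_proof_def intro: tyeq_And)
next
  case (And_form_eq s G A A' B B')
  then show ?case by (auto simp: bind_eq_Some_conv ity_proof_def intro: tyeq_And)
next
  case (Imp_form s G A B)
  then show ?case by (auto simp: bind_eq_Some_conv ity_proof_def intro: tyeq_Imp)
next
  case (Imp_form_eq s G A A' B B')
  then show ?case by (auto simp: bind_eq_Some_conv ity_proof_def intro: tyeq_Imp)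
next
  case (Sig_form s G A B)
  then show ?case by (auto simp: bind_eq_Some_conv intro: tyeq_Sig[where s = SSet, simplified] tyeq_Sig[where s = SCol, simplified])
next
  case (Sig_form_eq s G A A' B B')
  then show ?case by (auto simp: bind_eq_Some_conv intro: tyeq_Sig[where s = SSet, simplified] tyeq_Sig[where s = SCol, simplified])
next
  case (Pi_form G A B)
  then show ?case by (auto simp: bind_eq_Some_conv intro: tyeq_Pi[where s = SSet, simplified])
next
  case (Pi_form_eq G A A' B B')
  then show ?case by (auto simp: bind_eq_Some_conv intro: tyeq_Pi[where s = SSet, simplified])
next
  case (Ex_form s G A B)
  then show ?case by (auto simp: bind_eq_Some_conv ity_proof_def intro: tyeq_Ex)
next
  case (Ex_form_eq s G A A' B B')
  then show ?case by (auto simp: bind_eq_Some_conv ity_proof_def intro: tyeq_Ex)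
next
  case (All_form s G A B)
  then show ?case using tyeq_Pi[where s = s] by (fastforce simp: bind_eq_Some_conv ity_proof_def)
next
  case (All_form_eq s G A A' B B')
  then show ?case using tyeq_Pi[where s = s] by (fastforce simp: bind_eq_Some_conv ity_proof_def)
next
  case (Id_form s G A a b)
  then show ?case by (auto simp: bind_eq_Some_conv ity_proof_def deq_refl[symmetric] intro: tyeq_Id)
next
  case (Id_form_eq s G A A' a a' b b')
  then show ?case by (auto simp: bind_eq_Some_conv ity_proof_def intro: tyeq_Id)
next

  \<comment> \<open>Terms of the empty set, the singleton, lists and sums\<close>
  case (N0_elim G C d)
  from valid_ctx_tm[OF N0_elim.IH(2)] obtain G' where G: "ictx ch G = Some G'" "wf G'" by auto
  note c = wf_ctx[OF G(2)]
  have N: "ictx ch (TN0 # G) = Some (HEmpty # G')"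
    using G by simp
  from valid_ty[OF N0_elim.IH(1) N]
    obtain C' pC where C: "ity ch C = Some C'" "iprS ch C = Some pC"
      "HEmpty # G' \<turnstile> C' \<Ztypecolon> HUniv (Suc 0)" "HEmpty # G' \<turnstile> pC \<Ztypecolon> hisset C'"
    by (auto simp: hlevel_pred_def)
  from valid_tm[OF N0_elim.IH(2) G(1) ity.simps(1)]
    obtain d' where d: "itm ch d = Some d'" "G' \<turnstile> d' \<Ztypecolon> HEmpty" by auto
  show ?case
    by (rule valid_tmI[OF G _ _ inst_ty[OF C(3) d(2) c] hott.empty_elim[OF C(3) d(2)]])
      (use C d in \<open>simp_all add: i_inst\<close>)
next
  case (N1_intro G)
  then show ?case by (auto intro: hott.unit_intro hott.unit_form wf_ctx)
next
  case (N1_elim G C d c)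
  from valid_ctx_tm[OF N1_elim.IH(2)] obtain G' where G: "ictx ch G = Some G'" "wf G'" by auto
  note c = wf_ctx[OF G(2)]
  have N: "ictx ch (TN1 # G) = Some (HUnit # G')"
    using G by simp
  from valid_ty[OF N1_elim.IH(1) N]
    obtain C' pC where C: "ity ch C = Some C'" "iprS ch C = Some pC"
      "HUnit # G' \<turnstile> C' \<Ztypecolon> HUniv (Suc 0)" "HUnit # G' \<turnstile> pC \<Ztypecolon> hisset C'"
    by (auto simp: hlevel_pred_def)
  have CS: "ity ch (minstT C MStar) = Some (hinst C' HStar)"
    using C by (simp add: i_inst)
  from valid_tm[OF N1_elim.IH(2) G(1) ity.simps(2)]
    obtain d' where d: "itm ch d = Some d'" "G' \<turnstile> d' \<Ztypecolon> HUnit" by auto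
  from valid_tm[OF N1_elim.IH(3) G(1) CS]
    obtain c' where e: "itm ch c = Some c'" "G' \<turnstile> c' \<Ztypecolon> hinst C' HStar" by auto
  show ?case
    by (rule valid_tmI[OF G _ _ inst_ty[OF C(3) d(2) c] hott.unit_elim[OF C(3) e(2) d(2)]])
      (use C d e in \<open>simp_all add: i_inst\<close>)
next
  case (N1_beta G C c)
  from valid_ctx_tm[OF N1_beta.IH(2)] obtain G' where G: "ictx ch G = Some G'" "wf G'" by auto
  note c = wf_ctx[OF G(2)]
  have N: "ictx ch (TN1 # G) = Some (HUnit # G')"
    using G by simp
  from valid_ty[OF N1_beta.IH(1) N]
    obtain C' pC where C: "ity ch C = Some C'" "iprS ch C = Some pC"
      "HUnit # G' \<turnstile> C' \<Ztypecolon> HUniv (Suc 0)" "HUnit # G' \<turnstile> pC \<Ztypecolon> hisset C'"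
    by (auto simp: hlevel_pred_def)
  have CS: "ity ch (minstT C MStar) = Some (hinst C' HStar)"
    using C by (simp add: i_inst)
  from valid_tm[OF N1_beta.IH(2) G(1) CS]
    obtain c' where e: "itm ch c = Some c'" "G' \<turnstile> c' \<Ztypecolon> hinst C' HStar" by auto
  show ?case
    by (rule valid_eqI[OF G _ _ _ inst_ty[OF C(3) hott.unit_intro[OF c] c]
          hott.unit_elim[OF C(3) e(2) hott.unit_intro[OF c]]
        e(2) hott.unit_beta[OF C(3) e(2)]])
      (use C e in \<open>simp_all add: i_inst\<close>)
next
  case (List_nil G A)
  from valid_ctx[OF List_nil.IH(1)] obtain G' where G: "ictx ch G = Some G'" "wf G'" by auto
  note c = wf_ctx[OF G(2)]
  from valid_ty[OF List_nil.IH(1) G(1)]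
    obtain A' pA where A: "ity ch A = Some A'" "iprS ch A = Some pA"
      "G' \<turnstile> A' \<Ztypecolon> HUniv (Suc 0)" "G' \<turnstile> pA \<Ztypecolon> hisset A'"
    by (auto simp: hlevel_pred_def)
  show ?case
    by (rule valid_tmI[OF G _ _ hott.list_form[OF A(3)] hott.list_nil[OF A(3)]])
      (use A in \<open>simp_all add: i_inst\<close>)
next
  case (List_cons G A l a)
  from valid_ctx[OF List_cons.IH(1)] obtain G' where G: "ictx ch G = Some G'" "wf G'" by auto
  note c = wf_ctx[OF G(2)]
  from valid_ty[OF List_cons.IH(1) G(1)]
    obtain A' pA where A: "ity ch A = Some A'" "iprS ch A = Some pA"
      "G' \<turnstile> A' \<Ztypecolon> HUniv (Suc 0)" "G' \<turnstile> pA \<Ztypecolon> hisset A'"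
    by (auto simp: hlevel_pred_def)
  have L: "ity ch (TList A) = Some (HList A')"
    using A by simp
  from valid_tm[OF List_cons.IH(2) G(1) L]
    obtain l' where l: "itm ch l = Some l'" "G' \<turnstile> l' \<Ztypecolon> HList A'" by auto
  from valid_tm[OF List_cons.IH(3) G(1) A(1)]
    obtain a' where a: "itm ch a = Some a'" "G' \<turnstile> a' \<Ztypecolon> A'" by auto
  show ?case
    by (rule valid_tmI[OF G _ _ hott.list_form[OF A(3)] hott.list_cons[OF l(2) a(2)]])
      (use A l a in \<open>simp_all add: i_inst\<close>)
next
  case (List_elim G A C d n c)
  from valid_ctx[OF List_elim.IH(1)] obtain G' where G: "ictx ch G = Some G'" "wf G'" by auto
  note c = wf_ctx[OF G(2)]
  from valid_ty[OF List_elim.IH(1) G(1)]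
    obtain A' pA where A: "ity ch A = Some A'" "iprS ch A = Some pA"
      "G' \<turnstile> A' \<Ztypecolon> HUniv (Suc 0)" "G' \<turnstile> pA \<Ztypecolon> hisset A'"
    by (auto simp: hlevel_pred_def)
  have L: "ity ch (TList A) = Some (HList A')"
    using A by simp
  from valid_ty[OF List_elim.IH(2) ictx_Cons[OF G(1) L]]
    obtain C' pC where C: "ity ch C = Some C'" "iprS ch C = Some pC"
      "HList A' # G' \<turnstile> C' \<Ztypecolon> HUniv (Suc 0)" "HList A' # G' \<turnstile> pC \<Ztypecolon> hisset C'"
    by (auto simp: hlevel_pred_def)
  have CN: "ity ch (minstT C MNil) = Some (hinst C' HNil)"
    using C by (simp add: i_inst)
  have C2: "ity ch (matT 2 (MVar 1) C) = Some (hat 2 (HVar 1) C')"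
    by (rule i_inst(3)[OF _ C(1)]) simp
  have C3: "ity ch (matT 3 (MCons (MVar 2) (MVar 1)) C) = Some (hat 3 (HCons (HVar 2) (HVar 1)) C')"
    by (rule i_inst(3)[OF _ C(1)]) simp
  from valid_tm[OF List_elim.IH(3) G(1) L]
    obtain d' where d: "itm ch d = Some d'" "G' \<turnstile> d' \<Ztypecolon> HList A'" by auto
  from valid_tm[OF List_elim.IH(4) G(1) CN]
    obtain n' where n: "itm ch n = Some n'" "G' \<turnstile> n' \<Ztypecolon> hinst C' HNil" by auto
  from valid_tm[OF List_elim.IH(5) ictx_Cons[OF ictx_Cons[OF ictx_Cons[OF G(1) L] i_ty_ren[OF A(1)]] C2] C3]
    obtain c' where e: "itm ch c = Some c'" "hat 2 (HVar 1) C' # hwk 1 A' # HList A' # G' \<turnstile> c' \<Ztypecolon> hat 3 (HCons (HVar 2) (HVar 1)) C'" by auto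
  show ?case
    by (rule valid_tmI[OF G _ _ inst_ty[OF C(3) d(2) c] hott.list_elim[OF C(3) n(2) e(2) d(2)]])
      (use C d n e in \<open>simp_all add: i_inst\<close>)
next
  case (List_beta_nil G A C n c)
  from valid_ctx[OF List_beta_nil.IH(1)] obtain G' where G: "ictx ch G = Some G'" "wf G'" by auto
  note c = wf_ctx[OF G(2)]
  from valid_ty[OF List_beta_nil.IH(1) G(1)]
    obtain A' pA where A: "ity ch A = Some A'" "iprS ch A = Some pA"
      "G' \<turnstile> A' \<Ztypecolon> HUniv (Suc 0)" "G' \<turnstile> pA \<Ztypecolon> hisset A'"
    by (auto simp: hlevel_pred_def)
  have L: "ity ch (TList A) = Some (HList A')"
    using A by simp
  from valid_ty[OF List_beta_nil.IH(2) ictx_Cons[OF G(1) L]]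
    obtain C' pC where C: "ity ch C = Some C'" "iprS ch C = Some pC"
      "HList A' # G' \<turnstile> C' \<Ztypecolon> HUniv (Suc 0)" "HList A' # G' \<turnstile> pC \<Ztypecolon> hisset C'"
    by (auto simp: hlevel_pred_def)
  have CN: "ity ch (minstT C MNil) = Some (hinst C' HNil)"
    using C by (simp add: i_inst)
  have C2: "ity ch (matT 2 (MVar 1) C) = Some (hat 2 (HVar 1) C')"
    by (rule i_inst(3)[OF _ C(1)]) simp
  have C3: "ity ch (matT 3 (MCons (MVar 2) (MVar 1)) C) = Some (hat 3 (HCons (HVar 2) (HVar 1)) C')"
    by (rule i_inst(3)[OF _ C(1)]) simp
  from valid_tm[OF List_beta_nil.IH(3) G(1) CN]
    obtain n' where n: "itm ch n = Some n'" "G' \<turnstile> n' \<Ztypecolon> hinst C' HNil" by auto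
  from valid_tm[OF List_beta_nil.IH(4) ictx_Cons[OF ictx_Cons[OF ictx_Cons[OF G(1) L] i_ty_ren[OF A(1)]] C2] C3]
    obtain c' where e: "itm ch c = Some c'" "hat 2 (HVar 1) C' # hwk 1 A' # HList A' # G' \<turnstile> c' \<Ztypecolon> hat 3 (HCons (HVar 2) (HVar 1)) C'" by auto
  note nil = hott.list_nil[OF A(3)]
  show ?case
    by (rule valid_eqI[OF G _ _ _ inst_ty[OF C(3) nil c] hott.list_elim[OF C(3) n(2) e(2) nil]
        n(2) hott.list_beta_nil[OF C(3) n(2) e(2)]])
      (use C n e in \<open>simp_all add: i_inst\<close>)
next
  case (List_beta_cons G A C l a n c)
  from valid_ctx[OF List_beta_cons.IH(1)] obtain G' where G: "ictx ch G = Some G'" "wf G'" by auto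
  note c = wf_ctx[OF G(2)]
  from valid_ty[OF List_beta_cons.IH(1) G(1)]
    obtain A' pA where A: "ity ch A = Some A'" "iprS ch A = Some pA"
      "G' \<turnstile> A' \<Ztypecolon> HUniv (Suc 0)" "G' \<turnstile> pA \<Ztypecolon> hisset A'"
    by (auto simp: hlevel_pred_def)
  have L: "ity ch (TList A) = Some (HList A')"
    using A by simp
  from valid_ty[OF List_beta_cons.IH(2) ictx_Cons[OF G(1) L]]
    obtain C' pC where C: "ity ch C = Some C'" "iprS ch C = Some pC"
      "HList A' # G' \<turnstile> C' \<Ztypecolon> HUniv (Suc 0)" "HList A' # G' \<turnstile> pC \<Ztypecolon> hisset C'"
    by (auto simp: hlevel_pred_def)
  have CN: "ity ch (minstT C MNil) = Some (hinst C' HNil)"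
    using C by (simp add: i_inst)
  have C2: "ity ch (matT 2 (MVar 1) C) = Some (hat 2 (HVar 1) C')"
    by (rule i_inst(3)[OF _ C(1)]) simp
  have C3: "ity ch (matT 3 (MCons (MVar 2) (MVar 1)) C) = Some (hat 3 (HCons (HVar 2) (HVar 1)) C')"
    by (rule i_inst(3)[OF _ C(1)]) simp
  from valid_tm[OF List_beta_cons.IH(3) G(1) L]
    obtain l' where l: "itm ch l = Some l'" "G' \<turnstile> l' \<Ztypecolon> HList A'" by auto
  from valid_tm[OF List_beta_cons.IH(4) G(1) A(1)]
    obtain a' where a: "itm ch a = Some a'" "G' \<turnstile> a' \<Ztypecolon> A'" by auto
  from valid_tm[OF List_beta_cons.IH(5) G(1) CN]
    obtain n' where n: "itm ch n = Some n'" "G' \<turnstile> n' \<Ztypecolon> hinst C' HNil" by auto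
  from valid_tm[OF List_beta_cons.IH(6) ictx_Cons[OF ictx_Cons[OF ictx_Cons[OF G(1) L] i_ty_ren[OF A(1)]] C2] C3]
    obtain c' where e: "itm ch c = Some c'" "hat 2 (HVar 1) C' # hwk 1 A' # HList A' # G' \<turnstile> c' \<Ztypecolon> hat 3 (HCons (HVar 2) (HVar 1)) C'" by auto
  note cons = hott.list_cons[OF l(2) a(2)]
  \<comment> \<open>The contractum substitutes the tail, the head and the recursive call into the
    step. Along this substitution the type of the step, formed over three bound variables, becomes
    \<open>C'\<close> at \<open>HCons l' a'\<close>.\<close>
  have "G' \<turnstile> hsub (HIndList l' n' c' \<rhd> a' \<rhd> l' \<rhd> HVar) c' \<Ztypecolon>
      hsub (HIndList l' n' c' \<rhd> a' \<rhd> l' \<rhd> HVar) (hat 3 (HCons (HVar 2) (HVar 1)) C')"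
    by (rule sub_tm[OF e(2) c], intro sub_ok_scons sub_ok_id c)
      (use hott.list_elim[OF C(3) n(2) e(2) l(2)] l(2) a(2) in \<open>simp_all add: sub_simps\<close>)
  then have r: "G' \<turnstile> hsub (HIndList l' n' c' \<rhd> a' \<rhd> l' \<rhd> HVar) c' \<Ztypecolon> hinst C' (HCons l' a')"
    by (simp add: sub_simps eval_nat_numeral)
  show ?case
    by (rule valid_eqI[OF G _ _ _ inst_ty[OF C(3) cons c] hott.list_elim[OF C(3) n(2) e(2) cons]
        r hott.list_beta_cons[OF C(3) n(2) e(2) l(2) a(2)]])
      (use C l a n e in \<open>simp_all add: i_inst\<close>)
next
  case (Sum_inl G A B a)
  from valid_ctx[OF Sum_inl.IH(1)] obtain G' where G: "ictx ch G = Some G'" "wf G'" by auto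
  note c = wf_ctx[OF G(2)]
  from valid_ty[OF Sum_inl.IH(1) G(1)]
    obtain A' pA where A: "ity ch A = Some A'" "iprS ch A = Some pA"
      "G' \<turnstile> A' \<Ztypecolon> HUniv (Suc 0)" "G' \<turnstile> pA \<Ztypecolon> hisset A'"
    by (auto simp: hlevel_pred_def)
  from valid_ty[OF Sum_inl.IH(2) G(1)]
    obtain B' pB where B: "ity ch B = Some B'" "iprS ch B = Some pB"
      "G' \<turnstile> B' \<Ztypecolon> HUniv (Suc 0)" "G' \<turnstile> pB \<Ztypecolon> hisset B'"
    by (auto simp: hlevel_pred_def)
  from valid_tm[OF Sum_inl.IH(3) G(1) A(1)]
    obtain a' where t: "itm ch a = Some a'" "G' \<turnstile> a' \<Ztypecolon> A'" by auto
  show ?case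
    by (rule valid_tmI[OF G _ _ hott.sum_form[OF A(3) B(3)] hott.sum_inl[OF B(3) t(2)]])
      (use A B t in \<open>simp_all add: i_inst\<close>)
next
  case (Sum_inr G A B b)
  from valid_ctx[OF Sum_inr.IH(1)] obtain G' where G: "ictx ch G = Some G'" "wf G'" by auto
  note c = wf_ctx[OF G(2)]
  from valid_ty[OF Sum_inr.IH(1) G(1)]
    obtain A' pA where A: "ity ch A = Some A'" "iprS ch A = Some pA"
      "G' \<turnstile> A' \<Ztypecolon> HUniv (Suc 0)" "G' \<turnstile> pA \<Ztypecolon> hisset A'"
    by (auto simp: hlevel_pred_def)
  from valid_ty[OF Sum_inr.IH(2) G(1)]
    obtain B' pB where B: "ity ch B = Some B'" "iprS ch B = Some pB"
      "G' \<turnstile> B' \<Ztypecolon> HUniv (Suc 0)" "G' \<turnstile> pB \<Ztypecolon> hisset B'"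
    by (auto simp: hlevel_pred_def)
  from valid_tm[OF Sum_inr.IH(3) G(1) B(1)]
    obtain b' where t: "itm ch b = Some b'" "G' \<turnstile> b' \<Ztypecolon> B'" by auto
  show ?case
    by (rule valid_tmI[OF G _ _ hott.sum_form[OF A(3) B(3)] hott.sum_inr[OF A(3) t(2)]])
      (use A B t in \<open>simp_all add: i_inst\<close>)
next
  case (Sum_elim G A B C d l r)
  from valid_ctx[OF Sum_elim.IH(1)] obtain G' where G: "ictx ch G = Some G'" "wf G'" by auto
  note c = wf_ctx[OF G(2)]
  from valid_ty[OF Sum_elim.IH(1) G(1)]
    obtain A' pA where A: "ity ch A = Some A'" "iprS ch A = Some pA"
      "G' \<turnstile> A' \<Ztypecolon> HUniv (Suc 0)" "G' \<turnstile> pA \<Ztypecolon> hisset A'"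
    by (auto simp: hlevel_pred_def)
  from valid_ty[OF Sum_elim.IH(2) G(1)]
    obtain B' pB where B: "ity ch B = Some B'" "iprS ch B = Some pB"
      "G' \<turnstile> B' \<Ztypecolon> HUniv (Suc 0)" "G' \<turnstile> pB \<Ztypecolon> hisset B'"
    by (auto simp: hlevel_pred_def)
  have S: "ity ch (TSum A B) = Some (HSum A' B')"
    using A B by simp
  from valid_ty[OF Sum_elim.IH(3) ictx_Cons[OF G(1) S]]
    obtain C' pC where C: "ity ch C = Some C'" "iprS ch C = Some pC"
      "HSum A' B' # G' \<turnstile> C' \<Ztypecolon> HUniv (Suc 0)" "HSum A' B' # G' \<turnstile> pC \<Ztypecolon> hisset C'"
    by (auto simp: hlevel_pred_def)
  have Cl: "ity ch (matT 1 (MInl (MVar 0)) C) = Some (hat 1 (HInl (HVar 0)) C')"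
    by (rule i_inst(3)[OF _ C(1)]) simp
  have Cr: "ity ch (matT 1 (MInr (MVar 0)) C) = Some (hat 1 (HInr (HVar 0)) C')"
    by (rule i_inst(3)[OF _ C(1)]) simp
  from valid_tm[OF Sum_elim.IH(4) G(1) S]
    obtain d' where d: "itm ch d = Some d'" "G' \<turnstile> d' \<Ztypecolon> HSum A' B'" by auto
  from valid_tm[OF Sum_elim.IH(5) ictx_Cons[OF G(1) A(1)] Cl]
    obtain l' where l: "itm ch l = Some l'" "A' # G' \<turnstile> l' \<Ztypecolon> hat 1 (HInl (HVar 0)) C'" by auto
  from valid_tm[OF Sum_elim.IH(6) ictx_Cons[OF G(1) B(1)] Cr]
    obtain r' where r: "itm ch r = Some r'" "B' # G' \<turnstile> r' \<Ztypecolon> hat 1 (HInr (HVar 0)) C'" by auto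
  show ?case
    by (rule valid_tmI[OF G _ _ inst_ty[OF C(3) d(2) c] hott.sum_elim[OF C(3) l(2) r(2) d(2)]])
      (use C d l r in \<open>simp_all add: i_inst\<close>)
next
  case (Sum_beta_inl G A B C a l r)
  from valid_ctx[OF Sum_beta_inl.IH(1)] obtain G' where G: "ictx ch G = Some G'" "wf G'" by auto
  note c = wf_ctx[OF G(2)]
  from valid_ty[OF Sum_beta_inl.IH(1) G(1)]
    obtain A' pA where A: "ity ch A = Some A'" "iprS ch A = Some pA"
      "G' \<turnstile> A' \<Ztypecolon> HUniv (Suc 0)" "G' \<turnstile> pA \<Ztypecolon> hisset A'"
    by (auto simp: hlevel_pred_def)
  from valid_ty[OF Sum_beta_inl.IH(2) G(1)]
    obtain B' pB where B: "ity ch B = Some B'" "iprS ch B = Some pB"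
      "G' \<turnstile> B' \<Ztypecolon> HUniv (Suc 0)" "G' \<turnstile> pB \<Ztypecolon> hisset B'"
    by (auto simp: hlevel_pred_def)
  have S: "ity ch (TSum A B) = Some (HSum A' B')"
    using A B by simp
  from valid_ty[OF Sum_beta_inl.IH(3) ictx_Cons[OF G(1) S]]
    obtain C' pC where C: "ity ch C = Some C'" "iprS ch C = Some pC"
      "HSum A' B' # G' \<turnstile> C' \<Ztypecolon> HUniv (Suc 0)" "HSum A' B' # G' \<turnstile> pC \<Ztypecolon> hisset C'"
    by (auto simp: hlevel_pred_def)
  have Cl: "ity ch (matT 1 (MInl (MVar 0)) C) = Some (hat 1 (HInl (HVar 0)) C')"
    by (rule i_inst(3)[OF _ C(1)]) simp
  have Cr: "ity ch (matT 1 (MInr (MVar 0)) C) = Some (hat 1 (HInr (HVar 0)) C')"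
    by (rule i_inst(3)[OF _ C(1)]) simp
  from valid_tm[OF Sum_beta_inl.IH(4) G(1) A(1)]
    obtain a' where d: "itm ch a = Some a'" "G' \<turnstile> a' \<Ztypecolon> A'" by auto
  from valid_tm[OF Sum_beta_inl.IH(5) ictx_Cons[OF G(1) A(1)] Cl]
    obtain l' where l: "itm ch l = Some l'" "A' # G' \<turnstile> l' \<Ztypecolon> hat 1 (HInl (HVar 0)) C'" by auto
  from valid_tm[OF Sum_beta_inl.IH(6) ictx_Cons[OF G(1) B(1)] Cr]
    obtain r' where r: "itm ch r = Some r'" "B' # G' \<turnstile> r' \<Ztypecolon> hat 1 (HInr (HVar 0)) C'" by auto
  note i = hott.sum_inl[OF B(3) d(2)]
  have r2: "G' \<turnstile> hinst l' a' \<Ztypecolon> hinst C' (HInl a')"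
    using inst_tm[OF l(2) d(2) c] by (simp add: sub_simps)
  show ?case
    by (rule valid_eqI[OF G _ _ _ inst_ty[OF C(3) i c] hott.sum_elim[OF C(3) l(2) r(2) i]
        r2 hott.sum_beta_inl[OF C(3) l(2) r(2) d(2)]])
      (use C d l r in \<open>simp_all add: i_inst\<close>)
next
  case (Sum_beta_inr G A B C b l r)
  from valid_ctx[OF Sum_beta_inr.IH(1)] obtain G' where G: "ictx ch G = Some G'" "wf G'" by auto
  note c = wf_ctx[OF G(2)]
  from valid_ty[OF Sum_beta_inr.IH(1) G(1)]
    obtain A' pA where A: "ity ch A = Some A'" "iprS ch A = Some pA"
      "G' \<turnstile> A' \<Ztypecolon> HUniv (Suc 0)" "G' \<turnstile> pA \<Ztypecolon> hisset A'"
    by (auto simp: hlevel_pred_def)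
  from valid_ty[OF Sum_beta_inr.IH(2) G(1)]
    obtain B' pB where B: "ity ch B = Some B'" "iprS ch B = Some pB"
      "G' \<turnstile> B' \<Ztypecolon> HUniv (Suc 0)" "G' \<turnstile> pB \<Ztypecolon> hisset B'"
    by (auto simp: hlevel_pred_def)
  have S: "ity ch (TSum A B) = Some (HSum A' B')"
    using A B by simp
  from valid_ty[OF Sum_beta_inr.IH(3) ictx_Cons[OF G(1) S]]
    obtain C' pC where C: "ity ch C = Some C'" "iprS ch C = Some pC"
      "HSum A' B' # G' \<turnstile> C' \<Ztypecolon> HUniv (Suc 0)" "HSum A' B' # G' \<turnstile> pC \<Ztypecolon> hisset C'"
    by (auto simp: hlevel_pred_def)
  have Cl: "ity ch (matT 1 (MInl (MVar 0)) C) = Some (hat 1 (HInl (HVar 0)) C')"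
    by (rule i_inst(3)[OF _ C(1)]) simp
  have Cr: "ity ch (matT 1 (MInr (MVar 0)) C) = Some (hat 1 (HInr (HVar 0)) C')"
    by (rule i_inst(3)[OF _ C(1)]) simp
  from valid_tm[OF Sum_beta_inr.IH(4) G(1) B(1)]
    obtain b' where d: "itm ch b = Some b'" "G' \<turnstile> b' \<Ztypecolon> B'" by auto
  from valid_tm[OF Sum_beta_inr.IH(5) ictx_Cons[OF G(1) A(1)] Cl]
    obtain l' where l: "itm ch l = Some l'" "A' # G' \<turnstile> l' \<Ztypecolon> hat 1 (HInl (HVar 0)) C'" by auto
  from valid_tm[OF Sum_beta_inr.IH(6) ictx_Cons[OF G(1) B(1)] Cr]
    obtain r' where r: "itm ch r = Some r'" "B' # G' \<turnstile> r' \<Ztypecolon> hat 1 (HInr (HVar 0)) C'" by auto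
  note i = hott.sum_inr[OF A(3) d(2)]
  have r2: "G' \<turnstile> hinst r' b' \<Ztypecolon> hinst C' (HInr b')"
    using inst_tm[OF r(2) d(2) c] by (simp add: sub_simps)
  show ?case
    by (rule valid_eqI[OF G _ _ _ inst_ty[OF C(3) i c] hott.sum_elim[OF C(3) l(2) r(2) i]
        r2 hott.sum_beta_inr[OF C(3) l(2) r(2) d(2)]])
      (use C d l r in \<open>simp_all add: i_inst\<close>)
next

  \<comment> \<open>Terms of dependent sums\<close>
  case (Sig_intro G A B a b)
  from valid_ctx[OF Sig_intro.IH(1)] obtain G' where G: "ictx ch G = Some G'" "wf G'" by auto
  note c = wf_ctx[OF G(2)]
  from valid_ty[OF Sig_intro.IH(1) G(1)]
    obtain A' pA where A: "ity ch A = Some A'" "iprS ch A = Some pA"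
      "G' \<turnstile> A' \<Ztypecolon> HUniv (Suc 0)" "G' \<turnstile> pA \<Ztypecolon> hisset A'"
    by (auto simp: hlevel_pred_def)
  from valid_ty[OF Sig_intro.IH(2) ictx_Cons[OF G(1) A(1)]]
    obtain B' pB where B: "ity ch B = Some B'" "iprS ch B = Some pB"
      "A' # G' \<turnstile> B' \<Ztypecolon> HUniv (Suc 0)" "A' # G' \<turnstile> pB \<Ztypecolon> hisset B'"
    by (auto simp: hlevel_pred_def)
  from valid_tm[OF Sig_intro.IH(3) G(1) A(1)]
    obtain a' where a: "itm ch a = Some a'" "G' \<turnstile> a' \<Ztypecolon> A'" by auto
  from valid_tm[OF Sig_intro.IH(4) G(1) i_inst(1)[OF a(1) B(1)]]
    obtain b' where b: "itm ch b = Some b'" "G' \<turnstile> b' \<Ztypecolon> hinst B' a'" by auto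
  show ?case
    by (rule valid_tmI[OF G _ _ hott.sig_form[OF A(3) B(3)] hott.sig_intro[OF B(3) a(2) b(2)]])
      (use A B a b in \<open>simp_all add: i_inst\<close>)
next
  case (Sig_elim G A B C d c)
  from valid_ctx[OF Sig_elim.IH(1)] obtain G' where G: "ictx ch G = Some G'" "wf G'" by auto
  note c = wf_ctx[OF G(2)]
  from valid_ty[OF Sig_elim.IH(1) G(1)]
    obtain A' pA where A: "ity ch A = Some A'" "iprS ch A = Some pA"
      "G' \<turnstile> A' \<Ztypecolon> HUniv (Suc 0)" "G' \<turnstile> pA \<Ztypecolon> hisset A'"
    by (auto simp: hlevel_pred_def)
  from valid_ty[OF Sig_elim.IH(2) ictx_Cons[OF G(1) A(1)]]
    obtain B' pB where B: "ity ch B = Some B'" "iprS ch B = Some pB"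
      "A' # G' \<turnstile> B' \<Ztypecolon> HUniv (Suc 0)" "A' # G' \<turnstile> pB \<Ztypecolon> hisset B'"
    by (auto simp: hlevel_pred_def)
  have S: "ity ch (TSig A B) = Some (HSig A' B')"
    using A B by simp
  from valid_ty[OF Sig_elim.IH(3) ictx_Cons[OF G(1) S]]
    obtain C' pC where C: "ity ch C = Some C'" "iprS ch C = Some pC"
      "HSig A' B' # G' \<turnstile> C' \<Ztypecolon> HUniv (Suc 0)" "HSig A' B' # G' \<turnstile> pC \<Ztypecolon> hisset C'"
    by (auto simp: hlevel_pred_def)
  have C2: "ity ch (matT 2 (MPair (MVar 1) (MVar 0)) C) = Some (hat 2 (HPair (HVar 1) (HVar 0)) C')"
    by (rule i_inst(3)[OF _ C(1)]) simp
  from valid_tm[OF Sig_elim.IH(4) G(1) S]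
    obtain d' where d: "itm ch d = Some d'" "G' \<turnstile> d' \<Ztypecolon> HSig A' B'" by auto
  from valid_tm[OF Sig_elim.IH(5) ictx_Cons[OF ictx_Cons[OF G(1) A(1)] B(1)] C2]
    obtain c' where e: "itm ch c = Some c'" "B' # A' # G' \<turnstile> c' \<Ztypecolon> hat 2 (HPair (HVar 1) (HVar 0)) C'" by auto
  show ?case
    by (rule valid_tmI[OF G _ _ inst_ty[OF C(3) d(2) c] hott.sig_elim[OF C(3) e(2) d(2)]])
      (use C d e in \<open>simp_all add: i_inst\<close>)
next
  case (Sig_beta G A B C a b c)
  from valid_ctx[OF Sig_beta.IH(1)] obtain G' where G: "ictx ch G = Some G'" "wf G'" by auto
  note c = wf_ctx[OF G(2)]
  from valid_ty[OF Sig_beta.IH(1) G(1)]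
    obtain A' pA where A: "ity ch A = Some A'" "iprS ch A = Some pA"
      "G' \<turnstile> A' \<Ztypecolon> HUniv (Suc 0)" "G' \<turnstile> pA \<Ztypecolon> hisset A'"
    by (auto simp: hlevel_pred_def)
  from valid_ty[OF Sig_beta.IH(2) ictx_Cons[OF G(1) A(1)]]
    obtain B' pB where B: "ity ch B = Some B'" "iprS ch B = Some pB"
      "A' # G' \<turnstile> B' \<Ztypecolon> HUniv (Suc 0)" "A' # G' \<turnstile> pB \<Ztypecolon> hisset B'"
    by (auto simp: hlevel_pred_def)
  have S: "ity ch (TSig A B) = Some (HSig A' B')"
    using A B by simp
  from valid_ty[OF Sig_beta.IH(3) ictx_Cons[OF G(1) S]]
    obtain C' pC where C: "ity ch C = Some C'" "iprS ch C = Some pC"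
      "HSig A' B' # G' \<turnstile> C' \<Ztypecolon> HUniv (Suc 0)" "HSig A' B' # G' \<turnstile> pC \<Ztypecolon> hisset C'"
    by (auto simp: hlevel_pred_def)
  have C2: "ity ch (matT 2 (MPair (MVar 1) (MVar 0)) C) = Some (hat 2 (HPair (HVar 1) (HVar 0)) C')"
    by (rule i_inst(3)[OF _ C(1)]) simp
  from valid_tm[OF Sig_beta.IH(4) G(1) A(1)]
    obtain a' where a: "itm ch a = Some a'" "G' \<turnstile> a' \<Ztypecolon> A'" by auto
  from valid_tm[OF Sig_beta.IH(5) G(1) i_inst(1)[OF a(1) B(1)]]
    obtain b' where b: "itm ch b = Some b'" "G' \<turnstile> b' \<Ztypecolon> hinst B' a'" by auto
  from valid_tm[OF Sig_beta.IH(6) ictx_Cons[OF ictx_Cons[OF G(1) A(1)] B(1)] C2]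
    obtain c' where e: "itm ch c = Some c'" "B' # A' # G' \<turnstile> c' \<Ztypecolon> hat 2 (HPair (HVar 1) (HVar 0)) C'" by auto
  note p = hott.sig_intro[OF B(3) a(2) b(2)]
  have "G' \<turnstile> hsub (b' \<rhd> a' \<rhd> HVar) c' \<Ztypecolon> hsub (b' \<rhd> a' \<rhd> HVar) (hat 2 (HPair (HVar 1) (HVar 0)) C')"
    by (rule sub_tm[OF e(2) c], intro sub_ok_scons sub_ok_id c) (use a(2) b(2) in simp_all)
  then have r: "G' \<turnstile> hsub (b' \<rhd> a' \<rhd> HVar) c' \<Ztypecolon> hinst C' (HPair a' b')"
    by (simp add: sub_simps)
  show ?case
    by (rule valid_eqI[OF G _ _ _ inst_ty[OF C(3) p c] hott.sig_elim[OF C(3) e(2) p]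
        r hott.sig_beta[OF C(3) e(2) a(2) b(2)]])
      (use C a b e in \<open>simp_all add: i_inst\<close>)
next

  \<comment> \<open>Abstraction and application for products, universal quantification and small
    propositional functions\<close>
  case (Pi_intro G A B b)
  from valid_ctx[OF Pi_intro.IH(1)] obtain G' where G: "ictx ch G = Some G'" "wf G'" by auto
  note c = wf_ctx[OF G(2)]
  from valid_ty[OF Pi_intro.IH(1) G(1)]
    obtain A' pA where A: "ity ch A = Some A'" "iprS ch A = Some pA"
      "G' \<turnstile> A' \<Ztypecolon> HUniv (Suc 0)" "G' \<turnstile> pA \<Ztypecolon> hisset A'"
    by (auto simp: hlevel_pred_def)
  from valid_ty[OF Pi_intro.IH(2) ictx_Cons[OF G(1) A(1)]]
    obtain B' pB where B: "ity ch B = Some B'" "iprS ch B = Some pB"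
      "A' # G' \<turnstile> B' \<Ztypecolon> HUniv (Suc 0)" "A' # G' \<turnstile> pB \<Ztypecolon> hisset B'"
    by (auto simp: hlevel_pred_def)
  from valid_tm[OF Pi_intro.IH(3) ictx_Cons[OF G(1) A(1)] B(1)]
    obtain b' where b: "itm ch b = Some b'" "A' # G' \<turnstile> b' \<Ztypecolon> B'" by auto
  show ?case
    by (rule valid_tmI[OF G _ _ hott.pi_form[OF A(3) B(3)] hott.pi_intro[OF b(2)]])
      (use A B b in \<open>simp_all add: i_inst\<close>)
next
  case (Pi_elim G A B f a)
  from valid_ctx[OF Pi_elim.IH(1)] obtain G' where G: "ictx ch G = Some G'" "wf G'" by auto
  note c = wf_ctx[OF G(2)]
  from valid_ty[OF Pi_elim.IH(1) G(1)]
    obtain A' pA where A: "ity ch A = Some A'" "iprS ch A = Some pA"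
      "G' \<turnstile> A' \<Ztypecolon> HUniv (Suc 0)" "G' \<turnstile> pA \<Ztypecolon> hisset A'"
    by (auto simp: hlevel_pred_def)
  from valid_ty[OF Pi_elim.IH(2) ictx_Cons[OF G(1) A(1)]]
    obtain B' pB where B: "ity ch B = Some B'" "iprS ch B = Some pB"
      "A' # G' \<turnstile> B' \<Ztypecolon> HUniv (Suc 0)" "A' # G' \<turnstile> pB \<Ztypecolon> hisset B'"
    by (auto simp: hlevel_pred_def)
  have S: "ity ch (TPi A B) = Some (HPi A' B')"
    using A B by simp
  from valid_tm[OF Pi_elim.IH(3) G(1) S]
    obtain f' where f: "itm ch f = Some f'" "G' \<turnstile> f' \<Ztypecolon> HPi A' B'" by auto
  from valid_tm[OF Pi_elim.IH(4) G(1) A(1)]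
    obtain a' where a: "itm ch a = Some a'" "G' \<turnstile> a' \<Ztypecolon> A'" by auto
  show ?case
    by (rule valid_tmI[OF G _ _ inst_ty[OF B(3) a(2) c] hott.pi_elim[OF f(2) a(2)]])
      (use B f a in \<open>simp_all add: i_inst\<close>)
next
  case (Pi_beta G A B b a)
  from valid_ctx[OF Pi_beta.IH(1)] obtain G' where G: "ictx ch G = Some G'" "wf G'" by auto
  note c = wf_ctx[OF G(2)]
  from valid_ty[OF Pi_beta.IH(1) G(1)]
    obtain A' pA where A: "ity ch A = Some A'" "iprS ch A = Some pA"
      "G' \<turnstile> A' \<Ztypecolon> HUniv (Suc 0)" "G' \<turnstile> pA \<Ztypecolon> hisset A'"
    by (auto simp: hlevel_pred_def)
  from valid_ty[OF Pi_beta.IH(2) ictx_Cons[OF G(1) A(1)]]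
    obtain B' pB where B: "ity ch B = Some B'" "iprS ch B = Some pB"
      "A' # G' \<turnstile> B' \<Ztypecolon> HUniv (Suc 0)" "A' # G' \<turnstile> pB \<Ztypecolon> hisset B'"
    by (auto simp: hlevel_pred_def)
  from valid_tm[OF Pi_beta.IH(3) ictx_Cons[OF G(1) A(1)] B(1)]
    obtain b' where b: "itm ch b = Some b'" "A' # G' \<turnstile> b' \<Ztypecolon> B'" by auto
  from valid_tm[OF Pi_beta.IH(4) G(1) A(1)]
    obtain a' where a: "itm ch a = Some a'" "G' \<turnstile> a' \<Ztypecolon> A'" by auto
  show ?case
    by (rule valid_eqI[OF G _ _ _ inst_ty[OF B(3) a(2) c] hott.pi_elim[OF hott.pi_intro[OF b(2)] a(2)]
        inst_tm[OF b(2) a(2) c] hott.pi_beta[OF b(2) a(2)]])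
      (use B b a in \<open>simp_all add: i_inst\<close>)
next
  case (All_intro G A B b)
  from valid_ctx[OF All_intro.IH(1)] obtain G' where G: "ictx ch G = Some G'" "wf G'" by auto
  note c = wf_ctx[OF G(2)]
  from valid_ty[OF All_intro.IH(1) G(1)]
    obtain A' pA where A: "ity ch A = Some A'" "iprS ch A = Some pA"
      "G' \<turnstile> A' \<Ztypecolon> HUniv (Suc 0)" "G' \<turnstile> pA \<Ztypecolon> hisset A'"
    by (auto simp: hlevel_pred_def)
  from valid_ty[OF All_intro.IH(2) ictx_Cons[OF G(1) A(1)]]
    obtain B' pB where B: "ity ch B = Some B'" "iprP ch B = Some pB"
      "A' # G' \<turnstile> B' \<Ztypecolon> HUniv (Suc 0)" "A' # G' \<turnstile> pB \<Ztypecolon> hisprop B'"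
    by (auto simp: hlevel_pred_def)
  from valid_tm[OF All_intro.IH(3) ictx_Cons[OF G(1) A(1)] B(1)]
    obtain b' where b: "itm ch b = Some b'" "A' # G' \<turnstile> b' \<Ztypecolon> B'" by auto
  show ?case
    by (rule valid_tmI[OF G _ _ hott.pi_form[OF A(3) B(3)] hott.pi_intro[OF b(2)]])
      (use A B b in \<open>simp_all add: i_inst\<close>)
next
  case (All_elim G A B f a)
  from valid_ctx[OF All_elim.IH(1)] obtain G' where G: "ictx ch G = Some G'" "wf G'" by auto
  note c = wf_ctx[OF G(2)]
  from valid_ty[OF All_elim.IH(1) G(1)]
    obtain A' pA where A: "ity ch A = Some A'" "iprS ch A = Some pA"
      "G' \<turnstile> A' \<Ztypecolon> HUniv (Suc 0)" "G' \<turnstile> pA \<Ztypecolon> hisset A'"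
    by (auto simp: hlevel_pred_def)
  from valid_ty[OF All_elim.IH(2) ictx_Cons[OF G(1) A(1)]]
    obtain B' pB where B: "ity ch B = Some B'" "iprP ch B = Some pB"
      "A' # G' \<turnstile> B' \<Ztypecolon> HUniv (Suc 0)" "A' # G' \<turnstile> pB \<Ztypecolon> hisprop B'"
    by (auto simp: hlevel_pred_def)
  have S: "ity ch (TAll A B) = Some (HPi A' B')"
    using A B by simp
  from valid_tm[OF All_elim.IH(3) G(1) S]
    obtain f' where f: "itm ch f = Some f'" "G' \<turnstile> f' \<Ztypecolon> HPi A' B'" by auto
  from valid_tm[OF All_elim.IH(4) G(1) A(1)]
    obtain a' where a: "itm ch a = Some a'" "G' \<turnstile> a' \<Ztypecolon> A'" by auto
  show ?case
    by (rule valid_tmI[OF G _ _ inst_ty[OF B(3) a(2) c] hott.pi_elim[OF f(2) a(2)]])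
      (use B f a in \<open>simp_all add: i_inst\<close>)
next
  case (All_beta G A B b a)
  from valid_ctx[OF All_beta.IH(1)] obtain G' where G: "ictx ch G = Some G'" "wf G'" by auto
  note c = wf_ctx[OF G(2)]
  from valid_ty[OF All_beta.IH(1) G(1)]
    obtain A' pA where A: "ity ch A = Some A'" "iprS ch A = Some pA"
      "G' \<turnstile> A' \<Ztypecolon> HUniv (Suc 0)" "G' \<turnstile> pA \<Ztypecolon> hisset A'"
    by (auto simp: hlevel_pred_def)
  from valid_ty[OF All_beta.IH(2) ictx_Cons[OF G(1) A(1)]]
    obtain B' pB where B: "ity ch B = Some B'" "iprP ch B = Some pB"
      "A' # G' \<turnstile> B' \<Ztypecolon> HUniv (Suc 0)" "A' # G' \<turnstile> pB \<Ztypecolon> hisprop B'"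
    by (auto simp: hlevel_pred_def)
  from valid_tm[OF All_beta.IH(3) ictx_Cons[OF G(1) A(1)] B(1)]
    obtain b' where b: "itm ch b = Some b'" "A' # G' \<turnstile> b' \<Ztypecolon> B'" by auto
  from valid_tm[OF All_beta.IH(4) G(1) A(1)]
    obtain a' where a: "itm ch a = Some a'" "G' \<turnstile> a' \<Ztypecolon> A'" by auto
  show ?case
    by (rule valid_eqI[OF G _ _ _ inst_ty[OF B(3) a(2) c] hott.pi_elim[OF hott.pi_intro[OF b(2)] a(2)]
        inst_tm[OF b(2) a(2) c] hott.pi_beta[OF b(2) a(2)]])
      (use B b a in \<open>simp_all add: i_inst\<close>)
next
  case (FunProps_intro G A p)
  from valid_ctx[OF FunProps_intro.IH(1)] obtain G' where G: "ictx ch G = Some G'" "wf G'" by auto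
  note c = wf_ctx[OF G(2)]
  from valid_ty[OF FunProps_intro.IH(1) G(1)]
    obtain A' pA where A: "ity ch A = Some A'" "iprS ch A = Some pA"
      "G' \<turnstile> A' \<Ztypecolon> HUniv (Suc 0)" "G' \<turnstile> pA \<Ztypecolon> hisset A'"
    by (auto simp: hlevel_pred_def)
  have H: "G' \<turnstile> hPROP 0 \<Ztypecolon> HUniv (Suc 0)" "A' # G' \<turnstile> hPROP 0 \<Ztypecolon> HUniv (Suc 0)"
    using hPROP_form[OF c, of 0] hPROP_form[OF hott.ctx_ext[OF A(3)], of 0] by simp_all
  \<comment> \<open>\<open>hPROP 0\<close> is closed, so the arrow is a plain \<open>HPi\<close> and
    the rules for products apply directly.\<close>
  have S: "ity ch (TFunProps A) = Some (HPi A' (hPROP 0))"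
    using A by (simp add: hfun_def hwk_sub hPROP_sub)
  from valid_tm[OF FunProps_intro.IH(2) ictx_Cons[OF G(1) A(1)] ity.simps(7)]
    obtain p' where p: "itm ch p = Some p'" "A' # G' \<turnstile> p' \<Ztypecolon> hPROP 0" by auto
  show ?case
    by (rule valid_tmI[OF G _ _ hott.pi_form[OF A(3) H(2)] hott.pi_intro[OF p(2)]])
      (use S p in \<open>simp_all add: i_inst\<close>)
next
  case (FunProps_elim G A f a)
  from valid_ctx[OF FunProps_elim.IH(1)] obtain G' where G: "ictx ch G = Some G'" "wf G'" by auto
  note c = wf_ctx[OF G(2)]
  from valid_ty[OF FunProps_elim.IH(1) G(1)]
    obtain A' pA where A: "ity ch A = Some A'" "iprS ch A = Some pA"
      "G' \<turnstile> A' \<Ztypecolon> HUniv (Suc 0)" "G' \<turnstile> pA \<Ztypecolon> hisset A'"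
    by (auto simp: hlevel_pred_def)
  have H: "G' \<turnstile> hPROP 0 \<Ztypecolon> HUniv (Suc 0)" "A' # G' \<turnstile> hPROP 0 \<Ztypecolon> HUniv (Suc 0)"
    using hPROP_form[OF c, of 0] hPROP_form[OF hott.ctx_ext[OF A(3)], of 0] by simp_all
  have S: "ity ch (TFunProps A) = Some (HPi A' (hPROP 0))"
    using A by (simp add: hfun_def hwk_sub hPROP_sub)
  from valid_tm[OF FunProps_elim.IH(2) G(1) S]
    obtain f' where f: "itm ch f = Some f'" "G' \<turnstile> f' \<Ztypecolon> HPi A' (hPROP 0)" by auto
  from valid_tm[OF FunProps_elim.IH(3) G(1) A(1)]
    obtain a' where a: "itm ch a = Some a'" "G' \<turnstile> a' \<Ztypecolon> A'" by auto
  show ?case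
    by (rule valid_tmI[OF G _ _ H(1) hott.pi_elim[OF f(2) a(2), unfolded hPROP_sub]])
      (use f a in \<open>simp_all add: i_inst\<close>)
next
  case (FunProps_beta G A p a)
  from valid_ctx[OF FunProps_beta.IH(1)] obtain G' where G: "ictx ch G = Some G'" "wf G'" by auto
  note c = wf_ctx[OF G(2)]
  from valid_ty[OF FunProps_beta.IH(1) G(1)]
    obtain A' pA where A: "ity ch A = Some A'" "iprS ch A = Some pA"
      "G' \<turnstile> A' \<Ztypecolon> HUniv (Suc 0)" "G' \<turnstile> pA \<Ztypecolon> hisset A'"
    by (auto simp: hlevel_pred_def)
  have H: "G' \<turnstile> hPROP 0 \<Ztypecolon> HUniv (Suc 0)" "A' # G' \<turnstile> hPROP 0 \<Ztypecolon> HUniv (Suc 0)"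
    using hPROP_form[OF c, of 0] hPROP_form[OF hott.ctx_ext[OF A(3)], of 0] by simp_all
  have S: "ity ch (TFunProps A) = Some (HPi A' (hPROP 0))"
    using A by (simp add: hfun_def hwk_sub hPROP_sub)
  from valid_tm[OF FunProps_beta.IH(2) ictx_Cons[OF G(1) A(1)] ity.simps(7)]
    obtain p' where p: "itm ch p = Some p'" "A' # G' \<turnstile> p' \<Ztypecolon> hPROP 0" by auto
  from valid_tm[OF FunProps_beta.IH(3) G(1) A(1)]
    obtain a' where a: "itm ch a = Some a'" "G' \<turnstile> a' \<Ztypecolon> A'" by auto
  show ?case
    by (rule valid_eqI[OF G _ _ _ H(1) hott.pi_elim[OF hott.pi_intro[OF p(2)] a(2), unfolded hPROP_sub]
        inst_tm[OF p(2) a(2) c, unfolded hPROP_sub] hott.pi_beta[OF p(2) a(2), unfolded hPROP_sub]])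
      (use p a in \<open>simp_all add: i_inst\<close>)
next

  \<comment> \<open>Proof terms of falsum and disjunction\<close>
  case (Bot_elim G C d)
  from valid_ctx[OF Bot_elim.IH(1)] obtain G' where G: "ictx ch G = Some G'" "wf G'" by auto
  note c = wf_ctx[OF G(2)]
  from valid_ty[OF Bot_elim.IH(1) G(1)]
    obtain C' pC where C: "ity ch C = Some C'" "iprP ch C = Some pC"
      "G' \<turnstile> C' \<Ztypecolon> HUniv (Suc 0)" "G' \<turnstile> pC \<Ztypecolon> hisprop C'"
    by (auto simp: hlevel_pred_def)
  from valid_tm[OF Bot_elim.IH(2) G(1) ity.simps(9)]
    obtain d' where d: "itm ch d = Some d'" "G' \<turnstile> d' \<Ztypecolon> HEmpty" by auto
  \<comment> \<open>The target of this eliminator does not mention the refuted proof, so the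
    dependent rule is used with a weakened motive.\<close>
  have C1: "HEmpty # G' \<turnstile> hwk 1 C' \<Ztypecolon> HUniv (Suc 0)"
    by (rule wk1_ty[OF C(3) hott.empty_form[OF c, of 0]])
  have e: "G' \<turnstile> HIndEmpty d' \<Ztypecolon> C'"
    using hott.empty_elim[OF C1 d(2)] by (simp add: sub_simps)
  show ?case
    by (rule valid_tmI[OF G _ _ C(3) e])
      (use C d in \<open>simp_all add: i_inst\<close>)
next
  case (Or_inl G A B a)
  from valid_ctx[OF Or_inl.IH(1)] obtain G' where G: "ictx ch G = Some G'" "wf G'" by auto
  note c = wf_ctx[OF G(2)]
  from valid_ty[OF Or_inl.IH(1) G(1)]
    obtain A' pA where A: "ity ch A = Some A'" "iprP ch A = Some pA"
      "G' \<turnstile> A' \<Ztypecolon> HUniv (Suc 0)" "G' \<turnstile> pA \<Ztypecolon> hisprop A'"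
      "tyeq SProp G' A' pA A' pA" "wf (A' # G')"
    by (auto simp: hlevel_pred_def)
  from valid_ty[OF Or_inl.IH(2) G(1)]
    obtain B' pB where B: "ity ch B = Some B'" "iprP ch B = Some pB"
      "G' \<turnstile> B' \<Ztypecolon> HUniv (Suc 0)" "G' \<turnstile> pB \<Ztypecolon> hisprop B'"
      "tyeq SProp G' B' pB B' pB" "wf (B' # G')"
    by (auto simp: hlevel_pred_def)
  from valid_tm[OF Or_inl.IH(3) G(1) A(1)]
    obtain a' where t: "itm ch a = Some a'" "G' \<turnstile> a' \<Ztypecolon> A'" by auto
  show ?case
    by (rule valid_tmI[OF G _ _ tyeqD(3)[OF G(2) tyeq_Or[OF G(2) _ A(5) B(5)], simplified] hott.trunc_intro[OF hott.sum_inl[OF B(3) t(2)], folded hor_def hinl_or_def hinr_or_def]])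
      (use A B t in \<open>simp_all add: i_inst\<close>)
next
  case (Or_inr G A B b)
  from valid_ctx[OF Or_inr.IH(1)] obtain G' where G: "ictx ch G = Some G'" "wf G'" by auto
  note c = wf_ctx[OF G(2)]
  from valid_ty[OF Or_inr.IH(1) G(1)]
    obtain A' pA where A: "ity ch A = Some A'" "iprP ch A = Some pA"
      "G' \<turnstile> A' \<Ztypecolon> HUniv (Suc 0)" "G' \<turnstile> pA \<Ztypecolon> hisprop A'"
      "tyeq SProp G' A' pA A' pA" "wf (A' # G')"
    by (auto simp: hlevel_pred_def)
  from valid_ty[OF Or_inr.IH(2) G(1)]
    obtain B' pB where B: "ity ch B = Some B'" "iprP ch B = Some pB"
      "G' \<turnstile> B' \<Ztypecolon> HUniv (Suc 0)" "G' \<turnstile> pB \<Ztypecolon> hisprop B'"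
      "tyeq SProp G' B' pB B' pB" "wf (B' # G')"
    by (auto simp: hlevel_pred_def)
  from valid_tm[OF Or_inr.IH(3) G(1) B(1)]
    obtain b' where t: "itm ch b = Some b'" "G' \<turnstile> b' \<Ztypecolon> B'" by auto
  show ?case
    by (rule valid_tmI[OF G _ _ tyeqD(3)[OF G(2) tyeq_Or[OF G(2) _ A(5) B(5)], simplified] hott.trunc_intro[OF hott.sum_inr[OF A(3) t(2)], folded hor_def hinl_or_def hinr_or_def]])
      (use A B t in \<open>simp_all add: i_inst\<close>)
next
  case (Or_elim G A B C d l r)
  from valid_ctx[OF Or_elim.IH(1)] obtain G' where G: "ictx ch G = Some G'" "wf G'" by auto
  note c = wf_ctx[OF G(2)]
  from valid_ty[OF Or_elim.IH(1) G(1)]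
    obtain A' pA where A: "ity ch A = Some A'" "iprP ch A = Some pA"
      "G' \<turnstile> A' \<Ztypecolon> HUniv (Suc 0)" "G' \<turnstile> pA \<Ztypecolon> hisprop A'"
    by (auto simp: hlevel_pred_def)
  from valid_ty[OF Or_elim.IH(2) G(1)]
    obtain B' pB where B: "ity ch B = Some B'" "iprP ch B = Some pB"
      "G' \<turnstile> B' \<Ztypecolon> HUniv (Suc 0)" "G' \<turnstile> pB \<Ztypecolon> hisprop B'"
    by (auto simp: hlevel_pred_def)
  from valid_ty[OF Or_elim.IH(3) G(1)]
    obtain C' pC where C: "ity ch C = Some C'" "iprP ch C = Some pC"
      "G' \<turnstile> C' \<Ztypecolon> HUniv (Suc 0)" "G' \<turnstile> pC \<Ztypecolon> hisprop C'"
    by (auto simp: hlevel_pred_def)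
  have S: "ity ch (TOr A B) = Some (hor A' B')"
    using A B by simp
  from valid_tm[OF Or_elim.IH(4) G(1) S]
    obtain d' where d: "itm ch d = Some d'" "G' \<turnstile> d' \<Ztypecolon> hor A' B'" by auto
  from valid_tm[OF Or_elim.IH(5) ictx_Cons[OF G(1) A(1)] i_ty_ren[OF C(1)]]
    obtain l' where l: "itm ch l = Some l'" "A' # G' \<turnstile> l' \<Ztypecolon> hwk 1 C'" by auto
  from valid_tm[OF Or_elim.IH(6) ictx_Cons[OF G(1) B(1)] i_ty_ren[OF C(1)]]
    obtain r' where r: "itm ch r = Some r'" "B' # G' \<turnstile> r' \<Ztypecolon> hwk 1 C'" by auto
  note el = or_elim[OF A(3) B(3) C(3) l(2) r(2) C(4)]
  show ?case
    by (rule valid_tmI[OF G _ _ C(3) el(1)[OF d(2)]])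
      (use C d l r in \<open>simp_all add: i_inst\<close>)
next
  case (Or_beta_inl G A B C a l r)
  from valid_ctx[OF Or_beta_inl.IH(1)] obtain G' where G: "ictx ch G = Some G'" "wf G'" by auto
  note c = wf_ctx[OF G(2)]
  from valid_ty[OF Or_beta_inl.IH(1) G(1)]
    obtain A' pA where A: "ity ch A = Some A'" "iprP ch A = Some pA"
      "G' \<turnstile> A' \<Ztypecolon> HUniv (Suc 0)" "G' \<turnstile> pA \<Ztypecolon> hisprop A'"
    by (auto simp: hlevel_pred_def)
  from valid_ty[OF Or_beta_inl.IH(2) G(1)]
    obtain B' pB where B: "ity ch B = Some B'" "iprP ch B = Some pB"
      "G' \<turnstile> B' \<Ztypecolon> HUniv (Suc 0)" "G' \<turnstile> pB \<Ztypecolon> hisprop B'"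
    by (auto simp: hlevel_pred_def)
  from valid_ty[OF Or_beta_inl.IH(3) G(1)]
    obtain C' pC where C: "ity ch C = Some C'" "iprP ch C = Some pC"
      "G' \<turnstile> C' \<Ztypecolon> HUniv (Suc 0)" "G' \<turnstile> pC \<Ztypecolon> hisprop C'"
    by (auto simp: hlevel_pred_def)
  have S: "ity ch (TOr A B) = Some (hor A' B')"
    using A B by simp
  from valid_tm[OF Or_beta_inl.IH(4) G(1) A(1)]
    obtain a' where d: "itm ch a = Some a'" "G' \<turnstile> a' \<Ztypecolon> A'" by auto
  from valid_tm[OF Or_beta_inl.IH(5) ictx_Cons[OF G(1) A(1)] i_ty_ren[OF C(1)]]
    obtain l' where l: "itm ch l = Some l'" "A' # G' \<turnstile> l' \<Ztypecolon> hwk 1 C'" by auto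
  from valid_tm[OF Or_beta_inl.IH(6) ictx_Cons[OF G(1) B(1)] i_ty_ren[OF C(1)]]
    obtain r' where r: "itm ch r = Some r'" "B' # G' \<turnstile> r' \<Ztypecolon> hwk 1 C'" by auto
  note el = or_elim[OF A(3) B(3) C(3) l(2) r(2) C(4)]
  have i: "G' \<turnstile> hinl_or a' \<Ztypecolon> hor A' B'"
    unfolding hinl_or_def hor_def by (rule hott.trunc_intro[OF hott.sum_inl[OF B(3) d(2)]])
  have r2: "G' \<turnstile> hinst l' a' \<Ztypecolon> C'"
    using inst_tm[OF l(2) d(2) c] by (simp add: sub_simps)
  show ?case
    by (rule valid_eqI[OF G _ _ _ C(3) el(1)[OF i]
        r2 el(2)[OF d(2)]])
      (use C d l r in \<open>simp_all add: i_inst\<close>)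
next
  case (Or_beta_inr G A B C b l r)
  from valid_ctx[OF Or_beta_inr.IH(1)] obtain G' where G: "ictx ch G = Some G'" "wf G'" by auto
  note c = wf_ctx[OF G(2)]
  from valid_ty[OF Or_beta_inr.IH(1) G(1)]
    obtain A' pA where A: "ity ch A = Some A'" "iprP ch A = Some pA"
      "G' \<turnstile> A' \<Ztypecolon> HUniv (Suc 0)" "G' \<turnstile> pA \<Ztypecolon> hisprop A'"
    by (auto simp: hlevel_pred_def)
  from valid_ty[OF Or_beta_inr.IH(2) G(1)]
    obtain B' pB where B: "ity ch B = Some B'" "iprP ch B = Some pB"
      "G' \<turnstile> B' \<Ztypecolon> HUniv (Suc 0)" "G' \<turnstile> pB \<Ztypecolon> hisprop B'"
    by (auto simp: hlevel_pred_def)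
  from valid_ty[OF Or_beta_inr.IH(3) G(1)]
    obtain C' pC where C: "ity ch C = Some C'" "iprP ch C = Some pC"
      "G' \<turnstile> C' \<Ztypecolon> HUniv (Suc 0)" "G' \<turnstile> pC \<Ztypecolon> hisprop C'"
    by (auto simp: hlevel_pred_def)
  have S: "ity ch (TOr A B) = Some (hor A' B')"
    using A B by simp
  from valid_tm[OF Or_beta_inr.IH(4) G(1) B(1)]
    obtain b' where d: "itm ch b = Some b'" "G' \<turnstile> b' \<Ztypecolon> B'" by auto
  from valid_tm[OF Or_beta_inr.IH(5) ictx_Cons[OF G(1) A(1)] i_ty_ren[OF C(1)]]
    obtain l' where l: "itm ch l = Some l'" "A' # G' \<turnstile> l' \<Ztypecolon> hwk 1 C'" by auto
  from valid_tm[OF Or_beta_inr.IH(6) ictx_Cons[OF G(1) B(1)] i_ty_ren[OF C(1)]]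
    obtain r' where r: "itm ch r = Some r'" "B' # G' \<turnstile> r' \<Ztypecolon> hwk 1 C'" by auto
  note el = or_elim[OF A(3) B(3) C(3) l(2) r(2) C(4)]
  have i: "G' \<turnstile> hinr_or b' \<Ztypecolon> hor A' B'"
    unfolding hinr_or_def hor_def by (rule hott.trunc_intro[OF hott.sum_inr[OF A(3) d(2)]])
  have r2: "G' \<turnstile> hinst r' b' \<Ztypecolon> C'"
    using inst_tm[OF r(2) d(2) c] by (simp add: sub_simps)
  show ?case
    by (rule valid_eqI[OF G _ _ _ C(3) el(1)[OF i]
        r2 el(3)[OF d(2)]])
      (use C d l r in \<open>simp_all add: i_inst\<close>)
next

  \<comment> \<open>Proof terms of conjunction and implication\<close>
  case (And_intro G A B a b)
  from valid_ctx[OF And_intro.IH(1)] obtain G' where G: "ictx ch G = Some G'" "wf G'" by auto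
  note c = wf_ctx[OF G(2)]
  from valid_ty[OF And_intro.IH(1) G(1)]
    obtain A' pA where A: "ity ch A = Some A'" "iprP ch A = Some pA"
      "G' \<turnstile> A' \<Ztypecolon> HUniv (Suc 0)" "G' \<turnstile> pA \<Ztypecolon> hisprop A'"
    by (auto simp: hlevel_pred_def)
  from valid_ty[OF And_intro.IH(2) G(1)]
    obtain B' pB where B: "ity ch B = Some B'" "iprP ch B = Some pB"
      "G' \<turnstile> B' \<Ztypecolon> HUniv (Suc 0)" "G' \<turnstile> pB \<Ztypecolon> hisprop B'"
    by (auto simp: hlevel_pred_def)
  \<comment> \<open>Conjunction is a Sigma type with a weakened second component, as implication
    below is such a product; \<open>inst\<close> cancels the weakening against any
    instantiation.\<close>
  have B1: "A' # G' \<turnstile> hwk 1 B' \<Ztypecolon> HUniv (Suc 0)" by (rule wk1_ty[OF B(3) A(3)])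
  have inst: "hinst (hwk 1 B') x = B'" for x by (simp add: sub_simps)
  have S: "ity ch (TAnd A B) = Some (HSig A' (hwk 1 B'))"
    using A B by (simp add: hprod_def)
  from valid_tm[OF And_intro.IH(3) G(1) A(1)]
    obtain a' where a: "itm ch a = Some a'" "G' \<turnstile> a' \<Ztypecolon> A'" by auto
  from valid_tm[OF And_intro.IH(4) G(1) B(1)]
    obtain b' where b: "itm ch b = Some b'" "G' \<turnstile> b' \<Ztypecolon> B'" by auto
  have b': "G' \<turnstile> b' \<Ztypecolon> hinst (hwk 1 B') a'" unfolding inst by (rule b(2))
  note p = hott.sig_intro[OF B1 a(2) b']
  show ?case
    by (rule valid_tmI[OF G _ _ hott.sig_form[OF A(3) B1] p])
      (use S a b in \<open>simp_all add: i_inst\<close>)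
next
  case (And_elim1 G A B d)
  from valid_ctx[OF And_elim1.IH(1)] obtain G' where G: "ictx ch G = Some G'" "wf G'" by auto
  note c = wf_ctx[OF G(2)]
  from valid_ty[OF And_elim1.IH(1) G(1)]
    obtain A' pA where A: "ity ch A = Some A'" "iprP ch A = Some pA"
      "G' \<turnstile> A' \<Ztypecolon> HUniv (Suc 0)" "G' \<turnstile> pA \<Ztypecolon> hisprop A'"
    by (auto simp: hlevel_pred_def)
  from valid_ty[OF And_elim1.IH(2) G(1)]
    obtain B' pB where B: "ity ch B = Some B'" "iprP ch B = Some pB"
      "G' \<turnstile> B' \<Ztypecolon> HUniv (Suc 0)" "G' \<turnstile> pB \<Ztypecolon> hisprop B'"
    by (auto simp: hlevel_pred_def)
  have B1: "A' # G' \<turnstile> hwk 1 B' \<Ztypecolon> HUniv (Suc 0)" by (rule wk1_ty[OF B(3) A(3)])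
  have inst: "hinst (hwk 1 B') x = B'" for x by (simp add: sub_simps)
  have S: "ity ch (TAnd A B) = Some (HSig A' (hwk 1 B'))"
    using A B by (simp add: hprod_def)
  from valid_tm[OF And_elim1.IH(3) G(1) S]
    obtain d' where d: "itm ch d = Some d'" "G' \<turnstile> d' \<Ztypecolon> HSig A' (hwk 1 B')" by auto
  show ?case
    by (rule valid_tmI[OF G _ _ A(3) pr1_tm[OF A(3) B1 d(2)]])
      (use A d in \<open>simp_all add: i_inst\<close>)
next
  case (And_elim2 G A B d)
  from valid_ctx[OF And_elim2.IH(1)] obtain G' where G: "ictx ch G = Some G'" "wf G'" by auto
  note c = wf_ctx[OF G(2)]
  from valid_ty[OF And_elim2.IH(1) G(1)]
    obtain A' pA where A: "ity ch A = Some A'" "iprP ch A = Some pA"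
      "G' \<turnstile> A' \<Ztypecolon> HUniv (Suc 0)" "G' \<turnstile> pA \<Ztypecolon> hisprop A'"
    by (auto simp: hlevel_pred_def)
  from valid_ty[OF And_elim2.IH(2) G(1)]
    obtain B' pB where B: "ity ch B = Some B'" "iprP ch B = Some pB"
      "G' \<turnstile> B' \<Ztypecolon> HUniv (Suc 0)" "G' \<turnstile> pB \<Ztypecolon> hisprop B'"
    by (auto simp: hlevel_pred_def)
  have B1: "A' # G' \<turnstile> hwk 1 B' \<Ztypecolon> HUniv (Suc 0)" by (rule wk1_ty[OF B(3) A(3)])
  have inst: "hinst (hwk 1 B') x = B'" for x by (simp add: sub_simps)
  have S: "ity ch (TAnd A B) = Some (HSig A' (hwk 1 B'))"
    using A B by (simp add: hprod_def)
  from valid_tm[OF And_elim2.IH(3) G(1) S]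
    obtain d' where d: "itm ch d = Some d'" "G' \<turnstile> d' \<Ztypecolon> HSig A' (hwk 1 B')" by auto
  show ?case
    by (rule valid_tmI[OF G _ _ B(3) pr2_tm[OF G(2) A(3) B1 d(2), unfolded inst]])
      (use B d in \<open>simp_all add: i_inst\<close>)
next
  case (And_beta1 G A B a b)
  from valid_ctx[OF And_beta1.IH(1)] obtain G' where G: "ictx ch G = Some G'" "wf G'" by auto
  note c = wf_ctx[OF G(2)]
  from valid_ty[OF And_beta1.IH(1) G(1)]
    obtain A' pA where A: "ity ch A = Some A'" "iprP ch A = Some pA"
      "G' \<turnstile> A' \<Ztypecolon> HUniv (Suc 0)" "G' \<turnstile> pA \<Ztypecolon> hisprop A'"
    by (auto simp: hlevel_pred_def)
  from valid_ty[OF And_beta1.IH(2) G(1)]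
    obtain B' pB where B: "ity ch B = Some B'" "iprP ch B = Some pB"
      "G' \<turnstile> B' \<Ztypecolon> HUniv (Suc 0)" "G' \<turnstile> pB \<Ztypecolon> hisprop B'"
    by (auto simp: hlevel_pred_def)
  have B1: "A' # G' \<turnstile> hwk 1 B' \<Ztypecolon> HUniv (Suc 0)" by (rule wk1_ty[OF B(3) A(3)])
  have inst: "hinst (hwk 1 B') x = B'" for x by (simp add: sub_simps)
  have S: "ity ch (TAnd A B) = Some (HSig A' (hwk 1 B'))"
    using A B by (simp add: hprod_def)
  from valid_tm[OF And_beta1.IH(3) G(1) A(1)]
    obtain a' where a: "itm ch a = Some a'" "G' \<turnstile> a' \<Ztypecolon> A'" by auto
  from valid_tm[OF And_beta1.IH(4) G(1) B(1)]
    obtain b' where b: "itm ch b = Some b'" "G' \<turnstile> b' \<Ztypecolon> B'" by auto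
  have b': "G' \<turnstile> b' \<Ztypecolon> hinst (hwk 1 B') a'" unfolding inst by (rule b(2))
  note p = hott.sig_intro[OF B1 a(2) b']
  show ?case
    by (rule valid_eqI[OF G _ _ _ A(3) pr1_tm[OF A(3) B1 p]
        a(2) pr1_beta[OF A(3) B1 a(2) b']])
      (use A a b in \<open>simp_all add: i_inst\<close>)
next
  case (And_beta2 G A B a b)
  from valid_ctx[OF And_beta2.IH(1)] obtain G' where G: "ictx ch G = Some G'" "wf G'" by auto
  note c = wf_ctx[OF G(2)]
  from valid_ty[OF And_beta2.IH(1) G(1)]
    obtain A' pA where A: "ity ch A = Some A'" "iprP ch A = Some pA"
      "G' \<turnstile> A' \<Ztypecolon> HUniv (Suc 0)" "G' \<turnstile> pA \<Ztypecolon> hisprop A'"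
    by (auto simp: hlevel_pred_def)
  from valid_ty[OF And_beta2.IH(2) G(1)]
    obtain B' pB where B: "ity ch B = Some B'" "iprP ch B = Some pB"
      "G' \<turnstile> B' \<Ztypecolon> HUniv (Suc 0)" "G' \<turnstile> pB \<Ztypecolon> hisprop B'"
    by (auto simp: hlevel_pred_def)
  have B1: "A' # G' \<turnstile> hwk 1 B' \<Ztypecolon> HUniv (Suc 0)" by (rule wk1_ty[OF B(3) A(3)])
  have inst: "hinst (hwk 1 B') x = B'" for x by (simp add: sub_simps)
  have S: "ity ch (TAnd A B) = Some (HSig A' (hwk 1 B'))"
    using A B by (simp add: hprod_def)
  from valid_tm[OF And_beta2.IH(3) G(1) A(1)]
    obtain a' where a: "itm ch a = Some a'" "G' \<turnstile> a' \<Ztypecolon> A'" by auto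
  from valid_tm[OF And_beta2.IH(4) G(1) B(1)]
    obtain b' where b: "itm ch b = Some b'" "G' \<turnstile> b' \<Ztypecolon> B'" by auto
  have b': "G' \<turnstile> b' \<Ztypecolon> hinst (hwk 1 B') a'" unfolding inst by (rule b(2))
  note p = hott.sig_intro[OF B1 a(2) b']
  show ?case
    by (rule valid_eqI[OF G _ _ _ B(3) pr2_tm[OF G(2) A(3) B1 p, unfolded inst]
        b(2) pr2_beta[OF G(2) A(3) B1 a(2) b', unfolded inst]])
      (use B a b in \<open>simp_all add: i_inst\<close>)
next
  case (Imp_intro G A B b)
  from valid_ctx[OF Imp_intro.IH(1)] obtain G' where G: "ictx ch G = Some G'" "wf G'" by auto
  note c = wf_ctx[OF G(2)]
  from valid_ty[OF Imp_intro.IH(1) G(1)]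
    obtain A' pA where A: "ity ch A = Some A'" "iprP ch A = Some pA"
      "G' \<turnstile> A' \<Ztypecolon> HUniv (Suc 0)" "G' \<turnstile> pA \<Ztypecolon> hisprop A'"
    by (auto simp: hlevel_pred_def)
  from valid_ty[OF Imp_intro.IH(2) G(1)]
    obtain B' pB where B: "ity ch B = Some B'" "iprP ch B = Some pB"
      "G' \<turnstile> B' \<Ztypecolon> HUniv (Suc 0)" "G' \<turnstile> pB \<Ztypecolon> hisprop B'"
    by (auto simp: hlevel_pred_def)
  have B1: "A' # G' \<turnstile> hwk 1 B' \<Ztypecolon> HUniv (Suc 0)" by (rule wk1_ty[OF B(3) A(3)])
  have inst: "hinst (hwk 1 B') x = B'" for x by (simp add: sub_simps)
  have S: "ity ch (TImp A B) = Some (HPi A' (hwk 1 B'))"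
    using A B by (simp add: hfun_def)
  from valid_tm[OF Imp_intro.IH(3) ictx_Cons[OF G(1) A(1)] i_ty_ren[OF B(1)]]
    obtain b' where b: "itm ch b = Some b'" "A' # G' \<turnstile> b' \<Ztypecolon> hwk 1 B'" by auto
  show ?case
    by (rule valid_tmI[OF G _ _ hott.pi_form[OF A(3) B1] hott.pi_intro[OF b(2)]])
      (use S b in \<open>simp_all add: i_inst\<close>)
next
  case (Imp_elim G A B f a)
  from valid_ctx[OF Imp_elim.IH(1)] obtain G' where G: "ictx ch G = Some G'" "wf G'" by auto
  note c = wf_ctx[OF G(2)]
  from valid_ty[OF Imp_elim.IH(1) G(1)]
    obtain A' pA where A: "ity ch A = Some A'" "iprP ch A = Some pA"
      "G' \<turnstile> A' \<Ztypecolon> HUniv (Suc 0)" "G' \<turnstile> pA \<Ztypecolon> hisprop A'"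
    by (auto simp: hlevel_pred_def)
  from valid_ty[OF Imp_elim.IH(2) G(1)]
    obtain B' pB where B: "ity ch B = Some B'" "iprP ch B = Some pB"
      "G' \<turnstile> B' \<Ztypecolon> HUniv (Suc 0)" "G' \<turnstile> pB \<Ztypecolon> hisprop B'"
    by (auto simp: hlevel_pred_def)
  have B1: "A' # G' \<turnstile> hwk 1 B' \<Ztypecolon> HUniv (Suc 0)" by (rule wk1_ty[OF B(3) A(3)])
  have inst: "hinst (hwk 1 B') x = B'" for x by (simp add: sub_simps)
  have S: "ity ch (TImp A B) = Some (HPi A' (hwk 1 B'))"
    using A B by (simp add: hfun_def)
  from valid_tm[OF Imp_elim.IH(3) G(1) S]
    obtain f' where f: "itm ch f = Some f'" "G' \<turnstile> f' \<Ztypecolon> HPi A' (hwk 1 B')" by auto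
  from valid_tm[OF Imp_elim.IH(4) G(1) A(1)]
    obtain a' where a: "itm ch a = Some a'" "G' \<turnstile> a' \<Ztypecolon> A'" by auto
  show ?case
    by (rule valid_tmI[OF G _ _ B(3) hott.pi_elim[OF f(2) a(2), unfolded inst]])
      (use B f a in \<open>simp_all add: i_inst\<close>)
next
  case (Imp_beta G A B b a)
  from valid_ctx[OF Imp_beta.IH(1)] obtain G' where G: "ictx ch G = Some G'" "wf G'" by auto
  note c = wf_ctx[OF G(2)]
  from valid_ty[OF Imp_beta.IH(1) G(1)]
    obtain A' pA where A: "ity ch A = Some A'" "iprP ch A = Some pA"
      "G' \<turnstile> A' \<Ztypecolon> HUniv (Suc 0)" "G' \<turnstile> pA \<Ztypecolon> hisprop A'"
    by (auto simp: hlevel_pred_def)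
  from valid_ty[OF Imp_beta.IH(2) G(1)]
    obtain B' pB where B: "ity ch B = Some B'" "iprP ch B = Some pB"
      "G' \<turnstile> B' \<Ztypecolon> HUniv (Suc 0)" "G' \<turnstile> pB \<Ztypecolon> hisprop B'"
    by (auto simp: hlevel_pred_def)
  have B1: "A' # G' \<turnstile> hwk 1 B' \<Ztypecolon> HUniv (Suc 0)" by (rule wk1_ty[OF B(3) A(3)])
  have inst: "hinst (hwk 1 B') x = B'" for x by (simp add: sub_simps)
  have S: "ity ch (TImp A B) = Some (HPi A' (hwk 1 B'))"
    using A B by (simp add: hfun_def)
  from valid_tm[OF Imp_beta.IH(3) ictx_Cons[OF G(1) A(1)] i_ty_ren[OF B(1)]]
    obtain b' where b: "itm ch b = Some b'" "A' # G' \<turnstile> b' \<Ztypecolon> hwk 1 B'" by auto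
  from valid_tm[OF Imp_beta.IH(4) G(1) A(1)]
    obtain a' where a: "itm ch a = Some a'" "G' \<turnstile> a' \<Ztypecolon> A'" by auto
  show ?case
    by (rule valid_eqI[OF G _ _ _ B(3) hott.pi_elim[OF hott.pi_intro[OF b(2)] a(2), unfolded inst]
        inst_tm[OF b(2) a(2) c, unfolded inst] hott.pi_beta[OF b(2) a(2), unfolded inst]])
      (use B b a in \<open>simp_all add: i_inst\<close>)
next

  \<comment> \<open>Proof terms of existential quantification\<close>
  case (Ex_intro G A B a b)
  from valid_ctx[OF Ex_intro.IH(1)] obtain G' where G: "ictx ch G = Some G'" "wf G'" by auto
  note c = wf_ctx[OF G(2)]
  from valid_ty[OF Ex_intro.IH(1) G(1)]
    obtain A' pA where A: "ity ch A = Some A'" "iprS ch A = Some pA"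
      "G' \<turnstile> A' \<Ztypecolon> HUniv (Suc 0)" "G' \<turnstile> pA \<Ztypecolon> hisset A'"
    by (auto simp: hlevel_pred_def)
  from valid_ty[OF Ex_intro.IH(2) ictx_Cons[OF G(1) A(1)]]
    obtain B' pB where B: "ity ch B = Some B'" "iprP ch B = Some pB"
      "A' # G' \<turnstile> B' \<Ztypecolon> HUniv (Suc 0)" "A' # G' \<turnstile> pB \<Ztypecolon> hisprop B'"
    by (auto simp: hlevel_pred_def)
  have S: "ity ch (TEx A B) = Some (hex A' B')"
    using A B by simp
  from valid_tm[OF Ex_intro.IH(3) G(1) A(1)]
    obtain a' where a: "itm ch a = Some a'" "G' \<turnstile> a' \<Ztypecolon> A'" by auto
  from valid_tm[OF Ex_intro.IH(4) G(1) i_inst(1)[OF a(1) B(1)]]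
    obtain b' where b: "itm ch b = Some b'" "G' \<turnstile> b' \<Ztypecolon> hinst B' a'" by auto
  have p: "G' \<turnstile> hpair_ex a' b' \<Ztypecolon> hex A' B'"
    unfolding hpair_ex_def hex_def by (rule hott.trunc_intro[OF hott.sig_intro[OF B(3) a(2) b(2)]])
  show ?case
    by (rule valid_tmI[OF G _ _ hott.trunc_form[OF hott.sig_form[OF A(3) B(3)], folded hex_def] p])
      (use S a b in \<open>simp_all add: i_inst\<close>)
next
  case (Ex_elim G A B C d c)
  from valid_ctx[OF Ex_elim.IH(1)] obtain G' where G: "ictx ch G = Some G'" "wf G'" by auto
  note c = wf_ctx[OF G(2)]
  from valid_ty[OF Ex_elim.IH(1) G(1)]
    obtain A' pA where A: "ity ch A = Some A'" "iprS ch A = Some pA"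
      "G' \<turnstile> A' \<Ztypecolon> HUniv (Suc 0)" "G' \<turnstile> pA \<Ztypecolon> hisset A'"
    by (auto simp: hlevel_pred_def)
  from valid_ty[OF Ex_elim.IH(2) ictx_Cons[OF G(1) A(1)]]
    obtain B' pB where B: "ity ch B = Some B'" "iprP ch B = Some pB"
      "A' # G' \<turnstile> B' \<Ztypecolon> HUniv (Suc 0)" "A' # G' \<turnstile> pB \<Ztypecolon> hisprop B'"
    by (auto simp: hlevel_pred_def)
  have S: "ity ch (TEx A B) = Some (hex A' B')"
    using A B by simp
  from valid_ty[OF Ex_elim.IH(3) G(1)]
    obtain C' pC where C: "ity ch C = Some C'" "iprP ch C = Some pC"
      "G' \<turnstile> C' \<Ztypecolon> HUniv (Suc 0)" "G' \<turnstile> pC \<Ztypecolon> hisprop C'"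
    by (auto simp: hlevel_pred_def)
  from valid_tm[OF Ex_elim.IH(4) G(1) S]
    obtain d' where d: "itm ch d = Some d'" "G' \<turnstile> d' \<Ztypecolon> hex A' B'" by auto
  from valid_tm[OF Ex_elim.IH(5) ictx_Cons[OF ictx_Cons[OF G(1) A(1)] B(1)] i_ty_ren[OF C(1)]]
    obtain c' where e: "itm ch c = Some c'" "B' # A' # G' \<turnstile> c' \<Ztypecolon> hwk 2 C'" by auto
  note el = ex_elim[OF A(3) B(3) C(3) e(2) C(4)]
  show ?case
    by (rule valid_tmI[OF G _ _ C(3) el(1)[OF d(2)]])
      (use C d e in \<open>simp_all add: i_inst\<close>)
next
  case (Ex_beta G A B C a b c)
  from valid_ctx[OF Ex_beta.IH(1)] obtain G' where G: "ictx ch G = Some G'" "wf G'" by auto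
  note c = wf_ctx[OF G(2)]
  from valid_ty[OF Ex_beta.IH(1) G(1)]
    obtain A' pA where A: "ity ch A = Some A'" "iprS ch A = Some pA"
      "G' \<turnstile> A' \<Ztypecolon> HUniv (Suc 0)" "G' \<turnstile> pA \<Ztypecolon> hisset A'"
    by (auto simp: hlevel_pred_def)
  from valid_ty[OF Ex_beta.IH(2) ictx_Cons[OF G(1) A(1)]]
    obtain B' pB where B: "ity ch B = Some B'" "iprP ch B = Some pB"
      "A' # G' \<turnstile> B' \<Ztypecolon> HUniv (Suc 0)" "A' # G' \<turnstile> pB \<Ztypecolon> hisprop B'"
    by (auto simp: hlevel_pred_def)
  have S: "ity ch (TEx A B) = Some (hex A' B')"
    using A B by simp
  from valid_ty[OF Ex_beta.IH(3) G(1)]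
    obtain C' pC where C: "ity ch C = Some C'" "iprP ch C = Some pC"
      "G' \<turnstile> C' \<Ztypecolon> HUniv (Suc 0)" "G' \<turnstile> pC \<Ztypecolon> hisprop C'"
    by (auto simp: hlevel_pred_def)
  from valid_tm[OF Ex_beta.IH(4) G(1) A(1)]
    obtain a' where a: "itm ch a = Some a'" "G' \<turnstile> a' \<Ztypecolon> A'" by auto
  from valid_tm[OF Ex_beta.IH(5) G(1) i_inst(1)[OF a(1) B(1)]]
    obtain b' where b: "itm ch b = Some b'" "G' \<turnstile> b' \<Ztypecolon> hinst B' a'" by auto
  have p: "G' \<turnstile> hpair_ex a' b' \<Ztypecolon> hex A' B'"
    unfolding hpair_ex_def hex_def by (rule hott.trunc_intro[OF hott.sig_intro[OF B(3) a(2) b(2)]])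
  from valid_tm[OF Ex_beta.IH(6) ictx_Cons[OF ictx_Cons[OF G(1) A(1)] B(1)] i_ty_ren[OF C(1)]]
    obtain c' where e: "itm ch c = Some c'" "B' # A' # G' \<turnstile> c' \<Ztypecolon> hwk 2 C'" by auto
  note el = ex_elim[OF A(3) B(3) C(3) e(2) C(4)]
  have "G' \<turnstile> hsub (b' \<rhd> a' \<rhd> HVar) c' \<Ztypecolon> hsub (b' \<rhd> a' \<rhd> HVar) (hwk 2 C')"
    by (rule sub_tm[OF e(2) c], intro sub_ok_scons sub_ok_id c) (use a(2) b(2) in simp_all)
  then have r: "G' \<turnstile> hsub (b' \<rhd> a' \<rhd> HVar) c' \<Ztypecolon> C'"
    by (simp add: sub_simps)
  show ?case
    by (rule valid_eqI[OF G _ _ _ C(3) el(1)[OF p]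
        r el(2)[OF a(2) b(2)]])
      (use C a b e in \<open>simp_all add: i_inst\<close>)
next

  \<comment> \<open>Proof terms of propositional identity\<close>
  case (Id_intro G A a)
  from valid_ctx[OF Id_intro.IH(1)] obtain G' where G: "ictx ch G = Some G'" "wf G'" by auto
  note c = wf_ctx[OF G(2)]
  from valid_ty[OF Id_intro.IH(1) G(1)]
    obtain A' pA where A: "ity ch A = Some A'" "iprS ch A = Some pA"
      "G' \<turnstile> A' \<Ztypecolon> HUniv (Suc 0)" "G' \<turnstile> pA \<Ztypecolon> hisset A'"
    by (auto simp: hlevel_pred_def)
  from valid_tm[OF Id_intro.IH(2) G(1) A(1)]
    obtain a' where a: "itm ch a = Some a'" "G' \<turnstile> a' \<Ztypecolon> A'" by auto
  show ?case
    by (rule valid_tmI[OF G _ _ hott.id_form[OF A(3) a(2) a(2)] hott.id_intro[OF a(2)]])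
      (use A a in \<open>simp_all add: i_inst\<close>)
next
  case (Id_elim G A a b C p c)
  from valid_ctx[OF Id_elim.IH(1)] obtain G' where G: "ictx ch G = Some G'" "wf G'" by auto
  note c = wf_ctx[OF G(2)]
  from valid_ty[OF Id_elim.IH(1) G(1)]
    obtain A' pA where A: "ity ch A = Some A'" "iprS ch A = Some pA"
      "G' \<turnstile> A' \<Ztypecolon> HUniv (Suc 0)" "G' \<turnstile> pA \<Ztypecolon> hisset A'"
    by (auto simp: hlevel_pred_def)
  from valid_tm[OF Id_elim.IH(2) G(1) A(1)]
    obtain a' where a: "itm ch a = Some a'" "G' \<turnstile> a' \<Ztypecolon> A'" by auto
  from valid_tm[OF Id_elim.IH(3) G(1) A(1)]
    obtain b' where b: "itm ch b = Some b'" "G' \<turnstile> b' \<Ztypecolon> A'" by auto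
  from valid_ty[OF Id_elim.IH(4) ictx_Cons[OF ictx_Cons[OF G(1) A(1)] i_ty_ren[OF A(1)]]]
    obtain C' pC where C: "ity ch C = Some C'" "iprP ch C = Some pC"
      "hwk 1 A' # A' # G' \<turnstile> C' \<Ztypecolon> HUniv (Suc 0)" "hwk 1 A' # A' # G' \<turnstile> pC \<Ztypecolon> hisprop C'"
    by (auto simp: hlevel_pred_def)
  have I: "ity ch (TId A a b) = Some (HId A' a' b')"
    using A a b by simp
  from valid_tm[OF Id_elim.IH(5) G(1) I]
    obtain p' where p: "itm ch p = Some p'" "G' \<turnstile> p' \<Ztypecolon> HId A' a' b'" by auto
  from valid_tm[OF Id_elim.IH(6) ictx_Cons[OF G(1) A(1)] i_inst(7)[OF C(1)]]
    obtain c' where e: "itm ch c = Some c'" "A' # G' \<turnstile> c' \<Ztypecolon> hsub (HVar 0 \<rhd> HVar 0 \<rhd> (\<lambda>n. HVar (n + 1))) C'" by auto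
  note el = path_elim[OF A(3) C(3) e(2)]
  show ?case
    by (rule valid_tmI[OF G _ _ el(1)[OF c a(2) b(2)] el(2)[OF a(2) b(2) p(2)]])
      (use C p e a b in \<open>simp_all add: i_inst\<close>)
next
  case (Id_beta G A a C c)
  from valid_ctx[OF Id_beta.IH(1)] obtain G' where G: "ictx ch G = Some G'" "wf G'" by auto
  note c = wf_ctx[OF G(2)]
  from valid_ty[OF Id_beta.IH(1) G(1)]
    obtain A' pA where A: "ity ch A = Some A'" "iprS ch A = Some pA"
      "G' \<turnstile> A' \<Ztypecolon> HUniv (Suc 0)" "G' \<turnstile> pA \<Ztypecolon> hisset A'"
    by (auto simp: hlevel_pred_def)
  from valid_tm[OF Id_beta.IH(2) G(1) A(1)]
    obtain a' where a: "itm ch a = Some a'" "G' \<turnstile> a' \<Ztypecolon> A'" by auto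
  from valid_ty[OF Id_beta.IH(3) ictx_Cons[OF ictx_Cons[OF G(1) A(1)] i_ty_ren[OF A(1)]]]
    obtain C' pC where C: "ity ch C = Some C'" "iprP ch C = Some pC"
      "hwk 1 A' # A' # G' \<turnstile> C' \<Ztypecolon> HUniv (Suc 0)" "hwk 1 A' # A' # G' \<turnstile> pC \<Ztypecolon> hisprop C'"
    by (auto simp: hlevel_pred_def)
  from valid_tm[OF Id_beta.IH(4) ictx_Cons[OF G(1) A(1)] i_inst(7)[OF C(1)]]
    obtain c' where e: "itm ch c = Some c'" "A' # G' \<turnstile> c' \<Ztypecolon> hsub (HVar 0 \<rhd> HVar 0 \<rhd> (\<lambda>n. HVar (n + 1))) C'" by auto
  note el = path_elim[OF A(3) C(3) e(2)]
  have r: "G' \<turnstile> hinst c' a' \<Ztypecolon> hsub (a' \<rhd> a' \<rhd> HVar) C'"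
    using inst_tm[OF e(2) a(2) c] by (simp add: sub_simps)
  show ?case
    by (rule valid_eqI[OF G _ _ _ el(1)[OF c a(2) a(2)] el(2)[OF a(2) a(2) hott.id_intro[OF a(2)]]
        r el(3)[OF a(2)]])
      (use C e a in \<open>simp_all add: i_inst\<close>)
next

  \<comment> \<open>Codes of small propositions and their decoding\<close>
  case (Tau_form G p)
  from valid_ctx_tm[OF Tau_form.IH(1)] obtain G' where G: "ictx ch G = Some G'" "wf G'" by auto
  note c = wf_ctx[OF G(2)]
  from valid_tm[OF Tau_form.IH(1) G(1) ity.simps(7)]
    obtain p' where p: "itm ch p = Some p'" "G' \<turnstile> p' \<Ztypecolon> hPROP 0" by auto
  show ?case
    by (rule valid_tyI[OF G _ _ tyeq_Tau[OF G(2) p(2)]]) (use p in simp_all)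
next
  case (CBot_intro G)
  from CBot_intro.IH obtain G' where G: "ictx ch G = Some G'" "wf G'" by auto
  note c = wf_ctx[OF G(2)]
  note t = tyeq_Bot[OF c]
  show ?case
    by (rule valid_tmI[OF G _ _ _ pair_PROP(1)[OF G(2) t]])
      (use hPROP_form[OF c, of 0] in simp_all)
next
  case (CBot_tau G)
  from CBot_tau.IH obtain G' where G: "ictx ch G = Some G'" "wf G'" by auto
  note c = wf_ctx[OF G(2)]
  note t = tyeq_Bot[OF c]
  show ?case
    using G pair_PROP(2)[OF G(2) t] by simp
next
  case (COr_intro G p q)
  from valid_ctx_tm[OF COr_intro.IH(1)] obtain G' where G: "ictx ch G = Some G'" "wf G'" by auto
  note c = wf_ctx[OF G(2)]
  from valid_tm[OF COr_intro.IH(1) G(1) ity.simps(7)]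
    obtain p' where p: "itm ch p = Some p'" "G' \<turnstile> p' \<Ztypecolon> hPROP 0" by auto
  from valid_tm[OF COr_intro.IH(2) G(1) ity.simps(7)]
    obtain q' where q: "itm ch q = Some q'" "G' \<turnstile> q' \<Ztypecolon> hPROP 0" by auto
  \<comment> \<open>Applied to the decoded propositions, the lemma for disjunction produces exactly
    the two components of the code. \<open>pair_PROP\<close> turns this into membership in
    \<open>hPROP 0\<close> here and into the equation for \<open>TTau\<close> in the following case;
    the other connectives repeat the pattern.\<close>
  note t = tyeq_Or[OF G(2) _ tyeq_Tau[OF G(2) p(2)] tyeq_Tau[OF G(2) q(2)], simplified]
  show ?case
    by (rule valid_tmI[OF G _ _ _ pair_PROP(1)[OF G(2) t]])
      (use hPROP_form[OF c, of 0] p q in simp_all)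
next
  case (COr_tau G p q)
  from valid_ctx_tm[OF COr_tau.IH(1)] obtain G' where G: "ictx ch G = Some G'" "wf G'" by auto
  note c = wf_ctx[OF G(2)]
  from valid_tm[OF COr_tau.IH(1) G(1) ity.simps(7)]
    obtain p' where p: "itm ch p = Some p'" "G' \<turnstile> p' \<Ztypecolon> hPROP 0" by auto
  from valid_tm[OF COr_tau.IH(2) G(1) ity.simps(7)]
    obtain q' where q: "itm ch q = Some q'" "G' \<turnstile> q' \<Ztypecolon> hPROP 0" by auto
  note t = tyeq_Or[OF G(2) _ tyeq_Tau[OF G(2) p(2)] tyeq_Tau[OF G(2) q(2)], simplified]
  show ?case
    using G pair_PROP(2)[OF G(2) t] p q by simp
next
  case (CAnd_intro G p q)
  from valid_ctx_tm[OF CAnd_intro.IH(1)] obtain G' where G: "ictx ch G = Some G'" "wf G'" by auto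
  note c = wf_ctx[OF G(2)]
  from valid_tm[OF CAnd_intro.IH(1) G(1) ity.simps(7)]
    obtain p' where p: "itm ch p = Some p'" "G' \<turnstile> p' \<Ztypecolon> hPROP 0" by auto
  from valid_tm[OF CAnd_intro.IH(2) G(1) ity.simps(7)]
    obtain q' where q: "itm ch q = Some q'" "G' \<turnstile> q' \<Ztypecolon> hPROP 0" by auto
  note t = tyeq_And[OF G(2) _ tyeq_Tau[OF G(2) p(2)] tyeq_Tau[OF G(2) q(2)], simplified]
  show ?case
    by (rule valid_tmI[OF G _ _ _ pair_PROP(1)[OF G(2) t]])
      (use hPROP_form[OF c, of 0] p q in simp_all)
next
  case (CAnd_tau G p q)
  from valid_ctx_tm[OF CAnd_tau.IH(1)] obtain G' where G: "ictx ch G = Some G'" "wf G'" by auto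
  note c = wf_ctx[OF G(2)]
  from valid_tm[OF CAnd_tau.IH(1) G(1) ity.simps(7)]
    obtain p' where p: "itm ch p = Some p'" "G' \<turnstile> p' \<Ztypecolon> hPROP 0" by auto
  from valid_tm[OF CAnd_tau.IH(2) G(1) ity.simps(7)]
    obtain q' where q: "itm ch q = Some q'" "G' \<turnstile> q' \<Ztypecolon> hPROP 0" by auto
  note t = tyeq_And[OF G(2) _ tyeq_Tau[OF G(2) p(2)] tyeq_Tau[OF G(2) q(2)], simplified]
  show ?case
    using G pair_PROP(2)[OF G(2) t] p q by simp
next
  case (CImp_intro G p q)
  from valid_ctx_tm[OF CImp_intro.IH(1)] obtain G' where G: "ictx ch G = Some G'" "wf G'" by auto
  note c = wf_ctx[OF G(2)]
  from valid_tm[OF CImp_intro.IH(1) G(1) ity.simps(7)]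
    obtain p' where p: "itm ch p = Some p'" "G' \<turnstile> p' \<Ztypecolon> hPROP 0" by auto
  from valid_tm[OF CImp_intro.IH(2) G(1) ity.simps(7)]
    obtain q' where q: "itm ch q = Some q'" "G' \<turnstile> q' \<Ztypecolon> hPROP 0" by auto
  note t = tyeq_Imp[OF G(2) _ tyeq_Tau[OF G(2) p(2)] tyeq_Tau[OF G(2) q(2)], simplified]
  show ?case
    by (rule valid_tmI[OF G _ _ _ pair_PROP(1)[OF G(2) t]])
      (use hPROP_form[OF c, of 0] p q in simp_all)
next
  case (CImp_tau G p q)
  from valid_ctx_tm[OF CImp_tau.IH(1)] obtain G' where G: "ictx ch G = Some G'" "wf G'" by auto
  note c = wf_ctx[OF G(2)]
  from valid_tm[OF CImp_tau.IH(1) G(1) ity.simps(7)]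
    obtain p' where p: "itm ch p = Some p'" "G' \<turnstile> p' \<Ztypecolon> hPROP 0" by auto
  from valid_tm[OF CImp_tau.IH(2) G(1) ity.simps(7)]
    obtain q' where q: "itm ch q = Some q'" "G' \<turnstile> q' \<Ztypecolon> hPROP 0" by auto
  note t = tyeq_Imp[OF G(2) _ tyeq_Tau[OF G(2) p(2)] tyeq_Tau[OF G(2) q(2)], simplified]
  show ?case
    using G pair_PROP(2)[OF G(2) t] p q by simp
next
  case (CEx_intro G A p)
  from valid_ctx[OF CEx_intro.IH(1)] obtain G' where G: "ictx ch G = Some G'" "wf G'" by auto
  note c = wf_ctx[OF G(2)]
  from valid_ty[OF CEx_intro.IH(1) G(1)]
    obtain A' pA where A: "ity ch A = Some A'" "iprS ch A = Some pA"
      "G' \<turnstile> A' \<Ztypecolon> HUniv (Suc 0)" "G' \<turnstile> pA \<Ztypecolon> hisset A'"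
      "tyeq SSet G' A' pA A' pA" "wf (A' # G')"
    by (auto simp: hlevel_pred_def)
  from valid_tm[OF CEx_intro.IH(2) ictx_Cons[OF G(1) A(1)] ity.simps(7)]
    obtain p' where p: "itm ch p = Some p'" "A' # G' \<turnstile> p' \<Ztypecolon> hPROP 0" by auto
  note t = tyeq_Ex[OF G(2) _ _ tyeq_Tau[OF A(6) p(2)], of pA A' pA, simplified, OF A(5)]
  show ?case
    by (rule valid_tmI[OF G _ _ _ pair_PROP(1)[OF G(2) t]])
      (use hPROP_form[OF c, of 0] A p in simp_all)
next
  case (CEx_tau G A p)
  from valid_ctx[OF CEx_tau.IH(1)] obtain G' where G: "ictx ch G = Some G'" "wf G'" by auto
  note c = wf_ctx[OF G(2)]
  from valid_ty[OF CEx_tau.IH(1) G(1)]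
    obtain A' pA where A: "ity ch A = Some A'" "iprS ch A = Some pA"
      "G' \<turnstile> A' \<Ztypecolon> HUniv (Suc 0)" "G' \<turnstile> pA \<Ztypecolon> hisset A'"
      "tyeq SSet G' A' pA A' pA" "wf (A' # G')"
    by (auto simp: hlevel_pred_def)
  from valid_tm[OF CEx_tau.IH(2) ictx_Cons[OF G(1) A(1)] ity.simps(7)]
    obtain p' where p: "itm ch p = Some p'" "A' # G' \<turnstile> p' \<Ztypecolon> hPROP 0" by auto
  note t = tyeq_Ex[OF G(2) _ _ tyeq_Tau[OF A(6) p(2)], of pA A' pA, simplified, OF A(5)]
  show ?case
    using G pair_PROP(2)[OF G(2) t] A p by simp
next
  case (CAll_intro G A p)
  from valid_ctx[OF CAll_intro.IH(1)] obtain G' where G: "ictx ch G = Some G'" "wf G'" by auto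
  note c = wf_ctx[OF G(2)]
  from valid_ty[OF CAll_intro.IH(1) G(1)]
    obtain A' pA where A: "ity ch A = Some A'" "iprS ch A = Some pA"
      "G' \<turnstile> A' \<Ztypecolon> HUniv (Suc 0)" "G' \<turnstile> pA \<Ztypecolon> hisset A'"
      "tyeq SSet G' A' pA A' pA" "wf (A' # G')"
    by (auto simp: hlevel_pred_def)
  from valid_tm[OF CAll_intro.IH(2) ictx_Cons[OF G(1) A(1)] ity.simps(7)]
    obtain p' where p: "itm ch p = Some p'" "A' # G' \<turnstile> p' \<Ztypecolon> hPROP 0" by auto
  note t = tyeq_Pi[OF G(2) _ tyeq_Tau[OF A(6) p(2)], of pA A' pA, simplified, OF A(5)]
  show ?case
    by (rule valid_tmI[OF G _ _ _ pair_PROP(1)[OF G(2) t]])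
      (use hPROP_form[OF c, of 0] A p in simp_all)
next
  case (CAll_tau G A p)
  from valid_ctx[OF CAll_tau.IH(1)] obtain G' where G: "ictx ch G = Some G'" "wf G'" by auto
  note c = wf_ctx[OF G(2)]
  from valid_ty[OF CAll_tau.IH(1) G(1)]
    obtain A' pA where A: "ity ch A = Some A'" "iprS ch A = Some pA"
      "G' \<turnstile> A' \<Ztypecolon> HUniv (Suc 0)" "G' \<turnstile> pA \<Ztypecolon> hisset A'"
      "tyeq SSet G' A' pA A' pA" "wf (A' # G')"
    by (auto simp: hlevel_pred_def)
  from valid_tm[OF CAll_tau.IH(2) ictx_Cons[OF G(1) A(1)] ity.simps(7)]
    obtain p' where p: "itm ch p = Some p'" "A' # G' \<turnstile> p' \<Ztypecolon> hPROP 0" by auto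
  note t = tyeq_Pi[OF G(2) _ tyeq_Tau[OF A(6) p(2)], of pA A' pA, simplified, OF A(5)]
  show ?case
    using G pair_PROP(2)[OF G(2) t] A p by simp
next
  case (CId_intro G A a b)
  from valid_ctx[OF CId_intro.IH(1)] obtain G' where G: "ictx ch G = Some G'" "wf G'" by auto
  note c = wf_ctx[OF G(2)]
  from valid_ty[OF CId_intro.IH(1) G(1)]
    obtain A' pA where A: "ity ch A = Some A'" "iprS ch A = Some pA"
      "G' \<turnstile> A' \<Ztypecolon> HUniv (Suc 0)" "G' \<turnstile> pA \<Ztypecolon> hisset A'"
      "tyeq SSet G' A' pA A' pA" "wf (A' # G')"
    by (auto simp: hlevel_pred_def)
  from valid_tm[OF CId_intro.IH(2) G(1) A(1)]
    obtain a' where a: "itm ch a = Some a'" "G' \<turnstile> a' \<Ztypecolon> A'" by auto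
  from valid_tm[OF CId_intro.IH(3) G(1) A(1)]
    obtain b' where b: "itm ch b = Some b'" "G' \<turnstile> b' \<Ztypecolon> A'" by auto
  note t = tyeq_Id[where s = SProps, simplified, OF G(2) A(5) a(2)[folded deq_refl] b(2)[folded deq_refl]]
  show ?case
    by (rule valid_tmI[OF G _ _ _ pair_PROP(1)[OF G(2) t]])
      (use hPROP_form[OF c, of 0] A a b in simp_all)
next
  case (CId_tau G A a b)
  from valid_ctx[OF CId_tau.IH(1)] obtain G' where G: "ictx ch G = Some G'" "wf G'" by auto
  note c = wf_ctx[OF G(2)]
  from valid_ty[OF CId_tau.IH(1) G(1)]
    obtain A' pA where A: "ity ch A = Some A'" "iprS ch A = Some pA"
      "G' \<turnstile> A' \<Ztypecolon> HUniv (Suc 0)" "G' \<turnstile> pA \<Ztypecolon> hisset A'"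
      "tyeq SSet G' A' pA A' pA" "wf (A' # G')"
    by (auto simp: hlevel_pred_def)
  from valid_tm[OF CId_tau.IH(2) G(1) A(1)]
    obtain a' where a: "itm ch a = Some a'" "G' \<turnstile> a' \<Ztypecolon> A'" by auto
  from valid_tm[OF CId_tau.IH(3) G(1) A(1)]
    obtain b' where b: "itm ch b = Some b'" "G' \<turnstile> b' \<Ztypecolon> A'" by auto
  note t = tyeq_Id[where s = SProps, simplified, OF G(2) A(5) a(2)[folded deq_refl] b(2)[folded deq_refl]]
  show ?case
    using G pair_PROP(2)[OF G(2) t] A a b by simp
qed

end

theorem theorem3p3:
  fixes E :: "hjudg set" and ch :: choice
  assumes "is_choice E ch"
  shows "(\<forall>J. mtt J \<longrightarrow> holds E ch J) \<and>
    (\<forall>G P. mtt (JTy SProp G P) \<or> mtt (JTy SProps G P) \<longrightarrow>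
      (\<exists>G' P' p. ictx ch G = Some G' \<and> ity ch P = Some P' \<and> iprP ch P = Some p \<and>
        iprS ch P = Some (happs (s_coe ch) [P', p]) \<and>
        hott E (HTm G' (happs (s_coe ch) [P', p]) (hisset P'))))"
proof (intro conjI allI impI)
  interpret hott_choice E ch by unfold_locales (rule assms)
  show "holds E ch J" if "mtt J" for J
    using that by (intro valid_holds mtt_valid)
  fix G P
  assume "mtt (JTy SProp G P) \<or> mtt (JTy SProps G P)"
  \<comment> \<open>\<open>s'\<close> is the non-propositional sort directly above:
    \<open>SCol\<close> for propositions and \<open>SSet\<close> for small ones. The claim about
    pr_S is then the subsumption of \<open>P\<close> into \<open>s'\<close>.\<close>
  then obtain s s' where s: "is_prop s" "subsort s s'" "\<not> is_prop s'" and "mtt (JTy s G P)"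
    by (metis is_prop.simps subsort.intros(1,4))
  from mtt_valid[OF this(4)] obtain G' P' p where G: "ictx ch G = Some G'" "wf G'" and
    P: "ity ch P = Some P'" "iprP ch P = Some p" "tyeq s G' P' p P' p"
    using s by (auto simp: ity_proof_def)
  have "hott E (HTm G' (happs (s_coe ch) [P', p]) (hisset P'))"
    using tyeqD(6)[OF G(2) tyeq_subsort[OF G(2) P(3) s(2)]] s by (simp add: hlevel_pred_def)
  with G P iprS_prop[OF P(2,1)]
  show "\<exists>G' P' p. ictx ch G = Some G' \<and> ity ch P = Some P' \<and> iprP ch P = Some p \<and>
      iprS ch P = Some (happs (s_coe ch) [P', p]) \<and>
      hott E (HTm G' (happs (s_coe ch) [P', p]) (hisset P'))"
    by blast
qed

end
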